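(* A parabolic Hitchin pair $(E,\phi,\epsilon,V_\bullet)$ is semistable (resp. stable), i.e. its associated decorated swamp is asymptotically $\delta_2$-semistable (resp. asymptotically $\delta_2$-stable) with $\delta_2=1/z$, if and only if the following conditions hold: (i) If $\epsilon=0$, then $\phi$ is not nilpotent. (ii) Every non-trivial proper subbundle $F\subset E$ with $\phi(F)\subset F\otimes L$ satisfies $$\frac{\mathrm{pardeg}_{\underline{\beta}}(F)}{\mathrm{rk}(F)}\ \le\ \frac{\mathrm{pardeg}_{\underline{\beta}}(E)}{\mathrm{rk}(E)}\qquad(\text{resp. }<),$$ where $$\mathrm{pardeg}_{\underline{\beta}}(F):=\deg(F)+\sum_{i=1}^k\beta_i\dim\bigl(F_{|\{x_0\}}\cap V_i\bigr).$$
   Context: Setting. $X$ is a smooth projective curve over $\mathbb{C}$ with generic point $\eta$, $x_0\in X$ a point, $\mathcal{O}_X(1)$ a fixed line bundle of degree $1$. Fix $r\in\mathbb{N}$, $d\in\mathbb{Z}$, a line bundle $L$ on $X$, integers $0<r_1<\dots<r_k<r$, and positive rationals $\beta_1,\dots,\beta_k$ with $\sum_i\beta_i<1$; let $z$ be the least common denominator of the $\beta_i$. Fix $l\in\mathbb{Z}$ with inclusions $\iota_1:L\to\mathcal{O}_X(l)$ and $\iota_2:\mathcal{O}_X\to\mathcal{O}_X(l)$. Parabolic Hitchin pairs. A parabolic Hitchin pair is $(E,\phi,\epsilon,V_\bullet)$ with $E$ a vector bundle of rank $r$ and degree $d$ on $X$, $\phi:E\to E\otimes L$ a homomorphism, $\epsilon\in\mathbb{C}$,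 with $\phi\ne0$ or $\epsilon\neq0$, and $V_\bullet$ a flag $0\subsetneq V_1\subsetneq\dots\subsetneq V_k\subsetneq E_{|\{x_0\}}$ with $\dim V_i=r_i$ and $\phi_{|\{x_0\}}(V_i)\subset V_i\otimes L_{|\{x_0\}}$. $\phi$ is nilpotent if some iterate $E\to E\otimes L^{\otimes m}$ vanishes. Associated decorated swamp. Let $\rho$ be the representation of $\mathrm{GL}(r)$ on $V_1:=\mathrm{End}(\mathbb{C}^r)^\vee\oplus\mathbb{C}$ (conjugation on the first summand, trivial on the second), and $\sigma$ the natural representation on $V_2:=\bigl(\bigotimes_{i=1}^k(\bigwedge^{r_i}\mathbb{C}^r)^{\otimes z\beta_i}\bigr)^\vee$. For a vector bundle $E$ of rank $r$, $E_\rho=\mathrm{End}(E)^\vee\oplus\mathcal{O}_X$ and $E_\sigma$ are the associated bundles. A decorated swamp is $(E,A,\varphi,s)$ with $E$ a vector bundle of rank $r$, $A$ a line bundle, $\varphi:E_\rho\to A$ a non-trivial homomorphism, and $0\neq s\in(E_{\sigma|\{x_0\}})^\vee$. The decorated swamp associated with $(E,\phi,\epsilon,V_\bullet)$ is $(E,\mathcal{O}_X(l),(\tilde\phi,\epsilon\cdot\iota_2),s)$, where $\tilde\phi$ is the composition $\mathrm{End}(E)^\vee\cong E^\vee\otimes E\xrightarrow{\mathrm{id}\otimes\phi}E^\vee\otimes E\otimes L\xrightarrow{\mathrm{tr}\otimes\iota_1}\mathcal{O}_X(l)$ (with $\mathrm{tr}$ the evaluation), and $s\in(E_{\sigma|\{x_0\}})^\vee=\bigotimes_i(\bigwedge^{r_i}E_{|\{x_0\}})^{\otimes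 z\beta_i}$ is a generator of the line $\bigotimes_i(\bigwedge^{r_i}V_i)^{\otimes z\beta_i}$ (Plücker–Segre embedding of the flag variety), well defined up to a non-zero scalar. Asymptotic stability. A weighted flag $(E_\bullet,\underline\alpha)$ of $E$ is a flag of subbundles $0=E_0\subsetneq E_1\subsetneq\dots\subsetneq E_m\subsetneq E_{m+1}=E$, $m\geq1$, with $\alpha_j\in\mathbb{Q}_{>0}$, $1\le j\le m$. Put $M(E_\bullet,\underline\alpha)=\sum_j\alpha_j(\deg(E)\mathrm{rk}(E_j)-\deg(E_j)\mathrm{rk}(E))$ and $\gamma_i=\sum_{j=1}^m\alpha_j\mathrm{rk}(E_j)-r\sum_{j= i}^m\alpha_j$ for $1\le i\le m+1$. Let $W$ be the fiber of $E$ at $\eta$ (resp. $x_0$) with the induced flag; choose a splitting $W=\bigoplus_{i=1}^{m+1}W^i$ with $W_j=\bigoplus_{i\le j}W^i$, let the rational one-parameter subgroup act on $W^i$ with weight $\gamma_i$, and let $W_\rho^\chi$ (resp. $W_\sigma^\chi$), $\chi\in\mathbb{Q}$, be the resulting weight spaces in the fiber of $E_\rho$ (resp. $E_\sigma$). Put $$\mu_1(E_\bullet,\underline\alpha,\varphi)=-\min\{\chi\mid\varphi_{\eta|W^\chi_\rho}\neq0\},\qquad\mu_2(E_\bullet,\underline\alpha,s)=-\min\{\chi\mid s_{|W_\sigma^\chi}\ne0\}$$ (independent of the splitting). $(E,A,\varphi,s)$ is asymptotically $\delta_2$-semistable (resp. stable) if for every weighted flag $(E_\bullet,\underline\alpha)$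 there is $c_1\in\mathbb{Q}_{>0}$ such that for all $\delta_1\ge c_1$ one has $M(E_\bullet,\underline\alpha)+\delta_1\mu_1(E_\bullet,\underline\alpha,\varphi)+\delta_2\mu_2(E_\bullet,\underline\alpha,s)\ge0$ (resp. $>0$). *)

theory Defs
  imports Complex_Main "Jordan_Normal_Form.Determinant"
begin

section \<open>Smooth projective curves over the complex numbers\<close>

text \<open>
  An integral scheme of finite type over the complex numbers is given by its function field
  (the type \<open>'k\<close>, with structure map \<open>emb\<close>) and the set \<open>X\<close> of its points.  On a projective
  (hence separated) integral scheme a point is determined by its local ring, a subring of the
  function field, and points are identified with their local rings.  In particular the
  generic point is \<open>UNIV :: 'k set\<close>, and a regular function on a non-empty open set \<open>U\<close> is an
  element of \<open>\<Inter>U\<close>.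
\<close>

definition complex_structure :: "(complex \<Rightarrow> 'k::field) \<Rightarrow> bool" where
  "complex_structure emb \<longleftrightarrow>
     emb 1 = 1 \<and> (\<forall>a b. emb (a + b) = emb a + emb b) \<and> (\<forall>a b. emb (a * b) = emb a * emb b)"

inductive_set generated_algebra :: "(complex \<Rightarrow> 'k::field) \<Rightarrow> 'k set \<Rightarrow> 'k set"
  for emb S where
  const: "emb c \<in> generated_algebra emb S"
| gen: "f \<in> S \<Longrightarrow> f \<in> generated_algebra emb S"
| add: "f \<in> generated_algebra emb S \<Longrightarrow> g \<in> generated_algebra emb S \<Longrightarrow>
    f + g \<in> generated_algebra emb S"
| mult: "f \<in> generated_algebra emb S \<Longrightarrow> g \<in> generated_algebra emb S \<Longrightarrow>
    f * g \<in> generated_algebra emb S"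

definition prime_ideal_in :: "'k::field set \<Rightarrow> 'k set \<Rightarrow> bool" where
  "prime_ideal_in A P \<longleftrightarrow>
     P \<subseteq> A \<and> 0 \<in> P \<and> 1 \<notin> P \<and> (\<forall>f\<in>P. \<forall>g\<in>P. f + g \<in> P) \<and> (\<forall>f\<in>A. \<forall>g\<in>P. f * g \<in> P) \<and>
     (\<forall>f\<in>A. \<forall>g\<in>A. f * g \<in> P \<longrightarrow> f \<in> P \<or> g \<in> P)"

definition localization_at :: "'k::field set \<Rightarrow> 'k set \<Rightarrow> 'k set" where
  "localization_at A P = {f / g | f g. f \<in> A \<and> g \<in> A \<and> g \<notin> P}"

text \<open>
  Integral closed subschemes of projective \<open>n\<close>-space: the generic point is a point
  \<open>(f 0 : \<dots> : f n)\<close> of projective space with coordinates in the function field, and the part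
  of \<open>X\<close> in the standard chart where the \<open>i\<close>-th homogeneous coordinate is invertible is the
  spectrum of the algebra generated by the \<open>f j / f i\<close> (empty if \<open>f i = 0\<close>).
\<close>

definition chart_algebra :: "(complex \<Rightarrow> 'k::field) \<Rightarrow> nat \<Rightarrow> (nat \<Rightarrow> 'k) \<Rightarrow> nat \<Rightarrow> 'k set" where
  "chart_algebra emb n f i = generated_algebra emb {f j / f i | j. j \<le> n}"

definition projective_variety :: "(complex \<Rightarrow> 'k::field) \<Rightarrow> 'k set set \<Rightarrow> bool" where
  "projective_variety emb X \<longleftrightarrow>
     (\<exists>n f. (\<exists>i\<le>n. f i \<noteq> 0) \<and>
        X = (\<Union>i\<in>{i. i \<le> n \<and> f i \<noteq> 0}.
              {localization_at (chart_algebra emb n f i) P | P.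
                 prime_ideal_in (chart_algebra emb n f i) P}) \<and>
        (\<forall>i\<le>n. f i \<noteq> 0 \<longrightarrow>
           (\<forall>h. \<exists>a\<in>chart_algebra emb n f i. \<exists>b\<in>chart_algebra emb n f i. b \<noteq> 0 \<and> h = a / b)))"

text \<open>The value of a valuation at \<open>0\<close> is fixed to be \<open>0\<close> only to make the valuation unique.\<close>

definition discrete_valuation_on :: "'k::field set \<Rightarrow> ('k \<Rightarrow> int) \<Rightarrow> bool" where
  "discrete_valuation_on R v \<longleftrightarrow>
     v 0 = 0 \<and>
     (\<forall>f g. f \<noteq> 0 \<longrightarrow> g \<noteq> 0 \<longrightarrow> v (f * g) = v f + v g) \<and>
     (\<forall>f g. f \<noteq> 0 \<longrightarrow> g \<noteq> 0 \<longrightarrow> f + g \<noteq> 0 \<longrightarrow> min (v f) (v g) \<le> v (f + g)) \<and>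
     (\<exists>f. f \<noteq> 0 \<and> v f = 1) \<and>
     R = {f. f = 0 \<or> 0 \<le> v f}"

definition order_of_vanishing :: "'k::field set \<Rightarrow> 'k \<Rightarrow> int" where
  "order_of_vanishing x = (THE v. discrete_valuation_on x v)"

definition maximal_ideal :: "'k::field set \<Rightarrow> 'k set" where
  "maximal_ideal x = {f \<in> x. f = 0 \<or> 1 / f \<notin> x}"

definition closed_points :: "'k::field set set \<Rightarrow> 'k set set" where
  "closed_points X = X - {UNIV}"

text \<open>
  Over the complex numbers smoothness is regularity of all local rings; the regular local rings
  of dimension at most one are the fields and the discrete valuation rings.  The existence of
  a closed point different from the generic point says that the dimension is one, not zero.
\<close>

definition smooth_projective_curve :: "(complex \<Rightarrow> 'k::field) \<Rightarrow> 'k set set \<Rightarrow> bool" where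
  "smooth_projective_curve emb X \<longleftrightarrow>
     complex_structure emb \<and> projective_variety emb X \<and> closed_points X \<noteq> {} \<and>
     (\<forall>x\<in>closed_points X. \<exists>v. discrete_valuation_on x v)"

text \<open>
  The Zariski topology: the sets of points at which a given finite set of rational functions is
  regular form a basis (among them are the spectra of the chart algebras and their principal
  open subsets).
\<close>

definition zariski_open :: "'k::field set set \<Rightarrow> 'k set set \<Rightarrow> bool" where
  "zariski_open X U \<longleftrightarrow>
     U \<subseteq> X \<and> (\<forall>x\<in>U. \<exists>S. finite S \<and> S \<subseteq> x \<and> {y\<in>X. S \<subseteq> y} \<subseteq> U)"

definition nonempty_opens :: "'k::field set set \<Rightarrow> 'k set set set" where
  "nonempty_opens X = {U. zariski_open X U \<and> U \<noteq> {}}"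

section \<open>Vector bundles\<close>

text \<open>
  Vector bundles are locally free sheaves.  As \<open>X\<close> is integral, the restriction maps of a
  locally free sheaf between non-empty open sets are injective, and the sheaf is a subsheaf of
  the constant sheaf attached to its stalk at the generic point.  So a vector bundle is
  given by the modules of sections \<open>E U\<close> inside a vector space over the function field (the
  type \<open>'v\<close> with scalar multiplication \<open>sc\<close>), restriction maps being inclusions.  Only non-empty
  open sets \<open>U\<close> are considered; the value of \<open>E\<close> elsewhere is irrelevant.
  Since non-empty open sets meet, the gluing axiom takes the form stated in \<open>is_sheaf\<close>.
  Line bundles are realised inside the function field itself, with \<open>sc = (*)\<close>.
\<close>

type_synonym ('k, 'v) subsheaf = "'k set set \<Rightarrow> 'v set"

definition structure_sheaf :: "('k::field, 'k) subsheaf" where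
  "structure_sheaf U = \<Inter>U"

definition is_sheaf ::
  "'k::field set set \<Rightarrow> ('k \<Rightarrow> 'v::ab_group_add \<Rightarrow> 'v) \<Rightarrow> ('k, 'v) subsheaf \<Rightarrow> bool" where
  "is_sheaf X sc E \<longleftrightarrow>
     (\<forall>U\<in>nonempty_opens X. 0 \<in> E U \<and> (\<forall>u\<in>E U. \<forall>v\<in>E U. u + v \<in> E U) \<and>
        (\<forall>f\<in>structure_sheaf U. \<forall>v\<in>E U. sc f v \<in> E U)) \<and>
     (\<forall>\<U>. \<U> \<noteq> {} \<longrightarrow> \<U> \<subseteq> nonempty_opens X \<longrightarrow> E (\<Union>\<U>) = (\<Inter>U\<in>\<U>. E U))"

text \<open>\<open>e 0, \<dots>, e (n-1)\<close> is a basis of sections of \<open>E\<close> over \<open>U\<close>.\<close>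

definition frame_on ::
  "'k::field set set \<Rightarrow> ('k \<Rightarrow> 'v::ab_group_add \<Rightarrow> 'v) \<Rightarrow> ('k, 'v) subsheaf \<Rightarrow>
     'k set set \<Rightarrow> nat \<Rightarrow> (nat \<Rightarrow> 'v) \<Rightarrow> bool" where
  "frame_on X sc E U n e \<longleftrightarrow>
     inj_on e {..<n} \<and> \<not> module.dependent sc (e ` {..<n}) \<and>
     (\<forall>U'\<in>nonempty_opens X. U' \<subseteq> U \<longrightarrow>
        E U' = {\<Sum>i<n. sc (f i) (e i) | f. \<forall>i<n. f i \<in> structure_sheaf U'})"

definition vector_bundle ::
  "'k::field set set \<Rightarrow> ('k \<Rightarrow> 'v::ab_group_add \<Rightarrow> 'v) \<Rightarrow> nat \<Rightarrow> ('k, 'v) subsheaf \<Rightarrow> bool" where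
  "vector_bundle X sc r E \<longleftrightarrow>
     is_sheaf X sc E \<and>
     (\<forall>x\<in>X. \<exists>U\<in>nonempty_opens X. x \<in> U \<and> (\<exists>e. frame_on X sc E U r e))"

definition line_bundle :: "'k::field set set \<Rightarrow> ('k, 'k) subsheaf \<Rightarrow> bool" where
  "line_bundle X L \<longleftrightarrow> vector_bundle X (*) 1 L"

definition stalk :: "'k::field set set \<Rightarrow> ('k, 'v) subsheaf \<Rightarrow> 'k set \<Rightarrow> 'v set" where
  "stalk X E x = \<Union>{E U | U. U \<in> nonempty_opens X \<and> x \<in> U}"

definition generic_fiber :: "'k::field set set \<Rightarrow> ('k, 'v) subsheaf \<Rightarrow> 'v set" where
  "generic_fiber X E = stalk X E UNIV"

definition bundle_rank ::
  "'k::field set set \<Rightarrow> ('k \<Rightarrow> 'v::ab_group_add \<Rightarrow> 'v) \<Rightarrow> ('k, 'v) subsheaf \<Rightarrow> nat" where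
  "bundle_rank X sc E = vector_space.dim sc (generic_fiber X E)"

text \<open>
  The degree of \<open>E\<close> is the degree of the divisor of a rational section of \<open>det E\<close>, namely of
  \<open>b 0 \<and> \<dots> \<and> b (n-1)\<close> for a basis \<open>b\<close> of the generic fiber.  Its order at \<open>x\<close> is computed in the
  generator \<open>e 0 \<and> \<dots> \<and> e (n-1)\<close> of \<open>det E\<close> attached to a frame \<open>e\<close> of \<open>E\<close> near \<open>x\<close>.
\<close>

definition order_of_det ::
  "'k::field set set \<Rightarrow> ('k \<Rightarrow> 'v::ab_group_add \<Rightarrow> 'v) \<Rightarrow> ('k, 'v) subsheaf \<Rightarrow>
     nat \<Rightarrow> (nat \<Rightarrow> 'v) \<Rightarrow> 'k set \<Rightarrow> int" where
  "order_of_det X sc E n b x =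
     (THE k. \<exists>U\<in>nonempty_opens X. \<exists>e A. x \<in> U \<and> frame_on X sc E U n e \<and>
        (\<forall>j<n. b j = (\<Sum>i<n. sc (A i j) (e i))) \<and>
        k = order_of_vanishing x (det (mat n n (\<lambda>(i, j). A i j))))"

definition degree_wrt ::
  "'k::field set set \<Rightarrow> ('k \<Rightarrow> 'v::ab_group_add \<Rightarrow> 'v) \<Rightarrow> ('k, 'v) subsheaf \<Rightarrow>
     nat \<Rightarrow> (nat \<Rightarrow> 'v) \<Rightarrow> int" where
  "degree_wrt X sc E n b =
     (\<Sum>x\<in>{x\<in>closed_points X. order_of_det X sc E n b x \<noteq> 0}. order_of_det X sc E n b x)"

definition bundle_degree ::
  "'k::field set set \<Rightarrow> ('k \<Rightarrow> 'v::ab_group_add \<Rightarrow> 'v) \<Rightarrow> ('k, 'v) subsheaf \<Rightarrow> int" where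
  "bundle_degree X sc E =
     (THE d. \<exists>b. inj_on b {..<bundle_rank X sc E} \<and>
        \<not> module.dependent sc (b ` {..<bundle_rank X sc E}) \<and>
        b ` {..<bundle_rank X sc E} \<subseteq> generic_fiber X E \<and>
        d = degree_wrt X sc E (bundle_rank X sc E) b)"

definition subsheaf_of ::
  "'k::field set set \<Rightarrow> ('k, 'v) subsheaf \<Rightarrow> ('k, 'v) subsheaf \<Rightarrow> bool" where
  "subsheaf_of X F E \<longleftrightarrow> (\<forall>U\<in>nonempty_opens X. F U \<subseteq> E U)"

definition strict_subsheaf_of ::
  "'k::field set set \<Rightarrow> ('k, 'v) subsheaf \<Rightarrow> ('k, 'v) subsheaf \<Rightarrow> bool" where
  "strict_subsheaf_of X F E \<longleftrightarrow>
     subsheaf_of X F E \<and> (\<exists>U\<in>nonempty_opens X. F U \<noteq> E U)"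

definition zero_sheaf :: "('k::field, 'v::ab_group_add) subsheaf" where
  "zero_sheaf U = {0}"

text \<open>Subbundles are the subsheaves that are locally direct summands with free complement.\<close>

definition subbundle ::
  "'k::field set set \<Rightarrow> ('k \<Rightarrow> 'v::ab_group_add \<Rightarrow> 'v) \<Rightarrow> ('k, 'v) subsheaf \<Rightarrow>
     ('k, 'v) subsheaf \<Rightarrow> bool" where
  "subbundle X sc F E \<longleftrightarrow>
     is_sheaf X sc F \<and> subsheaf_of X F E \<and>
     (\<exists>s n. s \<le> n \<and>
       (\<forall>x\<in>X. \<exists>U\<in>nonempty_opens X. x \<in> U \<and>
          (\<exists>e. frame_on X sc E U n e \<and> frame_on X sc F U s e)))"

text \<open>
  Homomorphisms \<open>E \<rightarrow> F\<close>, identified with the induced linear maps of generic fibers (which are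
  here assumed to be the full types).
\<close>

definition bundle_hom ::
  "'k::field set set \<Rightarrow> ('k \<Rightarrow> 'v::ab_group_add \<Rightarrow> 'v) \<Rightarrow> ('k, 'v) subsheaf \<Rightarrow>
     ('k \<Rightarrow> 'w::ab_group_add \<Rightarrow> 'w) \<Rightarrow> ('k, 'w) subsheaf \<Rightarrow> ('v \<Rightarrow> 'w) \<Rightarrow> bool" where
  "bundle_hom X sc E sc' F h \<longleftrightarrow>
     Vector_Spaces.linear sc sc' h \<and> (\<forall>U\<in>nonempty_opens X. h ` E U \<subseteq> F U)"

inductive_set additive_span :: "'v::ab_group_add set \<Rightarrow> 'v set" for S where
  zero: "0 \<in> additive_span S"
| base: "v \<in> S \<Longrightarrow> v \<in> additive_span S"
| add: "u \<in> additive_span S \<Longrightarrow> v \<in> additive_span S \<Longrightarrow> u + v \<in> additive_span S"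

text \<open>
  For a line bundle \<open>L\<close> inside the function field, multiplication identifies the generic fiber of
  \<open>E \<otimes> L\<close> with that of \<open>E\<close>; \<open>E \<otimes> L\<close> is the sheaf associated with the presheaf of products
  \<open>L(U) E(U)\<close>.
\<close>

definition twist ::
  "'k::field set set \<Rightarrow> ('k \<Rightarrow> 'v::ab_group_add \<Rightarrow> 'v) \<Rightarrow> ('k, 'k) subsheaf \<Rightarrow>
     ('k, 'v) subsheaf \<Rightarrow> ('k, 'v) subsheaf" where
  "twist X sc L E U =
     {v. \<forall>x\<in>U. \<exists>U'\<in>nonempty_opens X. x \<in> U' \<and> U' \<subseteq> U \<and>
           v \<in> additive_span {sc f u | f u. f \<in> L U' \<and> u \<in> E U'}}"

definition dual_line_bundle ::
  "'k::field set set \<Rightarrow> ('k, 'k) subsheaf \<Rightarrow> ('k, 'k) subsheaf" where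
  "dual_line_bundle X L U =
     {f. \<forall>U'\<in>nonempty_opens X. U' \<subseteq> U \<longrightarrow> (\<forall>g\<in>L U'. f * g \<in> structure_sheaf U')}"

definition line_bundle_power ::
  "'k::field set set \<Rightarrow> ('k, 'k) subsheaf \<Rightarrow> int \<Rightarrow> ('k, 'k) subsheaf" where
  "line_bundle_power X L l =
     (if 0 \<le> l then (twist X (*) L ^^ nat l) structure_sheaf
      else dual_line_bundle X ((twist X (*) L ^^ nat (- l)) structure_sheaf))"

text \<open>
  The fiber of \<open>E\<close> at \<open>x\<close> is \<open>E\<^sub>x / m\<^sub>x E\<^sub>x\<close>, determined up to unique isomorphism by the quotient map.
  It is presented by a complex vector space (the type \<open>'w\<close> with scalar multiplication \<open>sw\<close>)
  and a surjective map \<open>ev\<close> with this kernel.  The values of \<open>ev\<close> outside the stalk are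
  irrelevant, and the residue field of a closed point is the field of complex numbers.
\<close>

definition fiber_map ::
  "(complex \<Rightarrow> 'k::field) \<Rightarrow> 'k set set \<Rightarrow> ('k \<Rightarrow> 'v::ab_group_add \<Rightarrow> 'v) \<Rightarrow>
     ('k, 'v) subsheaf \<Rightarrow> 'k set \<Rightarrow> (complex \<Rightarrow> 'w::ab_group_add \<Rightarrow> 'w) \<Rightarrow> ('v \<Rightarrow> 'w) \<Rightarrow> bool" where
  "fiber_map emb X sc E x sw ev \<longleftrightarrow>
     (\<forall>u\<in>stalk X E x. \<forall>v\<in>stalk X E x. ev (u + v) = ev u + ev v) \<and>
     (\<forall>c. \<forall>u\<in>stalk X E x. ev (sc (emb c) u) = sw c (ev u)) \<and>
     ev ` stalk X E x = UNIV \<and>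
     {u\<in>stalk X E x. ev u = 0} =
       additive_span {sc f u | f u. f \<in> maximal_ideal x \<and> u \<in> stalk X E x}"

definition sub_fiber ::
  "'k::field set set \<Rightarrow> 'k set \<Rightarrow> ('v \<Rightarrow> 'w) \<Rightarrow> ('k, 'v) subsheaf \<Rightarrow> 'w set" where
  "sub_fiber X x ev F = ev ` stalk X F x"

section \<open>Weights of rational one-parameter subgroups\<close>

definition splitting ::
  "('a::field \<Rightarrow> 'w::ab_group_add \<Rightarrow> 'w) \<Rightarrow> nat \<Rightarrow> (nat \<Rightarrow> 'w set) \<Rightarrow> (nat \<Rightarrow> 'w set) \<Rightarrow> bool" where
  "splitting sc m W D \<longleftrightarrow>
     (\<forall>i\<in>{1..m+1}. module.subspace sc (D i)) \<and>
     (\<forall>j\<in>{1..m+1}. W j = {\<Sum>i=1..j. w i | w. \<forall>i\<in>{1..j}. w i \<in> D i}) \<and>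
     (\<forall>w. (\<forall>i\<in>{1..m+1}. w i \<in> D i) \<longrightarrow> (\<Sum>i=1..m+1. w i) = 0 \<longrightarrow> (\<forall>i\<in>{1..m+1}. w i = 0))"

text \<open>\<open>g\<close> acts on the summand \<open>D i\<close> as multiplication by the \<open>a i\<close>-th power of \<open>t\<close>.\<close>

definition one_parameter_element ::
  "('a::field \<Rightarrow> 'w::ab_group_add \<Rightarrow> 'w) \<Rightarrow> nat \<Rightarrow> (nat \<Rightarrow> 'w set) \<Rightarrow> (nat \<Rightarrow> int) \<Rightarrow> 'a \<Rightarrow>
     ('w \<Rightarrow> 'w) \<Rightarrow> bool" where
  "one_parameter_element sc m D a t g \<longleftrightarrow>
     Vector_Spaces.linear sc sc g \<and> (\<forall>i\<in>{1..m+1}. \<forall>w\<in>D i. g w = sc (t powi a i) w)"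

text \<open>
  A representation of \<open>GL\<close> of the space \<open>'w\<close> is given by its space \<open>R\<close>, its scalar multiplication
  \<open>smul\<close> and the action \<open>act\<close>.  A rational one-parameter subgroup with weights \<open>\<gamma> i\<close> becomes an
  honest one with weights \<open>q * \<gamma> i\<close> after multiplication by a common denominator \<open>q\<close>; the
  weight \<open>\<chi>\<close> then corresponds to the integral weight \<open>q * \<chi>\<close>.
\<close>

definition weight_space ::
  "('a::field \<Rightarrow> 'w::ab_group_add \<Rightarrow> 'w) \<Rightarrow> nat \<Rightarrow> (nat \<Rightarrow> 'w set) \<Rightarrow> (nat \<Rightarrow> rat) \<Rightarrow>
     'b set \<Rightarrow> ('a \<Rightarrow> 'b \<Rightarrow> 'b) \<Rightarrow> (('w \<Rightarrow> 'w) \<Rightarrow> 'b \<Rightarrow> 'b) \<Rightarrow> rat \<Rightarrow> 'b set" where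
  "weight_space sc m D \<gamma> R smul act \<chi> =
     {x\<in>R. \<exists>(q::nat) a n. 0 < q \<and> (\<forall>i\<in>{1..m+1}. of_int (a i) = of_nat q * \<gamma> i) \<and>
        of_int n = of_nat q * \<chi> \<and>
        (\<forall>t g. t \<noteq> 0 \<longrightarrow> one_parameter_element sc m D a t g \<longrightarrow> act g x = smul (t powi n) x)}"

text \<open>The value does not depend on the chosen splitting \<open>D\<close> of the filtration \<open>W\<close>.\<close>

definition minus_min_weight ::
  "('a::field \<Rightarrow> 'w::ab_group_add \<Rightarrow> 'w) \<Rightarrow> nat \<Rightarrow> (nat \<Rightarrow> 'w set) \<Rightarrow> (nat \<Rightarrow> rat) \<Rightarrow>
     'b set \<Rightarrow> ('a \<Rightarrow> 'b \<Rightarrow> 'b) \<Rightarrow> (('w \<Rightarrow> 'w) \<Rightarrow> 'b \<Rightarrow> 'b) \<Rightarrow> ('b \<Rightarrow> 'a) \<Rightarrow> rat" where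
  "minus_min_weight sc m W \<gamma> R smul act \<Phi> =
     (let D = (SOME D. splitting sc m W D)
      in - Min {\<chi>. \<exists>x\<in>weight_space sc m D \<gamma> R smul act \<chi>. \<Phi> x \<noteq> 0})"

section \<open>The representations \<open>\<rho>\<close> and \<open>\<sigma>\<close>\<close>

text \<open>
  Elements of \<open>End(V)\<^sup>\<or>\<close> are linear forms on the space of linear endomorphisms of \<open>V\<close>, extended by \<open>0\<close>
  to all functions.
\<close>

definition end_dual ::
  "('k::field \<Rightarrow> 'v::ab_group_add \<Rightarrow> 'v) \<Rightarrow> (('v \<Rightarrow> 'v) \<Rightarrow> 'k) set" where
  "end_dual sc =
     {\<xi>. (\<forall>f g. Vector_Spaces.linear sc sc f \<longrightarrow> Vector_Spaces.linear sc sc g \<longrightarrow>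
              \<xi> (\<lambda>v. f v + g v) = \<xi> f + \<xi> g) \<and>
          (\<forall>c f. Vector_Spaces.linear sc sc f \<longrightarrow> \<xi> (\<lambda>v. sc c (f v)) = c * \<xi> f) \<and>
          (\<forall>f. \<not> Vector_Spaces.linear sc sc f \<longrightarrow> \<xi> f = 0)}"

type_synonym ('k, 'v) rho_space = "(('v \<Rightarrow> 'v) \<Rightarrow> 'k) \<times> 'k"

definition rho_add ::
  "('k::field, 'v) rho_space \<Rightarrow> ('k, 'v) rho_space \<Rightarrow> ('k, 'v) rho_space" where
  "rho_add x y = ((\<lambda>f. fst x f + fst y f), snd x + snd y)"

definition rho_smul :: "'k::field \<Rightarrow> ('k, 'v) rho_space \<Rightarrow> ('k, 'v) rho_space" where
  "rho_smul c x = ((\<lambda>f. c * fst x f), c * snd x)"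

definition rho_act :: "('v \<Rightarrow> 'v) \<Rightarrow> ('k::field, 'v) rho_space \<Rightarrow> ('k, 'v) rho_space" where
  "rho_act g x = ((\<lambda>f. fst x (inv_into UNIV g \<circ> f \<circ> g)), snd x)"

definition end_sheaf ::
  "'k::field set set \<Rightarrow> ('k \<Rightarrow> 'v::ab_group_add \<Rightarrow> 'v) \<Rightarrow> ('k, 'v) subsheaf \<Rightarrow>
     ('k, 'v \<Rightarrow> 'v) subsheaf" where
  "end_sheaf X sc E U =
     {f. Vector_Spaces.linear sc sc f \<and> (\<forall>U'\<in>nonempty_opens X. U' \<subseteq> U \<longrightarrow> f ` E U' \<subseteq> E U')}"

text \<open>The bundle \<open>E\<^sub>\<rho> = End(E)\<^sup>\<or> \<oplus> O\<^sub>X\<close> inside its generic fiber.\<close>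

definition rho_bundle ::
  "'k::field set set \<Rightarrow> ('k \<Rightarrow> 'v::ab_group_add \<Rightarrow> 'v) \<Rightarrow> ('k, 'v) subsheaf \<Rightarrow>
     ('k, ('k, 'v) rho_space) subsheaf" where
  "rho_bundle X sc E U =
     {\<xi>\<in>end_dual sc. \<forall>U'\<in>nonempty_opens X. U' \<subseteq> U \<longrightarrow>
        (\<forall>f\<in>end_sheaf X sc E U'. \<xi> f \<in> structure_sheaf U')} \<times> structure_sheaf U"

definition rho_hom ::
  "'k::field set set \<Rightarrow> ('k \<Rightarrow> 'v::ab_group_add \<Rightarrow> 'v) \<Rightarrow> ('k, 'v) subsheaf \<Rightarrow>
     ('k, 'k) subsheaf \<Rightarrow> (('k, 'v) rho_space \<Rightarrow> 'k) \<Rightarrow> bool" where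
  "rho_hom X sc E A \<Phi> \<longleftrightarrow>
     (\<forall>x\<in>end_dual sc \<times> UNIV. \<forall>y\<in>end_dual sc \<times> UNIV. \<Phi> (rho_add x y) = \<Phi> x + \<Phi> y) \<and>
     (\<forall>c. \<forall>x\<in>end_dual sc \<times> UNIV. \<Phi> (rho_smul c x) = c * \<Phi> x) \<and>
     (\<forall>U\<in>nonempty_opens X. \<Phi> ` rho_bundle X sc E U \<subseteq> A U)"

text \<open>
  The dual of \<open>\<Otimes>\<^sub>i (\<And>\<^bsup>r\<^sub>i\<^esup> W)\<^bsup>\<otimes> n\<^sub>i\<^esup>\<close> is the space of multilinear forms with one argument for each position
  \<open>(i, c, p)\<close> (the \<open>p\<close>-th factor in the \<open>c\<close>-th copy of the \<open>i\<close>-th exterior power) that are alternating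
  in the arguments with the same \<open>(i, c)\<close>.  The arguments form a function on all triples of which
  only the values at the positions matter.
\<close>

definition positions :: "nat \<Rightarrow> (nat \<Rightarrow> nat) \<Rightarrow> (nat \<Rightarrow> nat) \<Rightarrow> (nat \<times> nat \<times> nat) set" where
  "positions k rs n = {(i, c, p). 1 \<le> i \<and> i \<le> k \<and> c < n i \<and> p < rs i}"

type_synonym 'w form = "(nat \<times> nat \<times> nat \<Rightarrow> 'w) \<Rightarrow> complex"

definition sigma_space ::
  "(complex \<Rightarrow> 'w::ab_group_add \<Rightarrow> 'w) \<Rightarrow> nat \<Rightarrow> (nat \<Rightarrow> nat) \<Rightarrow> (nat \<Rightarrow> nat) \<Rightarrow> 'w form set" where
  "sigma_space sw k rs n =
     {T. (\<forall>u u'. (\<forall>j\<in>positions k rs n. u j = u' j) \<longrightarrow> T u = T u') \<and>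
         (\<forall>u. \<forall>j\<in>positions k rs n. Vector_Spaces.linear sw (*) (\<lambda>w. T (u(j := w)))) \<and>
         (\<forall>u i c p q. (i, c, p) \<in> positions k rs n \<longrightarrow> (i, c, q) \<in> positions k rs n \<longrightarrow>
            p \<noteq> q \<longrightarrow> u (i, c, p) = u (i, c, q) \<longrightarrow> T u = 0)}"

definition sigma_smul :: "complex \<Rightarrow> 'w form \<Rightarrow> 'w form" where
  "sigma_smul c T = (\<lambda>u. c * T u)"

definition sigma_act :: "('w \<Rightarrow> 'w) \<Rightarrow> 'w form \<Rightarrow> 'w form" where
  "sigma_act g T = (\<lambda>u. T (inv_into UNIV g \<circ> u))"

definition sigma_functional ::
  "(complex \<Rightarrow> 'w::ab_group_add \<Rightarrow> 'w) \<Rightarrow> nat \<Rightarrow> (nat \<Rightarrow> nat) \<Rightarrow> (nat \<Rightarrow> nat) \<Rightarrow>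
     ('w form \<Rightarrow> complex) \<Rightarrow> bool" where
  "sigma_functional sw k rs n s \<longleftrightarrow>
     (\<forall>S\<in>sigma_space sw k rs n. \<forall>T\<in>sigma_space sw k rs n. s (\<lambda>u. S u + T u) = s S + s T) \<and>
     (\<forall>c. \<forall>T\<in>sigma_space sw k rs n. s (sigma_smul c T) = c * s T)"

section \<open>Decorated swamps and asymptotic stability\<close>

text \<open>
  In this section \<open>r\<close> is the rank, \<open>sw\<close>, \<open>ev\<close> present the fiber of \<open>E\<close> at \<open>x0\<close>, and \<open>k\<close>, \<open>rs\<close>, \<open>n\<close> are
  the discrete data of \<open>\<sigma>\<close>, \<open>n i\<close> being the exponent of the \<open>i\<close>-th exterior power.
\<close>

definition decorated_swamp ::
  "'k::field set set \<Rightarrow> ('k \<Rightarrow> 'v::ab_group_add \<Rightarrow> 'v) \<Rightarrow> nat \<Rightarrow>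
     (complex \<Rightarrow> 'w::ab_group_add \<Rightarrow> 'w) \<Rightarrow> nat \<Rightarrow> (nat \<Rightarrow> nat) \<Rightarrow> (nat \<Rightarrow> nat) \<Rightarrow>
     ('k, 'v) subsheaf \<Rightarrow> ('k, 'k) subsheaf \<Rightarrow> (('k, 'v) rho_space \<Rightarrow> 'k) \<Rightarrow>
     ('w form \<Rightarrow> complex) \<Rightarrow> bool" where
  "decorated_swamp X sc r sw k rs n E A \<Phi> s \<longleftrightarrow>
     vector_bundle X sc r E \<and> generic_fiber X E = UNIV \<and> line_bundle X A \<and>
     rho_hom X sc E A \<Phi> \<and> (\<exists>x\<in>end_dual sc \<times> UNIV. \<Phi> x \<noteq> 0) \<and>
     sigma_functional sw k rs n s \<and> (\<exists>T\<in>sigma_space sw k rs n. s T \<noteq> 0)"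

definition weighted_flag ::
  "'k::field set set \<Rightarrow> ('k \<Rightarrow> 'v::ab_group_add \<Rightarrow> 'v) \<Rightarrow> ('k, 'v) subsheaf \<Rightarrow> nat \<Rightarrow>
     (nat \<Rightarrow> ('k, 'v) subsheaf) \<Rightarrow> (nat \<Rightarrow> rat) \<Rightarrow> bool" where
  "weighted_flag X sc E m Es \<alpha> \<longleftrightarrow>
     1 \<le> m \<and> (\<forall>U\<in>nonempty_opens X. Es 0 U = zero_sheaf U \<and> Es (m + 1) U = E U) \<and>
     (\<forall>j\<in>{0..m+1}. subbundle X sc (Es j) E) \<and>
     (\<forall>j\<le>m. strict_subsheaf_of X (Es j) (Es (j + 1))) \<and>
     (\<forall>j\<in>{1..m}. 0 < \<alpha> j)"

definition flag_M ::
  "'k::field set set \<Rightarrow> ('k \<Rightarrow> 'v::ab_group_add \<Rightarrow> 'v) \<Rightarrow> ('k, 'v) subsheaf \<Rightarrow> nat \<Rightarrow>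
     (nat \<Rightarrow> ('k, 'v) subsheaf) \<Rightarrow> (nat \<Rightarrow> rat) \<Rightarrow> rat" where
  "flag_M X sc E m Es \<alpha> =
     (\<Sum>j=1..m. \<alpha> j * (of_int (bundle_degree X sc E) * of_nat (bundle_rank X sc (Es j))
                     - of_int (bundle_degree X sc (Es j)) * of_nat (bundle_rank X sc E)))"

definition flag_gamma ::
  "'k::field set set \<Rightarrow> ('k \<Rightarrow> 'v::ab_group_add \<Rightarrow> 'v) \<Rightarrow> nat \<Rightarrow> nat \<Rightarrow>
     (nat \<Rightarrow> ('k, 'v) subsheaf) \<Rightarrow> (nat \<Rightarrow> rat) \<Rightarrow> nat \<Rightarrow> rat" where
  "flag_gamma X sc r m Es \<alpha> i =
     (\<Sum>j=1..m. \<alpha> j * of_nat (bundle_rank X sc (Es j))) - of_nat r * (\<Sum>j=i..m. \<alpha> j)"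

definition mu1 ::
  "'k::field set set \<Rightarrow> ('k \<Rightarrow> 'v::ab_group_add \<Rightarrow> 'v) \<Rightarrow> nat \<Rightarrow> nat \<Rightarrow>
     (nat \<Rightarrow> ('k, 'v) subsheaf) \<Rightarrow> (nat \<Rightarrow> rat) \<Rightarrow> (('k, 'v) rho_space \<Rightarrow> 'k) \<Rightarrow> rat" where
  "mu1 X sc r m Es \<alpha> \<Phi> =
     minus_min_weight sc m (\<lambda>j. generic_fiber X (Es j)) (flag_gamma X sc r m Es \<alpha>)
       (end_dual sc \<times> UNIV) rho_smul rho_act \<Phi>"

definition mu2 ::
  "'k::field set set \<Rightarrow> ('k \<Rightarrow> 'v::ab_group_add \<Rightarrow> 'v) \<Rightarrow> nat \<Rightarrow> 'k set \<Rightarrow>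
     (complex \<Rightarrow> 'w::ab_group_add \<Rightarrow> 'w) \<Rightarrow> ('v \<Rightarrow> 'w) \<Rightarrow> nat \<Rightarrow> (nat \<Rightarrow> nat) \<Rightarrow> (nat \<Rightarrow> nat) \<Rightarrow>
     nat \<Rightarrow> (nat \<Rightarrow> ('k, 'v) subsheaf) \<Rightarrow> (nat \<Rightarrow> rat) \<Rightarrow> ('w form \<Rightarrow> complex) \<Rightarrow> rat" where
  "mu2 X sc r x0 sw ev k rs n m Es \<alpha> s =
     minus_min_weight sw m (\<lambda>j. sub_fiber X x0 ev (Es j)) (flag_gamma X sc r m Es \<alpha>)
       (sigma_space sw k rs n) sigma_smul sigma_act s"

text \<open>Here \<open>cmp\<close> is \<open>(\<le>)\<close> for semistability and \<open>(<)\<close> for stability.\<close>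

definition asymptotic_condition ::
  "(rat \<Rightarrow> rat \<Rightarrow> bool) \<Rightarrow> 'k::field set set \<Rightarrow> ('k \<Rightarrow> 'v::ab_group_add \<Rightarrow> 'v) \<Rightarrow> nat \<Rightarrow> 'k set \<Rightarrow>
     (complex \<Rightarrow> 'w::ab_group_add \<Rightarrow> 'w) \<Rightarrow> ('v \<Rightarrow> 'w) \<Rightarrow> nat \<Rightarrow> (nat \<Rightarrow> nat) \<Rightarrow> (nat \<Rightarrow> nat) \<Rightarrow>
     rat \<Rightarrow> ('k, 'v) subsheaf \<Rightarrow> ('k, 'k) subsheaf \<Rightarrow> (('k, 'v) rho_space \<Rightarrow> 'k) \<Rightarrow>
     ('w form \<Rightarrow> complex) \<Rightarrow> bool" where
  "asymptotic_condition cmp X sc r x0 sw ev k rs n \<delta>2 E A \<Phi> s \<longleftrightarrow>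
     decorated_swamp X sc r sw k rs n E A \<Phi> s \<and>
     (\<forall>m Es \<alpha>. weighted_flag X sc E m Es \<alpha> \<longrightarrow>
        (\<exists>c1>0. \<forall>\<delta>1\<ge>c1.
           cmp 0 (flag_M X sc E m Es \<alpha> + \<delta>1 * mu1 X sc r m Es \<alpha> \<Phi>
                    + \<delta>2 * mu2 X sc r x0 sw ev k rs n m Es \<alpha> s)))"

abbreviation asymptotically_semistable where
  "asymptotically_semistable \<equiv> asymptotic_condition (\<le>)"

abbreviation asymptotically_stable where
  "asymptotically_stable \<equiv> asymptotic_condition (<)"

section \<open>Parabolic Hitchin pairs\<close>

definition common_denominator :: "nat \<Rightarrow> (nat \<Rightarrow> rat) \<Rightarrow> nat" where
  "common_denominator k \<beta> = (LEAST z. 0 < z \<and> (\<forall>i\<in>{1..k}. of_nat z * \<beta> i \<in> \<int>))"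

definition exponent :: "nat \<Rightarrow> (nat \<Rightarrow> rat) \<Rightarrow> nat \<Rightarrow> nat" where
  "exponent k \<beta> i = nat \<lfloor>of_nat (common_denominator k \<beta>) * \<beta> i\<rfloor>"

text \<open>
  The condition that the fiber of \<open>\<phi>\<close> at \<open>x0\<close> maps \<open>V\<^sub>i\<close> into \<open>V\<^sub>i \<otimes> L\<close> is expressed on the stalk, through
  the preimage of \<open>V\<^sub>i\<close> under the quotient map \<open>ev\<close>.  The product of \<open>L\<close> with this preimage is
  the preimage of \<open>V\<^sub>i \<otimes> L\<close>, as it contains the product with \<open>m\<^sub>x E\<^sub>x\<close>.
\<close>

definition parabolic_Hitchin_pair ::
  "'k::field set set \<Rightarrow> ('k, 'k) subsheaf \<Rightarrow> ('k \<Rightarrow> 'v::ab_group_add \<Rightarrow> 'v) \<Rightarrow> nat \<Rightarrow> int \<Rightarrow> 'k set \<Rightarrow>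
     (complex \<Rightarrow> 'w::ab_group_add \<Rightarrow> 'w) \<Rightarrow> ('v \<Rightarrow> 'w) \<Rightarrow> nat \<Rightarrow> (nat \<Rightarrow> nat) \<Rightarrow>
     ('k, 'v) subsheaf \<Rightarrow> ('v \<Rightarrow> 'v) \<Rightarrow> complex \<Rightarrow> (nat \<Rightarrow> 'w set) \<Rightarrow> bool" where
  "parabolic_Hitchin_pair X L sc r d x0 sw ev k rs E \<phi> \<epsilon> V \<longleftrightarrow>
     vector_bundle X sc r E \<and> generic_fiber X E = UNIV \<and> bundle_degree X sc E = d \<and>
     bundle_hom X sc E sc (twist X sc L E) \<phi> \<and>
     (\<phi> \<noteq> (\<lambda>_. 0) \<or> \<epsilon> \<noteq> 0) \<and>
     (\<forall>i\<in>{1..k}. module.subspace sw (V i) \<and> {0} \<subset> V i \<and> V i \<subset> UNIV \<and>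
        vector_space.dim sw (V i) = rs i) \<and>
     (\<forall>i\<in>{1..<k}. V i \<subset> V (i + 1)) \<and>
     (\<forall>i\<in>{1..k}. \<forall>u\<in>stalk X E x0. ev u \<in> V i \<longrightarrow>
        \<phi> u \<in> additive_span {sc f w | f w. f \<in> stalk X L x0 \<and> w \<in> stalk X E x0 \<and> ev w \<in> V i})"

text \<open>
  With \<open>E \<otimes> L\<^sup>m\<close> realised in the generic fiber of \<open>E\<close>, the iterate \<open>E \<rightarrow> E \<otimes> L\<^sup>m\<close> is the \<open>m\<close>-fold
  composition.
\<close>

definition nilpotent_hom :: "('v::ab_group_add \<Rightarrow> 'v) \<Rightarrow> bool" where
  "nilpotent_hom \<phi> \<longleftrightarrow> (\<exists>m>0. (\<phi> ^^ m) = (\<lambda>_. 0))"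

text \<open>
  Under \<open>E\<^sup>\<or> \<otimes> E \<cong> End(E)\<^sup>\<or>\<close>, where \<open>\<lambda> \<otimes> v\<close> corresponds to the form \<open>f \<mapsto> \<lambda> (f v)\<close>, the composition
  of \<open>id \<otimes> \<phi>\<close> with \<open>tr \<otimes> \<iota>1\<close> sends \<open>\<lambda> \<otimes> v\<close> to \<open>\<iota>1 (\<lambda> (\<phi> v))\<close>; on all of \<open>End(E)\<^sup>\<or>\<close> it is
  therefore \<open>\<xi> \<mapsto> \<iota>1 (\<xi> \<phi>)\<close>.
\<close>

definition associated_hom ::
  "(complex \<Rightarrow> 'k::field) \<Rightarrow> ('k \<Rightarrow> 'k) \<Rightarrow> ('k \<Rightarrow> 'k) \<Rightarrow> ('v \<Rightarrow> 'v) \<Rightarrow> complex \<Rightarrow>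
     ('k, 'v) rho_space \<Rightarrow> 'k" where
  "associated_hom emb \<iota>1 \<iota>2 \<phi> \<epsilon> = (\<lambda>(\<xi>, c). \<iota>1 (\<xi> \<phi>) + emb \<epsilon> * \<iota>2 c)"

definition elementary_tensor ::
  "('k::field \<Rightarrow> 'v::ab_group_add \<Rightarrow> 'v) \<Rightarrow> ('v \<Rightarrow> 'k) \<Rightarrow> 'v \<Rightarrow> ('v \<Rightarrow> 'v) \<Rightarrow> 'k" where
  "elementary_tensor sc lam v f = (if Vector_Spaces.linear sc sc f then lam (f v) else 0)"

lemma associated_hom_elementary_tensor:
  assumes "Vector_Spaces.linear sc sc \<phi>" and "Vector_Spaces.linear (*) (*) \<iota>2"
  shows "associated_hom emb \<iota>1 \<iota>2 \<phi> \<epsilon> (elementary_tensor sc lam v, 0) = \<iota>1 (lam (\<phi> v))"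
proof -
  interpret Vector_Spaces.linear "(*)" "(*)" \<iota>2 by fact
  show ?thesis using assms(1) zero by (simp add: associated_hom_def elementary_tensor_def)
qed

text \<open>
  Generators of the line \<open>\<Otimes>\<^sub>i (\<And>\<^bsup>r\<^sub>i\<^esup> V\<^sub>i)\<^bsup>\<otimes> n\<^sub>i\<^esup>\<close>, viewed as linear forms on \<open>sigma_space\<close>: a decomposable
  tensor is evaluation at its factors.
\<close>

definition flag_generator ::
  "(complex \<Rightarrow> 'w::ab_group_add \<Rightarrow> 'w) \<Rightarrow> nat \<Rightarrow> (nat \<Rightarrow> nat) \<Rightarrow> (nat \<Rightarrow> nat) \<Rightarrow> (nat \<Rightarrow> 'w set) \<Rightarrow>
     ('w form \<Rightarrow> complex) \<Rightarrow> bool" where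
  "flag_generator sw k rs n V s \<longleftrightarrow>
     (\<exists>b c. c \<noteq> 0 \<and>
        (\<forall>i\<in>{1..k}. inj_on (b i) {..<rs i} \<and> \<not> module.dependent sw (b i ` {..<rs i}) \<and>
           module.span sw (b i ` {..<rs i}) = V i) \<and>
        (\<forall>T\<in>sigma_space sw k rs n. s T = c * T (\<lambda>(i, _, p). b i p)))"

definition pardeg ::
  "'k::field set set \<Rightarrow> ('k \<Rightarrow> 'v::ab_group_add \<Rightarrow> 'v) \<Rightarrow> 'k set \<Rightarrow>
     (complex \<Rightarrow> 'w::ab_group_add \<Rightarrow> 'w) \<Rightarrow> ('v \<Rightarrow> 'w) \<Rightarrow> nat \<Rightarrow> (nat \<Rightarrow> rat) \<Rightarrow> (nat \<Rightarrow> 'w set) \<Rightarrow>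
     ('k, 'v) subsheaf \<Rightarrow> rat" where
  "pardeg X sc x0 sw ev k \<beta> V F =
     of_int (bundle_degree X sc F) +
     (\<Sum>i=1..k. \<beta> i * of_nat (vector_space.dim sw (sub_fiber X x0 ev F \<inter> V i)))"

definition parabolic_slope ::
  "'k::field set set \<Rightarrow> ('k \<Rightarrow> 'v::ab_group_add \<Rightarrow> 'v) \<Rightarrow> 'k set \<Rightarrow>
     (complex \<Rightarrow> 'w::ab_group_add \<Rightarrow> 'w) \<Rightarrow> ('v \<Rightarrow> 'w) \<Rightarrow> nat \<Rightarrow> (nat \<Rightarrow> rat) \<Rightarrow> (nat \<Rightarrow> 'w set) \<Rightarrow>
     ('k, 'v) subsheaf \<Rightarrow> rat" where
  "parabolic_slope X sc x0 sw ev k \<beta> V F =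
     pardeg X sc x0 sw ev k \<beta> V F / of_nat (bundle_rank X sc F)"

definition invariant_subbundle ::
  "'k::field set set \<Rightarrow> ('k, 'k) subsheaf \<Rightarrow> ('k \<Rightarrow> 'v::ab_group_add \<Rightarrow> 'v) \<Rightarrow>
     ('k, 'v) subsheaf \<Rightarrow> ('v \<Rightarrow> 'v) \<Rightarrow> ('k, 'v) subsheaf \<Rightarrow> bool" where
  "invariant_subbundle X L sc E \<phi> F \<longleftrightarrow>
     subbundle X sc F E \<and> (\<forall>U\<in>nonempty_opens X. \<phi> ` F U \<subseteq> twist X sc L F U)"

end

theory Submission
  imports Defs
begin

text \<open>
  Split the filtration of the generic fiber by a weighted flag.  The block of \<open>\<phi>\<close> from the \<open>i\<close>-th to
  the \<open>j\<close>-th summand contributes the weight \<open>\<gamma> i - \<gamma> j\<close> to \<open>E\<^sub>\<rho>\<close>, and \<open>\<epsilon> \<noteq> 0\<close> contributes the weight \<open>0\<close>.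
  As \<open>\<gamma>\<close> is strictly increasing, \<open>\<mu>\<^sub>1 > 0\<close> if \<open>\<phi>\<close> does not preserve the flag; if it does, \<open>\<mu>\<^sub>1 = 0\<close>
  unless \<open>\<epsilon> = 0\<close> and \<open>\<phi>\<close> lowers the flag strictly, so that \<open>\<phi>\<close> is nilpotent.  Conversely the kernels of
  the powers of a nilpotent \<open>\<phi>\<close> form a flag with \<open>\<mu>\<^sub>1 < 0\<close>.  For large \<open>\<delta>\<^sub>1\<close> the sign of \<open>\<mu>\<^sub>1\<close> decides, so
  that beyond condition (i) only flags of invariant subbundles matter.

  In a basis of \<open>V\<^sub>i\<close> adapted to the filtration of the fiber at \<open>x0\<close>, the minimal weight of the Pluecker
  coordinates of \<open>V\<^sub>i\<close> is read off from the leading terms, which gives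
  \<open>\<mu>\<^sub>2 = z \<Sum>\<^sub>j \<alpha>\<^sub>j \<Sum>\<^sub>i \<beta>\<^sub>i (r\<^sub>i rk E\<^sub>j - r dim (V\<^sub>i \<inter> E\<^sub>j))\<close>.  Hence \<open>M + \<mu>\<^sub>2 / z\<close> is the positive
  combination \<open>\<Sum>\<^sub>j \<alpha>\<^sub>j (pardeg E rk E\<^sub>j - pardeg E\<^sub>j r)\<close> of the differences in condition (ii).
\<close>

section \<open>Linear algebra of split filtrations\<close>

text \<open>Three obstacles shape the proof. The value \<open>minus_min_weight\<close> is defined
  through an arbitrarily chosen splitting. Splittings are never compared: the weights are computed
  for whichever one was chosen, and only what the filtration itself shows is kept, namely the sign
  of \<open>mu1\<close> and the dimensions in \<open>mu2\<close>. Next, membership in a weight space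
  is an identity for all parameters \<open>t\<close>; its exponent is recovered from a single one,
  the number 2 or its image in the function field, because that is not a root of unity. Finally,
  \<open>mu1\<close> sees subspaces of the generic fiber while condition (ii) speaks of subbundles.
  The two correspond because the local rings are valuation rings: among finitely many nonzero
  coordinates one divides all others, so that every subspace of the generic fiber is locally spanned
  by part of a frame. This also turns the kernels of the powers of \<phi> into a flag of subbundles.
  Since \<open>c1\<close> may depend on the weighted flag, every flag is settled on its own, and no
  bound over all flags is sought.\<close>

lemma common_denominator_exists:
  fixes S :: "rat set"
  assumes "finite S"
  shows "\<exists>q::nat. 0 < q \<and> (\<forall>x\<in>S. of_nat q * x \<in> \<int>)"
  using assms
proof (induction S)
  case empty
  show ?case by (intro exI[of _ 1]) simp
next
  case (insert x S)
  then obtain q :: nat where q: "0 < q" "\<forall>x\<in>S. of_nat q * x \<in> \<int>" by blast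
  obtain a b :: int where ab: "b > 0" "x = of_int a / of_int b"
    by (metis quotient_of_div quotient_of_denom_pos surj_pair)
  have "of_nat (nat b * q) * y \<in> \<int>" if "y \<in> insert x S" for y
  proof -
    have "of_nat (nat b * q) * y = of_int b * (of_nat q * y)"
      using ab(1) by (simp add: mult.assoc)
    moreover have "of_int b * (of_nat q * x) = of_int (a * int q)"
      using ab by simp
    ultimately show ?thesis
      using that q(2) by (metis Ints_mult Ints_of_int insertE)
  qed
  then show ?case using q(1) ab(1) by (intro exI[of _ "nat b * q"]) simp
qed

context vector_space
begin

lemma span_Int_disjoint_eq_0:
  assumes "independent (A \<union> B)" "A \<inter> B = {}" "x \<in> span A" "x \<in> span B"
  shows "x = 0"
proof -
  have eq: "representation A x = representation B x"
    using representation_extend[OF assms(1)] assms(3,4) by (metis Un_upper1 Un_upper2)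
  have "representation A x b = 0" for b
    using representation_ne_zero[of A x b] representation_ne_zero[of B x b] eq assms(2) by auto
  then show ?thesis
    using sum_nonzero_representation_eq[OF independent_mono[OF assms(1)] assms(3)] by auto
qed

text \<open>The choice is recursive because each basis must contain the one fixed before it. The
  vectors added at a step then span a complement of the preceding subspace.\<close>

lemma nested_bases:
  assumes "\<And>j. subspace (W j)" "\<And>j. W j \<subseteq> W (Suc j)"
  obtains B where "\<And>i j. i \<le> j \<Longrightarrow> B i \<subseteq> B j" "\<And>j::nat. independent (B j)" "\<And>j. span (B j) = W j"
proof -
  have "\<exists>B. \<forall>j. (independent (B j) \<and> span (B j) = W j) \<and> B j \<subseteq> B (Suc j)"
  proof (rule dependent_nat_choice)
    obtain B where "B \<subseteq> W 0" "independent B" "W 0 \<subseteq> span B"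
      using maximal_independent_subset by blast
    then show "\<exists>B. independent B \<and> span B = W 0"
      using assms(1) span_subspace by blast
  next
    fix B j assume B: "independent B \<and> span B = W j"
    then have "B \<subseteq> W (Suc j)" using assms(2) span_superset by blast
    then obtain C where "B \<subseteq> C" "C \<subseteq> W (Suc j)" "independent C" "W (Suc j) \<subseteq> span C"
      using maximal_independent_subset_extend B by blast
    then show "\<exists>C. (independent C \<and> span C = W (Suc j)) \<and> B \<subseteq> C"
      using assms(1) span_subspace by blast
  qed
  then obtain B where B: "\<And>j. independent (B j)" "\<And>j. span (B j) = W j" "\<And>j. B j \<subseteq> B (Suc j)"
    by blast
  show thesis by (rule that[OF lift_Suc_mono_le[of B, OF B(3)] B(1,2)])
qed

lemma splitting_exists:
  assumes sub: "\<And>j. j \<in> {1..m+1} \<Longrightarrow> subspace (W j)"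
    and mono: "\<And>j. j \<in> {1..m} \<Longrightarrow> W j \<subseteq> W (j + 1)"
  shows "\<exists>D. splitting scale m W D"
proof -
  \<comment> \<open>The chain is made to start at zero and to be constant beyond
    \<open>m + 1\<close>: nothing is assumed about \<open>W 0\<close>, and
    \<open>nested_bases\<close> wants subspaces for all natural indices.\<close>
  define W' where "W' j = (if j = 0 then {0} else W (min j (m + 1)))" for j
  have sub': "subspace (W' j)" for j
    using sub by (auto simp: W'_def)
  have mono': "W' j \<subseteq> W' (Suc j)" for j
  proof (cases "j = 0")
    case True
    then show ?thesis using subspace_0[OF sub'[of "Suc j"]] by (simp add: W'_def)
  next
    case False
    then show ?thesis using mono[of j] by (cases "j \<le> m") (auto simp: W'_def min_def le_Suc_eq)
  qed
  obtain B where B: "\<And>i j. i \<le> j \<Longrightarrow> B i \<subseteq> B j" "\<And>j::nat. independent (B j)" "\<And>j. span (B j) = W' j"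
    by (rule nested_bases[of W', OF sub' mono']) blast
  define D where "D j = span (B j - B (j - 1))" for j
  have D_sub: "D j \<subseteq> W' j" for j
    using span_mono[of "B j - B (j - 1)" "B j"] B(3) by (auto simp: D_def)
  have D_W: "W' (Suc j) = {x + y |x y. x \<in> W' j \<and> y \<in> D (Suc j)}" for j
    using span_Un[of "B j" "B (Suc j) - B j"] B(1)[of j "Suc j"] B(3)
    by (simp add: D_def Un_absorb1)
  have D_0: "x = 0" if "x \<in> W' j" "x \<in> D (Suc j)" for x j
    using span_Int_disjoint_eq_0[of "B j" "B (Suc j) - B j"] B that
    by (simp add: D_def Un_absorb1)
  have sums: "W' j = {\<Sum>i=1..j. w i | w. \<forall>i\<in>{1..j}. w i \<in> D i}" for j :: nat
  proof (induction j)
    case 0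
    then show ?case by (simp add: W'_def)
  next
    case (Suc j)
    show ?case
    proof (intro equalityI subsetI)
      fix x assume "x \<in> W' (Suc j)"
      then obtain y z where yz: "x = y + z" "y \<in> W' j" "z \<in> D (Suc j)"
        unfolding D_W by blast
      then obtain w where w: "y = (\<Sum>i=1..j. w i)" "\<forall>i\<in>{1..j}. w i \<in> D i"
        using Suc.IH by blast
      then have "x = (\<Sum>i=1..Suc j. (w(Suc j := z)) i)"
        using yz(1) by (simp add: sum.cl_ivl_Suc)
      moreover have "\<forall>i\<in>{1..Suc j}. (w(Suc j := z)) i \<in> D i"
        using w(2) yz(3) by auto
      ultimately show "x \<in> {\<Sum>i=1..Suc j. w i | w. \<forall>i\<in>{1..Suc j}. w i \<in> D i}" by blast
    next
      fix x assume "x \<in> {\<Sum>i=1..Suc j. w i | w. \<forall>i\<in>{1..Suc j}. w i \<in> D i}"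
      then obtain w where w: "x = (\<Sum>i=1..Suc j. w i)" "\<forall>i\<in>{1..Suc j}. w i \<in> D i" by blast
      then have "(\<Sum>i=1..j. w i) \<in> W' j"
        unfolding Suc.IH by auto
      moreover have "x = (\<Sum>i=1..j. w i) + w (Suc j)" using w(1) by simp
      ultimately show "x \<in> W' (Suc j)"
        unfolding D_W mem_Collect_eq using w(2) by (metis atLeastAtMost_iff le_add1 order_refl plus_1_eq_Suc)
    qed
  qed
  have uniq: "\<forall>i\<in>{1..j}. w i = 0" if "\<forall>i\<in>{1..j}. w i \<in> D i" "(\<Sum>i=1..j. w i) = 0" for w and j :: nat
    using that
  proof (induction j)
    case (Suc j)
    have "(\<Sum>i=1..j. w i) \<in> W' j" unfolding sums using Suc.prems(1) by auto
    moreover have eq: "w (Suc j) = - (\<Sum>i=1..j. w i)"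
      using Suc.prems(2) by (simp add: eq_neg_iff_add_eq_0 add.commute)
    ultimately have "w (Suc j) \<in> W' j" using subspace_neg[OF sub'] by simp
    then have "w (Suc j) = 0" using D_0 Suc.prems(1) by simp
    moreover have "\<forall>i\<in>{1..j}. w i = 0"
    proof (rule Suc.IH)
      show "(\<Sum>i=1..j. w i) = 0" using eq \<open>w (Suc j) = 0\<close> by (metis neg_0_equal_iff_equal)
    qed (use Suc.prems(1) in simp)
    ultimately show ?case by (simp add: atLeastAtMostSuc_conv)
  qed simp
  have "splitting scale m W D"
    unfolding splitting_def
  proof (intro conjI ballI)
    show "subspace (D i)" for i by (simp add: D_def)
    show "W j = {\<Sum>i=1..j. w i |w. \<forall>i\<in>{1..j}. w i \<in> D i}" if "j \<in> {1..m+1}" for j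
      using sums[of j] that by (simp add: W'_def)
    show "\<forall>w. (\<forall>i\<in>{1..m+1}. w i \<in> D i) \<longrightarrow> (\<Sum>i=1..m+1. w i) = 0 \<longrightarrow> (\<forall>i\<in>{1..m+1}. w i = 0)"
      using uniq by blast
  qed
  then show ?thesis by blast
qed

end

section \<open>Projections and one-parameter subgroups attached to a splitting\<close>

locale split_space = vector_space scale
  for scale :: "'a::field \<Rightarrow> 'b::ab_group_add \<Rightarrow> 'b" +
  fixes m :: nat and W D :: "nat \<Rightarrow> 'b set"
  assumes splitting: "splitting scale m W D" and top: "W (m + 1) = UNIV"
begin

definition proj :: "nat \<Rightarrow> 'b \<Rightarrow> 'b" where
  "proj i v = (SOME w. (\<forall>i\<in>{1..m+1}. w i \<in> D i) \<and> v = (\<Sum>i=1..m+1. w i)) i"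

lemma subspace_D: "i \<in> {1..m+1} \<Longrightarrow> subspace (D i)"
  using splitting by (simp add: splitting_def)

lemma proj_mem_sum: "(\<forall>i\<in>{1..m+1}. proj i v \<in> D i) \<and> v = (\<Sum>i=1..m+1. proj i v)"
proof -
  have "v \<in> W (m + 1)" unfolding top by (rule UNIV_I)
  then have "v \<in> {\<Sum>i=1..m+1. w i |w. \<forall>i\<in>{1..m+1}. w i \<in> D i}"
    using splitting unfolding splitting_def by (simp only: le_add2 atLeastAtMost_iff order_refl simp_thms)
  then have "\<exists>w. (\<forall>i\<in>{1..m+1}. w i \<in> D i) \<and> v = (\<Sum>i=1..m+1. w i)" by blast
  from someI_ex[OF this] show ?thesis unfolding proj_def .
qed

lemma proj_mem: "i \<in> {1..m+1} \<Longrightarrow> proj i v \<in> D i"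
  and sum_proj: "(\<Sum>i=1..m+1. proj i v) = v"
  using proj_mem_sum[of v] by (blast, metis)

lemma proj_unique:
  assumes "\<And>i. i \<in> {1..m+1} \<Longrightarrow> w i \<in> D i" "v = (\<Sum>i=1..m+1. w i)" "i \<in> {1..m+1}"
  shows "proj i v = w i"
proof -
  have "\<forall>i\<in>{1..m+1}. w i - proj i v \<in> D i"
    using assms(1) proj_mem subspace_D subspace_diff by blast
  moreover have "(\<Sum>i=1..m+1. w i - proj i v) = 0"
    using assms(2) sum_proj[of v] by (simp only: sum_subtractf diff_self)
  ultimately have "\<forall>i\<in>{1..m+1}. w i - proj i v = 0"
    using splitting unfolding splitting_def
    by (elim conjE) (drule spec[of _ "\<lambda>i. w i - proj i v"], blast)
  then show ?thesis using assms(3) by simp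
qed

lemma proj_ext:
  assumes "\<And>i. i \<in> {1..m+1} \<Longrightarrow> proj i u = proj i v"
  shows "u = v"
proof -
  have "(\<Sum>i=1..m+1. proj i u) = (\<Sum>i=1..m+1. proj i v)" by (rule sum.cong[OF refl assms])
  then show ?thesis by (simp only: sum_proj)
qed

lemma proj_add: "i \<in> {1..m+1} \<Longrightarrow> proj i (u + v) = proj i u + proj i v"
proof (rule proj_unique)
  show "proj i u + proj i v \<in> D i" if "i \<in> {1..m+1}" for i
    using that proj_mem subspace_D subspace_add by blast
  show "u + v = (\<Sum>i=1..m+1. proj i u + proj i v)"
    by (simp only: sum.distrib sum_proj)
qed

lemma proj_scale: "i \<in> {1..m+1} \<Longrightarrow> proj i (scale c v) = scale c (proj i v)"
proof (rule proj_unique)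
  show "scale c (proj i v) \<in> D i" if "i \<in> {1..m+1}" for i
    using that proj_mem subspace_D subspace_scale by blast
  show "scale c v = (\<Sum>i=1..m+1. scale c (proj i v))"
    by (simp only: scale_sum_right[symmetric] sum_proj)
qed

lemma linear_proj: "i \<in> {1..m+1} \<Longrightarrow> Vector_Spaces.linear scale scale (proj i)"
  by (simp add: Vector_Spaces.linear_iff proj_add proj_scale vector_space_axioms)

lemma proj_0: "i \<in> {1..m+1} \<Longrightarrow> proj i 0 = 0"
  using proj_scale[of i 0 0] by simp

lemma proj_sum: "i \<in> {1..m+1} \<Longrightarrow> proj i (sum f A) = (\<Sum>x\<in>A. proj i (f x))"
  by (induction A rule: infinite_finite_induct) (auto simp: proj_0 proj_add)

lemma proj_D:
  assumes "i \<in> {1..m+1}" "j \<in> {1..m+1}" "v \<in> D i"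
  shows "proj j v = (if j = i then v else 0)"
proof (rule proj_unique)
  show "(if j = i then v else 0) \<in> D j" if "j \<in> {1..m+1}" for j
    using that assms(3) subspace_D subspace_0 by auto
  show "v = (\<Sum>j=1..m+1. if j = i then v else 0)"
    using assms(1) by (simp add: sum.delta)
qed fact

lemma proj_proj:
  "i \<in> {1..m+1} \<Longrightarrow> j \<in> {1..m+1} \<Longrightarrow> proj j (proj i v) = (if j = i then proj i v else 0)"
  using proj_D proj_mem by blast

text \<open>The steps of the filtration become common kernels of projections, which turns statements
  about the filtration into the vanishing of components or blocks.\<close>

lemma mem_W_iff:
  assumes "j \<in> {1..m+1}"
  shows "v \<in> W j \<longleftrightarrow> (\<forall>i\<in>{1..m+1}. j < i \<longrightarrow> proj i v = 0)"
proof -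
  have W: "W j = {\<Sum>i=1..j. w i |w. \<forall>i\<in>{1..j}. w i \<in> D i}"
    using splitting assms unfolding splitting_def by blast
  show ?thesis
  proof
    assume "v \<in> W j"
    then obtain w where w: "v = (\<Sum>i=1..j. w i)" "\<forall>i\<in>{1..j}. w i \<in> D i" unfolding W by blast
    show "\<forall>i\<in>{1..m+1}. j < i \<longrightarrow> proj i v = 0"
    proof (intro ballI impI)
      fix i assume i: "i \<in> {1..m+1}" "j < i"
      have "proj i v = (\<Sum>k=1..j. proj i (w k))" unfolding w(1) by (rule proj_sum[OF i(1)])
      also have "\<dots> = 0"
      proof (intro sum.neutral ballI)
        fix k assume "k \<in> {1..j}"
        then show "proj i (w k) = 0"
          using w(2) i assms proj_D[of k i "w k"] by auto
      qed
      finally show "proj i v = 0" .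
    qed
  next
    assume *: "\<forall>i\<in>{1..m+1}. j < i \<longrightarrow> proj i v = 0"
    have "v = (\<Sum>i=1..m+1. proj i v)" by (rule sum_proj[symmetric])
    also have "\<dots> = (\<Sum>i=1..j. proj i v)"
      using assms * by (intro sum.mono_neutral_right) auto
    finally show "v \<in> W j"
      unfolding W using assms proj_mem by fastforce
  qed
qed

definition one_parameter :: "(nat \<Rightarrow> int) \<Rightarrow> 'a \<Rightarrow> 'b \<Rightarrow> 'b" where
  "one_parameter a t v = (\<Sum>i=1..m+1. scale (t powi a i) (proj i v))"

lemma proj_one_parameter: "i \<in> {1..m+1} \<Longrightarrow> proj i (one_parameter a t v) = scale (t powi a i) (proj i v)"
  by (rule proj_unique[OF _ one_parameter_def]) (use proj_mem subspace_D subspace_scale in blast)+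

lemma one_parameter_D: "i \<in> {1..m+1} \<Longrightarrow> v \<in> D i \<Longrightarrow> one_parameter a t v = scale (t powi a i) v"
  by (rule proj_ext) (simp add: proj_one_parameter proj_D proj_scale del: atLeastAtMost_iff)

lemma linear_one_parameter: "Vector_Spaces.linear scale scale (one_parameter a t)"
  unfolding Vector_Spaces.linear_iff
proof (intro conjI allI vector_space_axioms)
  show "one_parameter a t (u + v) = one_parameter a t u + one_parameter a t v" for u v
    by (rule proj_ext) (simp only: proj_one_parameter proj_add scale_right_distrib)
  show "one_parameter a t (scale c v) = scale c (one_parameter a t v)" for c v
    by (rule proj_ext) (simp only: proj_one_parameter proj_scale scale_left_commute)
qed

text \<open>A linear map is determined by its values on the summands, which together span the space.
  Hence the quantifier over \<open>g\<close> in \<open>weight_space\<close> meets exactly one map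
  for each \<open>t\<close>.\<close>

lemma one_parameter_element_iff: "one_parameter_element scale m D a t g \<longleftrightarrow> g = one_parameter a t"
proof
  assume g: "one_parameter_element scale m D a t g"
  then interpret g: Vector_Spaces.linear scale scale g by (simp add: one_parameter_element_def)
  show "g = one_parameter a t"
  proof
    fix v
    have "g v = g (\<Sum>i=1..m+1. proj i v)" by (simp only: sum_proj)
    also have "\<dots> = (\<Sum>i=1..m+1. g (proj i v))" by (rule g.sum)
    also have "\<dots> = one_parameter a t v"
      unfolding one_parameter_def using g proj_mem by (intro sum.cong) (auto simp: one_parameter_element_def)
    finally show "g v = one_parameter a t v" .
  qed
next
  assume "g = one_parameter a t"
  then show "one_parameter_element scale m D a t g"
    by (simp add: one_parameter_element_def linear_one_parameter one_parameter_D)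
qed

lemma one_parameter_inverse: "t \<noteq> 0 \<Longrightarrow> one_parameter a (inverse t) (one_parameter a t v) = v"
  by (rule proj_ext) (simp add: proj_one_parameter power_int_inverse)

lemma inv_one_parameter:
  assumes "t \<noteq> 0"
  shows "inv_into UNIV (one_parameter a t) = one_parameter a (inverse t)"
proof (rule inv_unique_comp)
  show "one_parameter a (inverse t) \<circ> one_parameter a t = id"
    using one_parameter_inverse[OF assms] by (simp add: fun_eq_iff)
  show "one_parameter a t \<circ> one_parameter a (inverse t) = id"
    using one_parameter_inverse[of "inverse t"] assms by (simp add: fun_eq_iff)
qed

lemma mem_weight_space_iff:
  "x \<in> weight_space scale m D \<gamma> R smul act \<chi> \<longleftrightarrow>
     x \<in> R \<and> (\<exists>(q::nat) a n. 0 < q \<and> (\<forall>i\<in>{1..m+1}. of_int (a i) = of_nat q * \<gamma> i) \<and>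
        of_int n = of_nat q * \<chi> \<and> (\<forall>t. t \<noteq> 0 \<longrightarrow> act (one_parameter a t) x = smul (t powi n) x))"
  unfolding weight_space_def by (simp add: one_parameter_element_iff)

lemma integral_weights:
  obtains q :: nat and a :: "nat \<Rightarrow> int" where "0 < q" "\<And>i. i \<in> {1..m+1} \<Longrightarrow> of_int (a i) = of_nat q * (\<gamma> i :: rat)"
proof -
  obtain q :: nat where q: "0 < q" "\<forall>x\<in>\<gamma> ` {1..m+1}. of_nat q * x \<in> \<int>"
    using common_denominator_exists[of "\<gamma> ` {1..m+1}"] by blast
  have "of_int \<lfloor>of_nat q * \<gamma> i\<rfloor> = of_nat q * \<gamma> i" if "i \<in> {1..m+1}" for i
  proof -
    have "of_nat q * \<gamma> i \<in> \<int>" using q(2) that by blast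
    then show ?thesis by (rule Ints_cases) simp
  qed
  then show thesis by (rule that[OF q(1)])
qed

end

section \<open>Weights on the dual of the endomorphisms\<close>

lemma vector_space_self: "vector_space ((*) :: 'a::field \<Rightarrow> 'a \<Rightarrow> 'a)"
  by (simp add: vector_space_def algebra_simps)

lemma (in vector_space) linear_form_extend:
  assumes "independent B"
  obtains g where "Vector_Spaces.linear scale (*) g" "\<And>x. x \<in> B \<Longrightarrow> g x = f x"
proof -
  interpret vector_space_pair scale "(*)"
    by (simp add: vector_space_pair_def vector_space_axioms vector_space_self)
  show thesis using linear_independent_extend[OF assms] that by metis
qed

text \<open>The function field is a line over itself. A homomorphism of line bundles is therefore
  multiplication by its value at 1, a nonzero factor if the map is injective.\<close>

lemma linear_mult_eq:
  assumes "Vector_Spaces.linear (*) (*) h"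
  shows "h x = h 1 * (x :: 'a::field)"
proof -
  have "h (x * 1) = x * h 1" using assms unfolding Vector_Spaces.linear_iff by blast
  then show ?thesis by (simp add: mult.commute)
qed

lemma linear_mult_nonzero:
  assumes "Vector_Spaces.linear (*) (*) (h :: 'a::field \<Rightarrow> 'a)" "inj h"
  shows "h 1 \<noteq> 0"
proof
  assume "h 1 = 0"
  then have "h 1 = h 0" using linear_mult_eq[OF assms(1), of 0] by simp
  then show False using assms(2) by (simp add: inj_eq)
qed

lemma associated_hom_eq:
  assumes "Vector_Spaces.linear (*) (*) \<iota>1" "Vector_Spaces.linear (*) (*) \<iota>2"
  shows "associated_hom emb \<iota>1 \<iota>2 \<phi> \<epsilon> x = \<iota>1 1 * fst x \<phi> + emb \<epsilon> * \<iota>2 1 * snd x"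
  using linear_mult_eq[OF assms(1), of "fst x \<phi>"] linear_mult_eq[OF assms(2), of "snd x"]
  by (simp add: associated_hom_def case_prod_beta mult.assoc)

context vector_space
begin

lemma linear_zero_fun: "Vector_Spaces.linear scale scale (\<lambda>_. 0)"
  by (simp add: Vector_Spaces.linear_iff vector_space_axioms)

lemma linear_add_fun:
  "Vector_Spaces.linear scale scale f \<Longrightarrow> Vector_Spaces.linear scale scale g \<Longrightarrow>
     Vector_Spaces.linear scale scale (\<lambda>v. f v + g v)"
  by (simp add: Vector_Spaces.linear_iff scale_right_distrib algebra_simps)

lemma linear_scale_fun:
  "Vector_Spaces.linear scale scale f \<Longrightarrow> Vector_Spaces.linear scale scale (\<lambda>v. scale c (f v))"
  by (simp add: Vector_Spaces.linear_iff scale_right_distrib scale_left_commute)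

lemma linear_sum_fun:
  "(\<And>i. i \<in> A \<Longrightarrow> Vector_Spaces.linear scale scale (f i)) \<Longrightarrow>
     Vector_Spaces.linear scale scale (\<lambda>v. \<Sum>i\<in>A. f i v)"
  by (induction A rule: infinite_finite_induct) (auto intro: linear_zero_fun linear_add_fun)

lemma end_dual_zero:
  assumes "\<xi> \<in> end_dual scale"
  shows "\<xi> (\<lambda>_. 0) = 0"
proof -
  have "\<xi> (\<lambda>v. scale 0 ((\<lambda>_. 0) v)) = 0 * \<xi> (\<lambda>_. 0)"
    using assms linear_zero_fun unfolding end_dual_def by blast
  then show ?thesis by simp
qed

lemma end_dual_sum:
  assumes "\<xi> \<in> end_dual scale" "\<And>i. i \<in> A \<Longrightarrow> Vector_Spaces.linear scale scale (f i)"
  shows "\<xi> (\<lambda>v. \<Sum>i\<in>A. f i v) = (\<Sum>i\<in>A. \<xi> (f i))"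
  using assms(2)
proof (induction A rule: infinite_finite_induct)
  case (insert i A)
  have "\<xi> (\<lambda>v. f i v + (\<Sum>j\<in>A. f j v)) = \<xi> (f i) + \<xi> (\<lambda>v. \<Sum>j\<in>A. f j v)"
    using assms(1) insert.prems linear_sum_fun[of A f] unfolding end_dual_def by blast
  then show ?case using insert by simp
qed (simp_all add: end_dual_zero[OF assms(1)])

lemma elementary_tensor_mem_end_dual:
  assumes "Vector_Spaces.linear scale (*) lam"
  shows "elementary_tensor scale lam v \<in> end_dual scale"
  using assms linear_add_fun linear_scale_fun
  by (auto simp: end_dual_def elementary_tensor_def Vector_Spaces.linear_iff[of scale "(*)"])

end

context split_space
begin

text \<open>Elements of \<open>end_dual\<close> are functions on all maps, zero off the linear ones.
  An identity between such forms has to hold at nonlinear arguments as well, so conjugation must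
  both preserve and reflect linearity.\<close>

lemma linear_conj_one_parameter_iff:
  assumes "t \<noteq> 0"
  shows "Vector_Spaces.linear scale scale (inv_into UNIV (one_parameter a t) \<circ> f \<circ> one_parameter a t) \<longleftrightarrow>
    Vector_Spaces.linear scale scale f"
proof
  assume "Vector_Spaces.linear scale scale f"
  then show "Vector_Spaces.linear scale scale (inv_into UNIV (one_parameter a t) \<circ> f \<circ> one_parameter a t)"
    using Vector_Spaces.linear_compose[OF Vector_Spaces.linear_compose[OF linear_one_parameter] linear_one_parameter] assms
    by (simp add: inv_one_parameter comp_assoc)
next
  assume "Vector_Spaces.linear scale scale (inv_into UNIV (one_parameter a t) \<circ> f \<circ> one_parameter a t)"
  then have "Vector_Spaces.linear scale scale
      (one_parameter a t \<circ> (inv_into UNIV (one_parameter a t) \<circ> f \<circ> one_parameter a t) \<circ> one_parameter a (inverse t))"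
    using Vector_Spaces.linear_compose[OF linear_one_parameter Vector_Spaces.linear_compose[OF _ linear_one_parameter]] by blast
  also have "one_parameter a t \<circ> (inv_into UNIV (one_parameter a t) \<circ> f \<circ> one_parameter a t) \<circ> one_parameter a (inverse t) = f"
    using one_parameter_inverse[of t a] one_parameter_inverse[of "inverse t" a] assms by (simp add: fun_eq_iff inv_one_parameter)
  finally show "Vector_Spaces.linear scale scale f" .
qed

text \<open>When \<open>f\<close> is conjugated and applied to \<open>v\<close>, the inner factor
  scales \<open>v\<close> with exponent \<gamma> i, and the outer, inverse factor scales the
  \<open>j\<close>-th component of the result with exponent - \<gamma> j.\<close>

lemma elementary_tensor_weight:
  assumes lam: "Vector_Spaces.linear scale (*) lam"
    and i: "i \<in> {1..m+1}" and j: "j \<in> {1..m+1}" and v: "v \<in> D i"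
  shows "(elementary_tensor scale (lam \<circ> proj j) v, 0) \<in>
    weight_space scale m D \<gamma> (end_dual scale \<times> UNIV) rho_smul rho_act (\<gamma> i - \<gamma> j)"
proof -
  let ?\<xi> = "elementary_tensor scale (lam \<circ> proj j) v"
  obtain q a where q: "0 < q" "\<And>i. i \<in> {1..m+1} \<Longrightarrow> of_int (a i) = of_nat q * \<gamma> i"
    by (rule integral_weights[where \<gamma> = \<gamma>]) blast
  have lin: "Vector_Spaces.linear scale (*) (lam \<circ> proj j)"
    using Vector_Spaces.linear_compose[OF linear_proj[OF j] lam] .
  have act: "rho_act (one_parameter a t) (?\<xi>, 0) = rho_smul (t powi (a i - a j)) (?\<xi>, 0)" if t: "t \<noteq> 0" for t
  proof -
    have "?\<xi> (inv_into UNIV (one_parameter a t) \<circ> f \<circ> one_parameter a t) = t powi (a i - a j) * ?\<xi> f" for f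
    proof (cases "Vector_Spaces.linear scale scale f")
      case True
      have "(lam \<circ> proj j) (one_parameter a (inverse t) (f (one_parameter a t v)))
          = lam (scale (inverse t powi a j) (proj j (f (scale (t powi a i) v))))"
        using i j v by (simp only: o_apply one_parameter_D proj_one_parameter)
      also have "\<dots> = inverse t powi a j * (t powi a i * lam (proj j (f v)))"
        using True lam j unfolding Vector_Spaces.linear_iff by (simp only: proj_scale)
      finally show ?thesis
        using True linear_conj_one_parameter_iff[OF t, of a f] t
        by (simp add: elementary_tensor_def inv_one_parameter power_int_diff power_int_inverse field_simps)
    next
      case False
      then show ?thesis
        using linear_conj_one_parameter_iff[OF t, of a f] by (simp add: elementary_tensor_def)
    qed
    then show ?thesis by (simp add: rho_act_def rho_smul_def)
  qed
  have "of_int (a i - a j) = of_nat q * (\<gamma> i - \<gamma> j)"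
    using q(2) i j by (simp add: right_diff_distrib)
  then show ?thesis
    unfolding mem_weight_space_iff using elementary_tensor_mem_end_dual[OF lin] q act by blast
qed

lemma invariant_weight:
  "((\<lambda>_. 0), c) \<in> weight_space scale m D \<gamma> (end_dual scale \<times> UNIV) rho_smul rho_act 0"
proof -
  obtain q a where q: "0 < q" "\<And>i. i \<in> {1..m+1} \<Longrightarrow> of_int (a i) = of_nat q * \<gamma> i"
    by (rule integral_weights[where \<gamma> = \<gamma>]) blast
  have "rho_act (one_parameter a t) (\<lambda>_. 0, c) = rho_smul (t powi 0) (\<lambda>_. 0, c)" for t
    by (simp add: rho_act_def rho_smul_def)
  moreover have "(\<lambda>_. 0) \<in> end_dual scale" by (simp add: end_dual_def)
  moreover have "of_int 0 = of_nat q * (0::rat)" by simp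
  ultimately show ?thesis
    unfolding mem_weight_space_iff using q by blast
qed

lemma block_decomposition:
  assumes "Vector_Spaces.linear scale scale \<phi>"
  shows "\<phi> = (\<lambda>v. \<Sum>(i, j)\<in>{1..m+1} \<times> {1..m+1}. proj j (\<phi> (proj i v)))"
proof
  fix v
  interpret \<phi>: Vector_Spaces.linear scale scale \<phi> by fact
  have "\<phi> v = \<phi> (\<Sum>i=1..m+1. proj i v)" by (simp only: sum_proj)
  also have "\<dots> = (\<Sum>i=1..m+1. \<Sum>j=1..m+1. proj j (\<phi> (proj i v)))" by (subst \<phi>.sum) (simp only: sum_proj)
  finally show "\<phi> v = (\<Sum>(i, j)\<in>{1..m+1} \<times> {1..m+1}. proj j (\<phi> (proj i v)))"
    by (simp only: sum.cartesian_product)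
qed

text \<open>The functional reads \<phi> and the scalar summand. Splitting \<phi> into blocks turns
  the weights on which it is nonzero into positions of nonzero blocks. The parameter \<tau> is not a
  root of unity, so equal powers of it have equal exponents.\<close>

lemma weights_nonvanishing:
  fixes \<tau> :: 'a
  assumes lin: "Vector_Spaces.linear scale scale \<phi>"
    and \<tau>: "\<tau> \<noteq> 0" "\<And>n. \<tau> powi n = 1 \<Longrightarrow> n = 0"
    and "c1 \<noteq> 0"
    and \<Phi>: "\<And>x. \<Phi> x = c1 * fst x \<phi> + c2 * snd x"
  shows "{\<chi>. \<exists>x\<in>weight_space scale m D \<gamma> (end_dual scale \<times> UNIV) rho_smul rho_act \<chi>. \<Phi> x \<noteq> 0} =
    {\<gamma> i - \<gamma> j | i j. i \<in> {1..m+1} \<and> j \<in> {1..m+1} \<and> (\<exists>v\<in>D i. proj j (\<phi> v) \<noteq> 0)}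
      \<union> (if c2 = 0 then {} else {0})" (is "?L = ?N \<union> ?C")
proof (intro equalityI subsetI)
  fix \<chi> assume "\<chi> \<in> ?L"
  then obtain \<xi> c where x: "(\<xi>, c) \<in> weight_space scale m D \<gamma> (end_dual scale \<times> UNIV) rho_smul rho_act \<chi>"
    and ne: "\<Phi> (\<xi>, c) \<noteq> 0" by auto
  then obtain q :: nat and a n where q: "0 < q" "\<forall>i\<in>{1..m+1}. of_int (a i) = of_nat q * \<gamma> i"
      "of_int n = of_nat q * \<chi>" and \<xi>: "\<xi> \<in> end_dual scale"
      and act: "\<And>t. t \<noteq> 0 \<Longrightarrow> rho_act (one_parameter a t) (\<xi>, c) = rho_smul (t powi n) (\<xi>, c)"
    unfolding mem_weight_space_iff by blast
  have n_eq: "n = k" if "\<tau> powi k = \<tau> powi n" for k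
  proof -
    have "\<tau> powi (n - k) = \<tau> powi n / \<tau> powi k" using power_int_diff[of \<tau> n k] \<tau>(1) by blast
    then show ?thesis using \<tau>(2)[of "n - k"] that \<tau>(1) by simp
  qed
  show "\<chi> \<in> ?N \<union> ?C"
  proof (cases "c2 * c = 0")
    \<comment> \<open>The group acts trivially on the scalar summand, so a nonzero scalar there
      forces weight zero.\<close>
    case False
    have "c = \<tau> powi n * c"
      using act[OF \<tau>(1)] by (simp add: rho_act_def rho_smul_def)
    then have "n = 0" using n_eq[of 0] False by simp
    then show ?thesis using q False by simp
  next
    case True
    then have "\<xi> \<phi> \<noteq> 0" using ne \<Phi> by auto
    let ?f = "\<lambda>(i, j) v. proj j (\<phi> (proj i v))"
    have f_lin: "Vector_Spaces.linear scale scale (?f p)" if p: "p \<in> {1..m+1} \<times> {1..m+1}" for p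
    proof -
      obtain i j where "p = (i, j)" "i \<in> {1..m+1}" "j \<in> {1..m+1}" using p by blast
      then show ?thesis
        using Vector_Spaces.linear_compose[OF Vector_Spaces.linear_compose[OF linear_proj lin] linear_proj, of i j]
        by (simp add: comp_def)
    qed
    have "\<xi> \<phi> = \<xi> (\<lambda>v. \<Sum>p\<in>{1..m+1} \<times> {1..m+1}. ?f p v)"
      by (rule arg_cong[where f = \<xi>], rule trans[OF block_decomposition[OF lin]])
        (simp only: case_prod_unfold)
    also have "\<dots> = (\<Sum>p\<in>{1..m+1} \<times> {1..m+1}. \<xi> (?f p))"
      by (rule end_dual_sum[OF \<xi> f_lin])
    finally obtain p where p: "p \<in> {1..m+1} \<times> {1..m+1}" "\<xi> (?f p) \<noteq> 0"
      using \<open>\<xi> \<phi> \<noteq> 0\<close> by (metis (no_types, lifting) sum.neutral)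
    then obtain i j where ij: "i \<in> {1..m+1}" "j \<in> {1..m+1}" "\<xi> (?f (i, j)) \<noteq> 0" by blast
    have "\<exists>v\<in>D i. proj j (\<phi> v) \<noteq> 0"
    proof (rule ccontr)
      assume "\<not> ?thesis"
      then have "?f (i, j) = (\<lambda>_. 0)" using proj_mem[OF ij(1)] by auto
      then show False using ij(3) end_dual_zero[OF \<xi>] by simp
    qed
    \<comment> \<open>Both exponents describe how the one-parameter subgroup changes the value of
      \<xi> at the chosen block, and this value is nonzero.\<close>
    moreover have "n = a i - a j"
    proof (rule n_eq)
      have conj: "inv_into UNIV (one_parameter a \<tau>) \<circ> ?f (i, j) \<circ> one_parameter a \<tau> = (\<lambda>v. scale (\<tau> powi (a i - a j)) (?f (i, j) v))"
      proof
        fix v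
        have "(inv_into UNIV (one_parameter a \<tau>) \<circ> ?f (i, j) \<circ> one_parameter a \<tau>) v
          = one_parameter a (inverse \<tau>) (proj j (\<phi> (scale (\<tau> powi a i) (proj i v))))"
          using ij by (simp only: inv_one_parameter[OF \<tau>(1)] o_apply proj_one_parameter case_prod_conv)
        also have "\<dots> = scale (inverse \<tau> powi a j) (proj j (\<phi> (scale (\<tau> powi a i) (proj i v))))"
          by (rule one_parameter_D[OF ij(2) proj_mem[OF ij(2)]])
        also have "\<dots> = scale (inverse \<tau> powi a j) (scale (\<tau> powi a i) (proj j (\<phi> (proj i v))))"
          using lin ij(2) unfolding Vector_Spaces.linear_iff by (simp only: proj_scale)
        also have "\<dots> = scale (\<tau> powi (a i - a j)) (?f (i, j) v)"
          using \<tau>(1) by (simp add: power_int_diff power_int_inverse divide_inverse mult.commute)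
        finally show "(inv_into UNIV (one_parameter a \<tau>) \<circ> ?f (i, j) \<circ> one_parameter a \<tau>) v = scale (\<tau> powi (a i - a j)) (?f (i, j) v)" .
      qed
      have "\<tau> powi n * \<xi> (?f (i, j)) = \<xi> (inv_into UNIV (one_parameter a \<tau>) \<circ> ?f (i, j) \<circ> one_parameter a \<tau>)"
        using act[OF \<tau>(1)] by (simp add: rho_act_def rho_smul_def fun_eq_iff)
      also have "\<dots> = \<tau> powi (a i - a j) * \<xi> (?f (i, j))"
        unfolding conj using \<xi> f_lin[of "(i, j)"] ij(1,2) unfolding end_dual_def by blast
      finally show "\<tau> powi (a i - a j) = \<tau> powi n" using ij(3) by simp
    qed
    moreover from this have "of_nat q * \<chi> = of_nat q * (\<gamma> i - \<gamma> j)"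
      using q ij by (simp add: right_diff_distrib flip: q(3))
    ultimately show ?thesis using ij q(1) by auto
  qed
next
  fix \<chi> assume "\<chi> \<in> ?N \<union> ?C"
  then show "\<chi> \<in> ?L"
  proof
    assume "\<chi> \<in> ?C"
    then have "\<chi> = 0" "c2 \<noteq> 0" by (auto split: if_splits)
    then show ?thesis
      using invariant_weight[of 1] \<Phi> by (auto intro!: bexI[of _ "(\<lambda>_. 0, 1)"])
  next
    assume "\<chi> \<in> ?N"
    then obtain i j v where ij: "\<chi> = \<gamma> i - \<gamma> j" "i \<in> {1..m+1}" "j \<in> {1..m+1}" "v \<in> D i" "proj j (\<phi> v) \<noteq> 0"
      by blast
    have "independent {proj j (\<phi> v)}" using ij(5) by simp
    then obtain lam where lam: "Vector_Spaces.linear scale (*) lam" "lam (proj j (\<phi> v)) = 1"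
      using linear_form_extend[of "{proj j (\<phi> v)}" "\<lambda>_. 1"] by (metis singletonI)
    have "\<Phi> (elementary_tensor scale (lam \<circ> proj j) v, 0) = c1"
      using lin lam(2) by (simp add: \<Phi> elementary_tensor_def)
    then show ?thesis
      using elementary_tensor_weight[OF lam(1) ij(2-4)] \<open>c1 \<noteq> 0\<close> ij(1) by auto
  qed
qed

end

section \<open>Alternating forms and minors\<close>

text \<open>The exterior product of the forms \<open>f 0, ..., f (N - 1)\<close> evaluated at the
  vectors \<open>u 0, ..., u (N - 1)\<close>; rows belong to forms, columns to arguments.\<close>

definition minor :: "nat \<Rightarrow> (nat \<Rightarrow> 'b \<Rightarrow> 'a::field) \<Rightarrow> (nat \<Rightarrow> 'b) \<Rightarrow> 'a" where
  "minor N f u = det (mat N N (\<lambda>(p, q). f p (u q)))"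

lemma minor_cong: "(\<And>q. q < N \<Longrightarrow> u q = u' q) \<Longrightarrow> minor N f u = minor N f u'"
  unfolding minor_def by (intro arg_cong[where f = det] eq_matI) auto

lemma minor_eq_0:
  assumes "p < N" "q < N" "p \<noteq> q" "u p = u q"
  shows "minor N f u = 0"
  unfolding minor_def
  by (rule det_identical_columns[OF _ assms(3,1,2)]) (use assms in \<open>auto intro!: eq_vecI\<close>)

text \<open>Every Leibniz term takes one factor from each row, so the row factors come out as the
  same product for all permutations. The values of the forms are scaled, not necessarily the
  vectors.\<close>

lemma minor_scale_rows:
  assumes "\<And>p q. p < N \<Longrightarrow> q < N \<Longrightarrow> f p (u' q) = c p * f p (u q)"
  shows "minor N f u' = (\<Prod>p<N. c p) * minor N f u"
proof -
  have "(\<Prod>i=0..<N. f i (u' (p i))) = (\<Prod>p<N. c p) * (\<Prod>i=0..<N. f i (u (p i)))"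
    if "p permutes {0..<N}" for p
    using assms permutes_in_image[OF that]
    by (simp add: prod.distrib[symmetric] atLeast0LessThan)
  moreover have "(\<Prod>i=0..<N. mat N N (\<lambda>(p, q). f p (u q)) $$ (i, p i)) = (\<Prod>i=0..<N. f i (u (p i)))"
    if "p permutes {0..<N}" for p u
    using permutes_in_image[OF that] by (intro prod.cong) auto
  ultimately show ?thesis
    by (simp add: minor_def det_def sum_distrib_left mult.left_commute)
qed

lemma minor_column_expansion:
  assumes "q < N"
  obtains d where "\<And>w. minor N f (u(q := w)) = (\<Sum>p<N. f p w * d p)"
proof -
  define M where "M w = mat N N (\<lambda>(p, q'). f p ((u(q := w)) q'))" for w
  \<comment> \<open>Cofactors along column \<open>q\<close> delete this very column, so an arbitrary
    placeholder may stand in it.\<close>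
  define d where "d p = cofactor (M undefined) p q" for p
  have "cofactor (M w) p q = d p" if "p < N" for w p
  proof -
    have "mat_delete (M w) p q = mat_delete (M undefined) p q"
      using assms that by (intro eq_matI) (auto simp: mat_delete_def M_def)
    then show ?thesis by (simp add: cofactor_def d_def)
  qed
  moreover have "M w $$ (p, q) = f p w" if "p < N" for w p
    using assms that by (simp add: M_def)
  moreover have "M w \<in> carrier_mat N N" for w
    by (simp add: M_def)
  ultimately have "det (M w) = (\<Sum>p<N. f p w * d p)" for w
    using laplace_expansion_column[of "M w" N q] assms by simp
  then show thesis using that[of d] by (simp only: minor_def M_def)
qed

context vector_space
begin

lemma minor_linear:
  assumes "q < N" "\<And>p. p < N \<Longrightarrow> Vector_Spaces.linear scale (*) (f p)"
  shows "Vector_Spaces.linear scale (*) (\<lambda>w. minor N f (u(q := w)))"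
proof -
  obtain d where "\<And>w. minor N f (u(q := w)) = (\<Sum>p<N. f p w * d p)"
    using minor_column_expansion[OF assms(1)] by blast
  then show ?thesis
    using assms(2) vector_space_axioms vector_space_self
    by (simp add: Vector_Spaces.linear_iff sum.distrib distrib_right sum_distrib_left mult.assoc)
qed

text \<open>A vector in the kernel of a singular matrix would give a nontrivial combination of the
  \<open>b q\<close> on which all forms vanish.\<close>

lemma minor_nonzero:
  assumes f: "\<And>p. p < N \<Longrightarrow> Vector_Spaces.linear scale (*) (f p)"
    and b: "inj_on b {..<N}" "independent (b ` {..<N})"
    and inj: "\<And>v. v \<in> span (b ` {..<N}) \<Longrightarrow> (\<And>p. p < N \<Longrightarrow> f p v = 0) \<Longrightarrow> v = 0"
  shows "minor N f b \<noteq> 0"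
proof
  let ?A = "mat N N (\<lambda>(p, q). f p (b q))"
  assume "minor N f b = 0"
  then obtain x where x: "x \<in> carrier_vec N" "x \<noteq> 0\<^sub>v N" "?A *\<^sub>v x = 0\<^sub>v N"
    using det_0_iff_vec_prod_zero_field[of ?A N] by (auto simp: minor_def)
  define v where "v = (\<Sum>q<N. scale (x $ q) (b q))"
  have "f p v = 0" if "p < N" for p
  proof -
    interpret f: Vector_Spaces.linear scale "(*)" "f p" by (rule f[OF that])
    have "f p v = (\<Sum>q<N. f p (b q) * x $ q)"
      by (simp add: v_def f.sum f.scale mult.commute)
    also have "\<dots> = (?A *\<^sub>v x) $ p"
      using that x(1) by (simp add: scalar_prod_def atLeast0LessThan)
    finally show ?thesis using x(3) that by simp
  qed
  moreover have "v \<in> span (b ` {..<N})"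
    unfolding v_def by (intro span_sum span_scale span_base) auto
  ultimately have "v = 0" using inj by blast
  have "x $ q = 0" if "q < N" for q
  proof -
    have "(\<Sum>y\<in>b ` {..<N}. scale (x $ (the_inv_into {..<N} b y)) y) = v"
      unfolding v_def using b(1) by (simp add: sum.reindex the_inv_into_f_f)
    then have "x $ (the_inv_into {..<N} b (b q)) = 0"
      using independentD[OF b(2) _ order_refl, of "\<lambda>y. x $ (the_inv_into {..<N} b y)" "b q"] that \<open>v = 0\<close>
      by simp
    then show ?thesis using that b(1) by (simp add: the_inv_into_f_f)
  qed
  then have "x = 0\<^sub>v N" using x(1) by (intro eq_vecI) auto
  then show False using x(2) by simp
qed

end

section \<open>Forms on tensor products of exterior powers\<close>

lemma prod_power_int:
  fixes t :: "'a::field"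
  assumes "t \<noteq> 0"
  shows "(\<Prod>x\<in>A. t powi e x) = t powi (\<Sum>x\<in>A. e x)"
  using assms by (induction A rule: infinite_finite_induct) (auto simp: power_int_add)

lemma positions_Sigma: "positions k rs n = (SIGMA i:{1..k}. {..<n i} \<times> {..<rs i})"
  by (auto simp: positions_def)

lemma finite_positions: "finite (positions k rs n)"
  by (simp add: positions_Sigma)

lemma sum_positions:
  "(\<Sum>j\<in>positions k rs n. h j) = (\<Sum>i=1..k. \<Sum>c<n i. \<Sum>p<rs i. h (i, c, p))"
proof -
  have "(\<Sum>j\<in>positions k rs n. h j) = (\<Sum>i=1..k. \<Sum>x\<in>{..<n i} \<times> {..<rs i}. h (i, x))"
    unfolding positions_Sigma by (subst sum.Sigma) (auto simp: case_prod_unfold)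
  also have "\<dots> = (\<Sum>i=1..k. \<Sum>c<n i. \<Sum>p<rs i. h (i, c, p))"
    by (intro sum.cong refl) (simp add: sum.cartesian_product case_prod_unfold)
  finally show ?thesis .
qed

lemma sigma_space_linear:
  "T \<in> sigma_space sw k rs n \<Longrightarrow> j \<in> positions k rs n \<Longrightarrow>
     Vector_Spaces.linear sw (*) (\<lambda>w. T (u(j := w)))"
  by (simp add: sigma_space_def)

lemma sigma_space_cong:
  "T \<in> sigma_space sw k rs n \<Longrightarrow> (\<And>j. j \<in> positions k rs n \<Longrightarrow> u j = u' j) \<Longrightarrow> T u = T u'"
  by (simp add: sigma_space_def)

lemma sigma_space_alternating:
  "T \<in> sigma_space sw k rs n \<Longrightarrow> (i, c, p) \<in> positions k rs n \<Longrightarrow> (i, c, q) \<in> positions k rs n \<Longrightarrow>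
     p \<noteq> q \<Longrightarrow> u (i, c, p) = u (i, c, q) \<Longrightarrow> T u = 0"
  unfolding sigma_space_def by blast

text \<open>A linear form that is nonzero on a span is nonzero on a spanning set; this is applied to
  one position after another. It serves twice below, to reach vectors of an adapted basis and then
  homogeneous vectors.\<close>

lemma sigma_space_span_choice:
  assumes T: "T \<in> sigma_space sw k rs n" and "vector_space sw"
    and "\<And>j. j \<in> positions k rs n \<Longrightarrow> u j \<in> module.span sw (S j)" and "T u \<noteq> 0"
  obtains u' where "\<And>j. j \<in> positions k rs n \<Longrightarrow> u' j \<in> S j" "T u' \<noteq> 0"
proof -
  interpret vector_space sw by fact
  have "\<exists>u'. (\<forall>j\<in>P. u' j \<in> S j) \<and> (\<forall>j. j \<notin> P \<longrightarrow> u' j = u j) \<and> T u' \<noteq> 0"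
    if "finite P" "P \<subseteq> positions k rs n" for P
    using that
  proof (induction P)
    case empty
    then show ?case using assms(4) by auto
  next
    case (insert j P)
    then obtain u' where u': "\<forall>i\<in>P. u' i \<in> S i" "\<forall>i. i \<notin> P \<longrightarrow> u' i = u i" "T u' \<noteq> 0" by auto
    interpret l: Vector_Spaces.linear sw "(*)" "\<lambda>w. T (u'(j := w))"
      using sigma_space_linear[OF T] insert.prems by simp
    have "\<exists>w\<in>S j. T (u'(j := w)) \<noteq> 0"
    proof (rule ccontr)
      assume "\<not> ?thesis"
      then have "T (u'(j := u j)) = 0"
        using l.eq_0_on_span[of "S j" "u j"] assms(3) insert.prems by auto
      moreover have "u'(j := u j) = u'" using u'(2) insert.hyps(2) by (metis fun_upd_triv)
      ultimately show False using u'(3) by simp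
    qed
    then obtain w where "w \<in> S j" "T (u'(j := w)) \<noteq> 0" by blast
    moreover have "\<forall>i\<in>insert j P. (u'(j := w)) i \<in> S i"
      using u'(1) \<open>w \<in> S j\<close> by simp
    moreover have "\<forall>i. i \<notin> insert j P \<longrightarrow> (u'(j := w)) i = u i"
      using u'(2) by simp
    ultimately show ?case by blast
  qed
  from this[OF finite_positions order_refl] show thesis using that by blast
qed

lemma sigma_space_scale:
  assumes T: "T \<in> sigma_space sw k rs n"
  shows "T (\<lambda>j. sw (c j) (u j)) = (\<Prod>j\<in>positions k rs n. c j) * T u"
proof -
  have "T (\<lambda>j. if j \<in> P then sw (c j) (u j) else u j) = (\<Prod>j\<in>P. c j) * T u"
    if "finite P" "P \<subseteq> positions k rs n" for P
    using that
  proof (induction P)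
    case empty
    then show ?case by simp
  next
    case (insert j P)
    define u' where "u' i = (if i \<in> P then sw (c i) (u i) else u i)" for i
    have lin: "Vector_Spaces.linear sw (*) (\<lambda>w. T (u'(j := w)))"
      using sigma_space_linear[OF T] insert.prems by simp
    have "(\<lambda>i. if i \<in> insert j P then sw (c i) (u i) else u i) = u'(j := sw (c j) (u j))"
      by (auto simp: u'_def)
    then have "T (\<lambda>i. if i \<in> insert j P then sw (c i) (u i) else u i) = c j * T (u'(j := u j))"
      using lin unfolding Vector_Spaces.linear_iff by simp
    also have "u'(j := u j) = u'" using insert.hyps(2) by (auto simp: u'_def)
    also have "T u' = (\<Prod>j\<in>P. c j) * T u"
      using insert unfolding u'_def by simp
    finally show ?case using insert.hyps by simp
  qed
  from this[OF finite_positions order_refl]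
  have "T (\<lambda>j. if j \<in> positions k rs n then sw (c j) (u j) else u j) = (\<Prod>j\<in>positions k rs n. c j) * T u" .
  moreover have "T (\<lambda>j. sw (c j) (u j)) = T (\<lambda>j. if j \<in> positions k rs n then sw (c j) (u j) else u j)"
    by (rule sigma_space_cong[OF T]) simp
  ultimately show ?thesis by (rule trans[rotated])
qed

text \<open>The decomposable element of the form space: one exterior product of forms for each copy
  of each exterior power, all copies of the \<open>i\<close>-th power carrying the same forms
  \<open>f i\<close>.\<close>

definition minor_tensor ::
  "nat \<Rightarrow> (nat \<Rightarrow> nat) \<Rightarrow> (nat \<Rightarrow> nat) \<Rightarrow> (nat \<Rightarrow> nat \<Rightarrow> 'w \<Rightarrow> complex) \<Rightarrow> 'w form" where
  "minor_tensor k rs n f u =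
     (\<Prod>(i, c)\<in>(SIGMA i:{1..k}. {..<n i}). minor (rs i) (f i) (\<lambda>p. u (i, c, p)))"

lemma minor_tensor_mem:
  assumes "vector_space sw" and f: "\<And>i p. i \<in> {1..k} \<Longrightarrow> p < rs i \<Longrightarrow> Vector_Spaces.linear sw (*) (f i p)"
  shows "minor_tensor k rs n f \<in> sigma_space sw k rs n"
proof -
  interpret vector_space sw by fact
  let ?I = "SIGMA i:{1..k}. {..<n i}"
  have cong: "minor_tensor k rs n f u = minor_tensor k rs n f u'"
    if "\<forall>j\<in>positions k rs n. u j = u' j" for u u'
    unfolding minor_tensor_def
    by (intro prod.cong refl) (use that in \<open>auto simp: positions_def intro!: minor_cong\<close>)
  have lin: "Vector_Spaces.linear sw (*) (\<lambda>w. minor_tensor k rs n f (u(j := w)))"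
    if "j \<in> positions k rs n" for u j
  proof -
    obtain i c p where j: "j = (i, c, p)" "(i, c) \<in> ?I" "i \<in> {1..k}" "p < rs i"
      using \<open>j \<in> positions k rs n\<close> by (auto simp: positions_def)
    \<comment> \<open>Only the minor of the copy that contains the position \<open>j\<close> depends
      on the vector inserted there; \<open>K\<close> collects the other factors.\<close>
    define K where "K = (\<Prod>(i', c')\<in>?I - {(i, c)}. minor (rs i') (f i') (\<lambda>p. u (i', c', p)))"
    have "minor_tensor k rs n f (u(j := w)) = minor (rs i) (f i) ((\<lambda>p. u (i, c, p))(p := w)) * K" for w
    proof -
      have "minor_tensor k rs n f (u(j := w)) =
          minor (rs i) (f i) (\<lambda>p'. (u(j := w)) (i, c, p')) *
          (\<Prod>(i', c')\<in>?I - {(i, c)}. minor (rs i') (f i') (\<lambda>p. (u(j := w)) (i', c', p)))"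
        unfolding minor_tensor_def by (subst prod.remove[OF _ j(2)]) simp_all
      also have "(\<lambda>p'. (u(j := w)) (i, c, p')) = (\<lambda>p. u (i, c, p))(p := w)"
        using j(1) by auto
      also have "(\<Prod>(i', c')\<in>?I - {(i, c)}. minor (rs i') (f i') (\<lambda>p. (u(j := w)) (i', c', p))) = K"
        unfolding K_def by (intro prod.cong) (auto simp: j(1) split: if_splits intro!: minor_cong)
      finally show ?thesis .
    qed
    then show ?thesis
      using minor_linear[of p "rs i" "f i" "\<lambda>p. u (i, c, p)", OF j(4) f[OF j(3)]]
      by (simp add: Vector_Spaces.linear_iff distrib_right)
  qed
  have alt: "minor_tensor k rs n f u = 0"
    if "(i, c, p) \<in> positions k rs n" "(i, c, q) \<in> positions k rs n" "p \<noteq> q" "u (i, c, p) = u (i, c, q)" for u i c p q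
  proof -
    have "minor (rs i) (f i) (\<lambda>p. u (i, c, p)) = 0"
      by (rule minor_eq_0[of p _ q]) (use that in \<open>auto simp: positions_def\<close>)
    then show ?thesis
      unfolding minor_tensor_def using that(1)
      by (intro prod_zero) (auto simp: positions_def intro!: bexI[of _ "(i, c)"])
  qed
  show ?thesis
    unfolding sigma_space_def using cong lin alt by blast
qed

lemma minor_tensor_scale:
  assumes "\<And>i c p q. (i, c, q) \<in> positions k rs n \<Longrightarrow> p < rs i \<Longrightarrow>
    f i p (u' (i, c, q)) = d i p * f i p (u (i, c, q))"
  shows "minor_tensor k rs n f u' = (\<Prod>i=1..k. \<Prod>c<n i. \<Prod>p<rs i. d i p) * minor_tensor k rs n f u"
proof -
  have "minor_tensor k rs n f u' =
      (\<Prod>(i, c)\<in>(SIGMA i:{1..k}. {..<n i}). (\<Prod>p<rs i. d i p) * minor (rs i) (f i) (\<lambda>p. u (i, c, p)))"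
    unfolding minor_tensor_def
    by (intro prod.cong refl) (use assms in \<open>auto simp: positions_def intro!: minor_scale_rows\<close>)
  also have "\<dots> = (\<Prod>(i, c)\<in>(SIGMA i:{1..k}. {..<n i}). \<Prod>p<rs i. d i p) * minor_tensor k rs n f u"
    by (simp add: minor_tensor_def prod.distrib case_prod_unfold)
  also have "(\<Prod>(i, c)\<in>(SIGMA i:{1..k}. {..<n i}). \<Prod>p<rs i. d i p) =
      (\<Prod>i=1..k. \<Prod>c<n i. \<Prod>p<rs i. d i p)"
    by (rule prod.Sigma[symmetric]) auto
  finally show ?thesis .
qed

lemma minor_tensor_nonzero:
  assumes "\<And>i. i \<in> {1..k} \<Longrightarrow> minor (rs i) (f i) (b i) \<noteq> 0"
  shows "minor_tensor k rs n f (\<lambda>(i, _, p). b i p) \<noteq> 0"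
  unfolding minor_tensor_def using assms by (auto simp: case_prod_unfold)

section \<open>Levels and adapted bases\<close>

context split_space
begin

lemma subspace_W: "j \<in> {1..m+1} \<Longrightarrow> subspace (W j)"
  unfolding subspace_def using mem_W_iff by (simp add: proj_0 proj_add proj_scale)

lemma W_mono: "i \<le> j \<Longrightarrow> i \<in> {1..m+1} \<Longrightarrow> j \<in> {1..m+1} \<Longrightarrow> W i \<subseteq> W j"
  using mem_W_iff by (meson le_less_trans subsetI)

definition level :: "'b \<Rightarrow> nat" where
  "level x = (LEAST j. j \<in> {1..m+1} \<and> x \<in> W j)"

lemma level_mem: "level x \<in> {1..m+1}" and mem_W_level: "x \<in> W (level x)"
proof -
  have "x \<in> W (m + 1)" unfolding top by (rule UNIV_I)
  then have "m + 1 \<in> {1..m+1} \<and> x \<in> W (m + 1)" by simp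
  from LeastI[of "\<lambda>j. j \<in> {1..m+1} \<and> x \<in> W j", OF this]
  show "level x \<in> {1..m+1}" "x \<in> W (level x)" unfolding level_def by blast+
qed

lemma mem_W_iff_level: "j \<in> {1..m+1} \<Longrightarrow> x \<in> W j \<longleftrightarrow> level x \<le> j"
  using Least_le[of "\<lambda>j. j \<in> {1..m+1} \<and> x \<in> W j" j] W_mono[of "level x" j] level_mem[of x] mem_W_level[of x]
  unfolding level_def by blast

lemma proj_above_level: "j \<in> {1..m+1} \<Longrightarrow> level x < j \<Longrightarrow> proj j x = 0"
  using mem_W_iff[OF level_mem[of x]] mem_W_level[of x] by blast

text \<open>The component at the level is the leading term: without it the vector would lie one step
  lower. Level 1 is treated apart because the splitting says nothing about
  \<open>W 0\<close>.\<close>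

lemma proj_level_eq_0:
  assumes "proj (level x) x = 0"
  shows "x = 0"
proof (cases "level x = 1")
  case True
  show ?thesis
  proof (rule proj_ext)
    fix i assume i: "i \<in> {1..m+1}"
    show "proj i x = proj i 0"
    proof (cases "i = 1")
      case False
      then show ?thesis using proj_above_level[OF i] i True proj_0[OF i] by auto
    qed (use assms True proj_0[OF i] in auto)
  qed
next
  case False
  then have l: "level x - 1 \<in> {1..m+1}" "level x - 1 < level x" using level_mem[of x] by auto
  have "proj i x = 0" if "i \<in> {1..m+1}" "level x - 1 < i" for i
    using assms proj_above_level[OF that(1)] that(2) by (cases "i = level x") auto
  then have "x \<in> W (level x - 1)" using mem_W_iff[OF l(1)] by blast
  then show ?thesis using mem_W_iff_level[OF l(1)] l(2) by simp
qed

definition adapted_basis :: "'b set \<Rightarrow> 'b set \<Rightarrow> bool" where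
  "adapted_basis V B \<longleftrightarrow> finite B \<and> independent B \<and> span B = V \<and>
     (\<forall>j\<in>{1..m+1}. span (B \<inter> W j) = V \<inter> W j)"

lemma adapted_basis_exists:
  assumes V: "subspace V" "V \<subseteq> span F" "finite F"
  shows "\<exists>B. adapted_basis V B"
proof -
  define U where "U j = (if j = 0 then {0} else V \<inter> W (min j (m + 1)))" for j
  have sub: "subspace (U j)" for j
    using V(1) subspace_W[of "min j (m + 1)"] by (auto simp: U_def intro!: subspace_inter)
  have mono: "U j \<subseteq> U (Suc j)" for j
  proof (cases "j = 0")
    case True
    then show ?thesis using subspace_0[OF sub[of "Suc j"]] by (simp add: U_def)
  next
    case False
    then show ?thesis
      using W_mono[of "min j (m + 1)" "min (Suc j) (m + 1)"] by (auto simp: U_def min_def split: if_splits)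
  qed
  obtain B where B: "\<And>i j. i \<le> j \<Longrightarrow> B i \<subseteq> B j" "\<And>j::nat. independent (B j)" "\<And>j. span (B j) = U j"
    by (rule nested_bases[of U, OF sub mono]) blast
  have U: "U j = V \<inter> W j" if "j \<in> {1..m+1}" for j
    using that by (auto simp: U_def min_def)
  have span: "span (B (m + 1)) = V"
    unfolding B(3) using U[of "m + 1"] top by simp
  moreover have "finite (B (m + 1))"
    using independent_span_bound[OF V(3) B(2)] V(2) span_superset span by blast
  moreover have "span (B (m + 1) \<inter> W j) = V \<inter> W j" if j: "j \<in> {1..m+1}" for j
  proof
    show "span (B (m + 1) \<inter> W j) \<subseteq> V \<inter> W j"
      using span_mono[of "B (m + 1) \<inter> W j" "B (m + 1)"] span span_minimal[OF _ subspace_W[OF j]] by blast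
    have "B j \<subseteq> B (m + 1) \<inter> W j"
      using B(1)[of j "m + 1"] j span_superset[of "B j"] U[OF j] B(3)[of j] by auto
    then show "V \<inter> W j \<subseteq> span (B (m + 1) \<inter> W j)"
      using span_mono B(3)[of j] U[OF j] by blast
  qed
  ultimately show ?thesis
    unfolding adapted_basis_def using B(2) by blast
qed

text \<open>The sum of \<gamma> over the jumps of the filtration induced on \<open>V\<close>, with
  multiplicity, rewritten by Abel summation. In this form it involves dimensions of intersections
  only, hence no choice of basis, and these are the dimensions in the parabolic degree.\<close>

definition flag_weight :: "(nat \<Rightarrow> rat) \<Rightarrow> 'b set \<Rightarrow> rat" where
  "flag_weight \<gamma> V = of_nat (dim V) * \<gamma> (m + 1) -
     (\<Sum>j=1..m. (\<gamma> (j + 1) - \<gamma> j) * of_nat (dim (V \<inter> W j)))"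

lemma sum_level:
  assumes "adapted_basis V B"
  shows "(\<Sum>x\<in>B. \<gamma> (level x)) = flag_weight \<gamma> V"
proof -
  have B: "finite B" "independent B" "span B = V"
    and BW: "\<And>j. j \<in> {1..m+1} \<Longrightarrow> span (B \<inter> W j) = V \<inter> W j"
    using assms by (auto simp: adapted_basis_def)
  have card: "card (B \<inter> W j) = dim (V \<inter> W j)" if "j \<in> {1..m+1}" for j
    using dim_span_eq_card_independent[OF independent_mono[OF B(2)], of "B \<inter> W j"] BW[OF that] by simp
  \<comment> \<open>The increments of \<gamma> from the level of \<open>x\<close> upwards telescope,
    and they are the ones whose step contains \<open>x\<close>.\<close>
  have \<gamma>: "\<gamma> (level x) = \<gamma> (m + 1) - (\<Sum>j=1..m. if x \<in> W j then \<gamma> (j + 1) - \<gamma> j else 0)" for x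
  proof -
    have "(\<Sum>j=1..m. if x \<in> W j then \<gamma> (j + 1) - \<gamma> j else 0) = (\<Sum>j=level x..m. \<gamma> (Suc j) - \<gamma> j)"
      using level_mem[of x] mem_W_iff_level[of _ x]
      by (intro sum.mono_neutral_cong_right) auto
    also have "\<dots> = \<gamma> (m + 1) - \<gamma> (level x)"
      using level_mem[of x] by (subst sum_Suc_diff) auto
    finally show ?thesis by simp
  qed
  have "(\<Sum>x\<in>B. \<gamma> (level x)) =
      of_nat (card B) * \<gamma> (m + 1) - (\<Sum>x\<in>B. \<Sum>j=1..m. if x \<in> W j then \<gamma> (j + 1) - \<gamma> j else 0)"
    unfolding \<gamma> by (simp only: sum_subtractf sum_constant)
  also have "(\<Sum>x\<in>B. \<Sum>j=1..m. if x \<in> W j then \<gamma> (j + 1) - \<gamma> j else 0)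
      = (\<Sum>j=1..m. \<Sum>x\<in>B. if x \<in> W j then \<gamma> (j + 1) - \<gamma> j else 0)"
    by (rule sum.swap)
  also have "\<dots> = (\<Sum>j=1..m. (\<gamma> (j + 1) - \<gamma> j) * of_nat (dim (V \<inter> W j)))"
  proof (intro sum.cong refl)
    fix j assume "j \<in> {1..m}"
    then have "j \<in> {1..m+1}" by simp
    have "(\<Sum>x\<in>B. if x \<in> W j then \<gamma> (j + 1) - \<gamma> j else 0) = (\<Sum>x\<in>B \<inter> W j. \<gamma> (j + 1) - \<gamma> j)"
      by (rule sum.inter_restrict[OF B(1), symmetric])
    then show "(\<Sum>x\<in>B. if x \<in> W j then \<gamma> (j + 1) - \<gamma> j else 0) = (\<gamma> (j + 1) - \<gamma> j) * of_nat (dim (V \<inter> W j))"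
      using card[OF \<open>j \<in> {1..m+1}\<close>] by (simp only: sum_constant mult.commute)
  qed
  also have "card B = dim V"
    using dim_span_eq_card_independent[OF B(2)] B(3) by simp
  finally show ?thesis by (simp only: flag_weight_def)
qed

text \<open>
  The matrix of these forms on the basis is unitriangular when both are ordered by level; its minor is the
  Pluecker coordinate of minimal weight.
\<close>

lemma leading_forms:
  assumes "adapted_basis V B"
  obtains f where "\<And>x. x \<in> B \<Longrightarrow> Vector_Spaces.linear scale (*) (f x)"
    "\<And>x v. x \<in> B \<Longrightarrow> f x (proj (level x) v) = f x v"
    "\<And>x y. x \<in> B \<Longrightarrow> y \<in> B \<Longrightarrow> level y = level x \<Longrightarrow> f x y = (if y = x then 1 else 0)"
proof -
  have B: "finite B" "independent B" "span B = V"
    and BW: "\<And>j. j \<in> {1..m+1} \<Longrightarrow> span (B \<inter> W j) = V \<inter> W j"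
    using assms by (auto simp: adapted_basis_def)
  have "\<exists>g. Vector_Spaces.linear scale (*) g \<and> (\<forall>v. g (proj (level x) v) = g v) \<and>
      (\<forall>y\<in>B. level y = level x \<longrightarrow> g y = (if y = x then 1 else 0))" if x: "x \<in> B" for x
  proof -
    define l where "l = level x"
    define C where "C = {y \<in> B. level y = l}"
    have l: "l \<in> {1..m+1}" by (simp only: l_def level_mem)
    interpret p: Vector_Spaces.linear scale scale "proj l" by (rule linear_proj[OF l])
    \<comment> \<open>A nonzero vector of this span without component at \<open>l\<close> would have
      lower level. By adaptedness it would be a combination of basis vectors of lower level, none of
      which belongs to \<open>C\<close>.\<close>
    have inj: "inj_on (proj l) (span C)"
    proof (subst p.inj_on_iff_eq_0[OF subspace_span], intro ballI impI)
      fix v assume v: "v \<in> span C" "proj l v = 0"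
      have "C \<subseteq> V \<inter> W l"
        using B(3) span_superset[of B] mem_W_iff_level[OF l] by (auto simp: C_def)
      then have vVW: "v \<in> V \<inter> W l"
        using v(1) span_minimal[of C "V \<inter> W l"] subspace_inter[OF _ subspace_W[OF l]] B(3) subspace_span by blast
      show "v = 0"
      proof (rule ccontr)
        assume "v \<noteq> 0"
        then have "level v \<noteq> l" using v(2) proj_level_eq_0 by blast
        then have "level v < l" using vVW mem_W_iff_level[OF l, of v] by auto
        have "v \<in> V \<inter> W (level v)" using vVW mem_W_level by blast
        then have "v \<in> span (B \<inter> W (level v))" using BW[OF level_mem] by blast
        moreover have "C \<inter> (B \<inter> W (level v)) = {}"
          using \<open>level v < l\<close> mem_W_iff_level[OF level_mem] by (auto simp: C_def)
        moreover have "independent (C \<union> (B \<inter> W (level v)))"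
          by (rule independent_mono[OF B(2)]) (auto simp: C_def)
        ultimately show False using span_Int_disjoint_eq_0 v(1) \<open>v \<noteq> 0\<close> by blast
      qed
    qed
    have "independent (proj l ` C)"
      by (rule p.independent_injective_image[OF independent_mono[OF B(2)] inj]) (auto simp: C_def)
    then obtain g where g: "Vector_Spaces.linear scale (*) g"
        "\<And>y. y \<in> proj l ` C \<Longrightarrow> g y = (if y = proj l x then 1 else 0)"
      using linear_form_extend[of "proj l ` C" "\<lambda>y. if y = proj l x then 1 else 0"] by metis
    have "Vector_Spaces.linear scale (*) (g \<circ> proj l)"
      using Vector_Spaces.linear_compose[OF linear_proj[OF l] g(1)] .
    moreover have "(g \<circ> proj l) (proj (level x) v) = (g \<circ> proj l) v" for v
      using proj_proj[OF l l] by (simp add: l_def)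
    moreover have "(g \<circ> proj l) y = (if y = x then 1 else 0)" if "y \<in> B" "level y = level x" for y
    proof -
      have "y \<in> C" "x \<in> C" using that x by (auto simp: C_def l_def)
      then show ?thesis
        using g(2)[of "proj l y"] inj_onD[OF inj, of y x] span_base by auto
    qed
    ultimately show ?thesis by blast
  qed
  then obtain f where "\<And>x. x \<in> B \<Longrightarrow> Vector_Spaces.linear scale (*) (f x) \<and> (\<forall>v. f x (proj (level x) v) = f x v) \<and>
      (\<forall>y\<in>B. level y = level x \<longrightarrow> f x y = (if y = x then 1 else 0))"
    by metis
  then show thesis using that by blast
qed

text \<open>Among the basis vectors that occur in \<open>v\<close>, take one of maximal level. Its
  form kills the others of that level by duality and those of lower level because they have no
  component there, so it returns the nonzero coefficient.\<close>

lemma leading_forms_injective: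
  assumes "adapted_basis V B"
    and f: "\<And>x. x \<in> B \<Longrightarrow> Vector_Spaces.linear scale (*) (f x)"
      "\<And>x v. x \<in> B \<Longrightarrow> f x (proj (level x) v) = f x v"
      "\<And>x y. x \<in> B \<Longrightarrow> y \<in> B \<Longrightarrow> level y = level x \<Longrightarrow> f x y = (if y = x then 1 else 0)"
    and v: "v \<in> V" "\<And>x. x \<in> B \<Longrightarrow> f x v = 0"
  shows "v = 0"
proof -
  have B: "finite B" "span B = V"
    using assms(1) by (auto simp: adapted_basis_def)
  obtain c where c: "v = (\<Sum>x\<in>B. scale (c x) x)"
    using v(1) B span_finite by (metis (no_types, lifting) imageE)
  have "c x = 0" if "x \<in> B" for x
  proof (rule ccontr)
    assume "c x \<noteq> 0"
    define S where "S = {x \<in> B. c x \<noteq> 0}"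
    have S: "finite S" "S \<noteq> {}" using B(1) that \<open>c x \<noteq> 0\<close> by (auto simp: S_def)
    have "Max (level ` S) \<in> level ` S" using S by (intro Max_in) auto
    then obtain z where "z \<in> S" "Max (level ` S) = level z" by blast
    moreover from this have "level y \<le> level z" if "y \<in> S" for y
      using Max_ge[of "level ` S" "level y"] S(1) that by simp
    ultimately have z: "z \<in> S" "\<And>y. y \<in> S \<Longrightarrow> level y \<le> level z" by blast+
    then have "z \<in> B" by (simp add: S_def)
    interpret fz: Vector_Spaces.linear scale "(*)" "f z" by (rule f(1)[OF \<open>z \<in> B\<close>])
    have "f z v = (\<Sum>x\<in>B. c x * f z x)" unfolding c by (simp add: fz.sum fz.scale)
    also have "\<dots> = (\<Sum>x\<in>B. if x = z then c z else 0)"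
    proof (intro sum.cong refl)
      fix y assume "y \<in> B"
      consider "c y = 0" | "level y = level z" | "level y < level z"
        using z(2)[of y] \<open>y \<in> B\<close> by (fastforce simp: S_def)
      then show "c y * f z y = (if y = z then c z else 0)"
      proof cases
        case 3
        then have "f z y = f z 0"
          using f(2)[OF \<open>z \<in> B\<close>, of y] proj_above_level[OF level_mem, of y z] by simp
        then show ?thesis using 3 fz.zero by auto
      qed (use f(3)[OF \<open>z \<in> B\<close> \<open>y \<in> B\<close>] in auto)
    qed
    also have "\<dots> = c z" using B(1) \<open>z \<in> B\<close> by simp
    finally show False using v(2)[OF \<open>z \<in> B\<close>] z(1) by (simp add: S_def)
  qed
  then show ?thesis unfolding c by simp
qed

end

section \<open>Weights of the Pluecker coordinates of a flag\<close>

lemma two_powi_inject: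
  assumes "(2::complex) powi i = 2 powi j"
  shows "i = j"
proof -
  have "norm ((2::complex) powi i) = norm ((2::complex) powi j)" using assms by (rule arg_cong)
  then have "(2::real) powi i = 2 powi j" by (simp only: norm_power_int norm_numeral)
  then show ?thesis
    using power_int_strict_increasing[of i j "2::real"] power_int_strict_increasing[of j i "2::real"]
    by (cases i j rule: linorder_cases) auto
qed

locale complex_split_space = split_space sw m W D
  for sw :: "complex \<Rightarrow> 'w::ab_group_add \<Rightarrow> 'w" and m W D
begin

text \<open>One nonzero value at homogeneous vectors pins down the weight of a form. The minus sign
  arises because the group acts on forms through the inverse on their arguments.\<close>

lemma sigma_weight_eq:
  assumes T: "T \<in> weight_space sw m D \<gamma> (sigma_space sw k rs n) sigma_smul sigma_act \<chi>"
    and a: "\<And>j. j \<in> positions k rs n \<Longrightarrow> a j \<in> {1..m+1} \<and> u j \<in> D (a j)"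
    and "T u \<noteq> 0"
  shows "\<chi> = - (\<Sum>j\<in>positions k rs n. \<gamma> (a j))"
proof -
  let ?P = "positions k rs n"
  obtain q :: nat and e N where q: "0 < q" "\<forall>i\<in>{1..m+1}. of_int (e i) = of_nat q * \<gamma> i"
      "of_int N = of_nat q * \<chi>" and T': "T \<in> sigma_space sw k rs n"
      and act: "\<And>t. t \<noteq> 0 \<Longrightarrow> sigma_act (one_parameter e t) T = sigma_smul (t powi N) T"
    using T unfolding mem_weight_space_iff by blast
  have "2 powi N * T u = T (inv_into UNIV (one_parameter e 2) \<circ> u)"
    using act[of 2] by (simp add: sigma_act_def sigma_smul_def fun_eq_iff)
  also have "\<dots> = T (\<lambda>j. sw (2 powi (- e (a j))) (u j))"
  proof (rule sigma_space_cong[OF T'])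
    fix j assume "j \<in> ?P"
    then have "one_parameter e (inverse 2) (u j) = sw (inverse 2 powi e (a j)) (u j)"
      using a by (intro one_parameter_D) auto
    then show "(inv_into UNIV (one_parameter e 2) \<circ> u) j = sw (2 powi (- e (a j))) (u j)"
      by (simp only: o_apply inv_one_parameter[OF zero_neq_numeral[symmetric]] power_int_minus power_int_inverse)
  qed
  also have "\<dots> = 2 powi (\<Sum>j\<in>?P. - e (a j)) * T u"
    by (simp only: sigma_space_scale[OF T'] prod_power_int[OF zero_neq_numeral[symmetric]])
  finally have "(2::complex) powi N = 2 powi (\<Sum>j\<in>?P. - e (a j))"
    using \<open>T u \<noteq> 0\<close> by simp
  then have "N = (\<Sum>j\<in>?P. - e (a j))" by (rule two_powi_inject)
  then have "of_nat q * \<chi> = (\<Sum>j\<in>?P. - (of_nat q * \<gamma> (a j)))"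
    using q(2,3) a by (simp del: atLeastAtMost_iff)
  also have "\<dots> = of_nat q * - (\<Sum>j\<in>?P. \<gamma> (a j))"
    by (simp only: sum_negf sum_distrib_left mult_minus_right)
  finally have "of_nat q * \<chi> = of_nat q * - (\<Sum>j\<in>?P. \<gamma> (a j))" .
  moreover have "of_nat q \<noteq> (0::rat)" using q(1) by simp
  ultimately show ?thesis by (metis mult_left_cancel)
qed

text \<open>The decomposable tensor may be tested on adapted bases. Expanding a basis vector into
  homogeneous components leads only to indices up to its level, and \<gamma> is increasing, so the
  leading terms bound the weights from below. The minor of the leading forms attains the
  bound.\<close>

lemma sigma_weights:
  assumes \<gamma>: "\<And>i j. i \<in> {1..m+1} \<Longrightarrow> j \<in> {1..m+1} \<Longrightarrow> i \<le> j \<Longrightarrow> \<gamma> i \<le> \<gamma> j"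
    and b: "\<And>i. i \<in> {1..k} \<Longrightarrow> inj_on (b i) {..<rs i} \<and> independent (b i ` {..<rs i}) \<and>
      span (b i ` {..<rs i}) = V i"
    and s: "\<And>T. T \<in> sigma_space sw k rs n \<Longrightarrow> s T = c * T (\<lambda>(i, _, p). b i p)" and "c \<noteq> 0"
  shows "Min {\<chi>. \<exists>T\<in>weight_space sw m D \<gamma> (sigma_space sw k rs n) sigma_smul sigma_act \<chi>. s T \<noteq> 0} =
    - (\<Sum>i=1..k. of_nat (n i) * flag_weight \<gamma> (V i))" (is "Min ?S = - ?w")
proof -
  let ?P = "positions k rs n"
  have "\<exists>B. adapted_basis (V i) B" if i: "i \<in> {1..k}" for i
  proof (rule adapted_basis_exists)
    show "V i \<subseteq> span (b i ` {..<rs i})" "subspace (V i)" using b[OF i] by (blast, metis subspace_span)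
  qed simp
  then obtain B where B: "\<And>i. i \<in> {1..k} \<Longrightarrow> adapted_basis (V i) (B i)" by metis
  have card: "card (B i) = rs i" if i: "i \<in> {1..k}" for i
  proof -
    have "independent (B i)" "span (B i) = V i" "independent (b i ` {..<rs i})"
        "span (b i ` {..<rs i}) = V i" "card (b i ` {..<rs i}) = rs i"
      using B[OF i] b[OF i] by (auto simp: adapted_basis_def card_image)
    then show ?thesis using dim_span_eq_card_independent by metis
  qed
  have sum_B: "(\<Sum>j\<in>?P. \<gamma> (level (u j))) = ?w"
    if bij: "\<And>i c. i \<in> {1..k} \<Longrightarrow> c < n i \<Longrightarrow> bij_betw (\<lambda>p. u (i, c, p)) {..<rs i} (B i)" for u
  proof -
    have "(\<Sum>p<rs i. \<gamma> (level (u (i, c, p)))) = flag_weight \<gamma> (V i)" if "i \<in> {1..k}" "c < n i" for i c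
      using sum.reindex_bij_betw[OF bij[OF that], of "\<lambda>x. \<gamma> (level x)"] sum_level[OF B[OF that(1)]] by simp
    then show ?thesis by (simp add: sum_positions)
  qed

  \<comment> \<open>Besides satisfying the bound, each weight is located in a finite set of sums, so
    that \<open>Min\<close> is a genuine minimum.\<close>
  have upper: "- ?w \<le> \<chi> \<and> \<chi> \<in> (\<lambda>a. - (\<Sum>j\<in>?P. \<gamma> (a j))) ` (?P \<rightarrow>\<^sub>E {1..m+1})" if \<chi>_mem: "\<chi> \<in> ?S" for \<chi>
  proof -
    obtain T where T: "T \<in> weight_space sw m D \<gamma> (sigma_space sw k rs n) sigma_smul sigma_act \<chi>"
        and ne: "s T \<noteq> 0" using \<chi>_mem by blast
    then have T': "T \<in> sigma_space sw k rs n" by (simp add: weight_space_def)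
    obtain u where u: "\<And>j. j \<in> ?P \<Longrightarrow> u j \<in> B (fst j)" "T u \<noteq> 0"
    proof (rule sigma_space_span_choice[OF T' vector_space_axioms])
      show "T (\<lambda>(i, _, p). b i p) \<noteq> 0" using s[OF T'] ne by auto
      show "(case j of (i, _, p) \<Rightarrow> b i p) \<in> span (B (fst j))" if j_mem: "j \<in> ?P" for j
      proof -
        obtain i c p where j: "j = (i, c, p)" "i \<in> {1..k}" "p < rs i"
          using j_mem by (auto simp: positions_def)
        then show ?thesis
          using B[OF j(2)] b[OF j(2)] span_superset[of "b i ` {..<rs i}"] by (auto simp: adapted_basis_def)
      qed
    qed blast
    \<comment> \<open>An alternating form vanishes on repeated vectors, so the \<open>rs i\<close>
      basis vectors chosen within one copy are distinct and exhaust \<open>B i\<close>.\<close>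
    have bij: "bij_betw (\<lambda>p. u (i, c, p)) {..<rs i} (B i)" if i: "i \<in> {1..k}" "c < n i" for i c
    proof -
      have P: "(i, c, p) \<in> ?P" if "p < rs i" for p using i that by (auto simp: positions_def)
      have inj: "inj_on (\<lambda>p. u (i, c, p)) {..<rs i}"
        using sigma_space_alternating[OF T' P P] u(2) by (intro inj_onI) blast
      moreover have sub: "(\<lambda>p. u (i, c, p)) ` {..<rs i} \<subseteq> B i" using u(1)[OF P] by auto
      moreover have "(\<lambda>p. u (i, c, p)) ` {..<rs i} = B i"
        using card[OF i(1)] card_image[OF inj] B[OF i(1)]
        by (intro card_subset_eq sub) (auto simp: adapted_basis_def)
      ultimately show ?thesis by (simp add: bij_betw_def)
    qed
    obtain u' where u': "\<And>j. j \<in> ?P \<Longrightarrow> u' j \<in> (\<Union>i\<in>{1..level (u j)}. D i)" "T u' \<noteq> 0"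
    proof (rule sigma_space_span_choice[OF T' vector_space_axioms _ u(2)])
      fix j assume "j \<in> ?P"
      have "u j = (\<Sum>i=1..m+1. proj i (u j))" by (rule sum_proj[symmetric])
      also have "\<dots> = (\<Sum>i=1..level (u j). proj i (u j))"
        using level_mem[of "u j"] proj_above_level by (intro sum.mono_neutral_right) auto
      also have "\<dots> \<in> span (\<Union>i\<in>{1..level (u j)}. D i)"
        using level_mem[of "u j"] proj_mem by (intro span_sum span_base) fastforce
      finally show "u j \<in> span (\<Union>i\<in>{1..level (u j)}. D i)" .
    qed blast
    then have "\<forall>j\<in>?P. \<exists>i. i \<in> {1..level (u j)} \<and> u' j \<in> D i" by blast
    then obtain a where a: "\<And>j. j \<in> ?P \<Longrightarrow> a j \<in> {1..level (u j)} \<and> u' j \<in> D (a j)" by metis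
    have aI: "a j \<in> {1..m+1}" if "j \<in> ?P" for j
      using a[OF that] level_mem[of "u j"] by auto
    have \<chi>: "\<chi> = - (\<Sum>j\<in>?P. \<gamma> (a j))"
      by (rule sigma_weight_eq[OF T _ u'(2)]) (use a aI in blast)
    have "(\<Sum>j\<in>?P. \<gamma> (a j)) \<le> (\<Sum>j\<in>?P. \<gamma> (level (u j)))"
      using a aI level_mem by (intro sum_mono \<gamma>) auto
    then have "- ?w \<le> \<chi>" using \<chi> sum_B[OF bij] by simp
    moreover have "\<chi> = - (\<Sum>j\<in>?P. \<gamma> (restrict a ?P j))" using \<chi> by simp
    then have "\<chi> \<in> (\<lambda>a. - (\<Sum>j\<in>?P. \<gamma> (a j))) ` (?P \<rightarrow>\<^sub>E {1..m+1})"
      by (rule image_eqI[where x = "restrict a ?P"]) (use aI in \<open>auto simp del: atLeastAtMost_iff\<close>)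
    ultimately show ?thesis by blast
  qed

  have lower: "- ?w \<in> ?S"
  proof -
    have "\<exists>\<beta>. bij_betw \<beta> {..<rs i} (B i)" if i: "i \<in> {1..k}" for i
      using ex_bij_betw_nat_finite[of "B i"] B[OF i] card[OF i] by (simp add: adapted_basis_def atLeast0LessThan)
    then obtain \<beta> where \<beta>: "\<And>i. i \<in> {1..k} \<Longrightarrow> bij_betw (\<beta> i) {..<rs i} (B i)" by metis
    have "\<exists>f. (\<forall>x\<in>B i. Vector_Spaces.linear sw (*) (f x)) \<and>
      (\<forall>x\<in>B i. \<forall>v. f x (proj (level x) v) = f x v) \<and>
      (\<forall>x\<in>B i. \<forall>y\<in>B i. level y = level x \<longrightarrow> f x y = (if y = x then 1 else 0))" if i: "i \<in> {1..k}" for i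
      using leading_forms[OF B[OF i]] by metis
    then obtain f where "\<And>i. i \<in> {1..k} \<Longrightarrow> (\<forall>x\<in>B i. Vector_Spaces.linear sw (*) (f i x)) \<and>
      (\<forall>x\<in>B i. \<forall>v. f i x (proj (level x) v) = f i x v) \<and>
      (\<forall>x\<in>B i. \<forall>y\<in>B i. level y = level x \<longrightarrow> f i x y = (if y = x then 1 else 0))"
      by metis
    then have f: "\<And>i x. i \<in> {1..k} \<Longrightarrow> x \<in> B i \<Longrightarrow> Vector_Spaces.linear sw (*) (f i x)"
      "\<And>i x v. i \<in> {1..k} \<Longrightarrow> x \<in> B i \<Longrightarrow> f i x (proj (level x) v) = f i x v"
      "\<And>i x y. i \<in> {1..k} \<Longrightarrow> x \<in> B i \<Longrightarrow> y \<in> B i \<Longrightarrow> level y = level x \<Longrightarrow> f i x y = (if y = x then 1 else 0)"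
      by blast+
    have \<beta>_mem: "\<beta> i p \<in> B i" if "i \<in> {1..k}" "p < rs i" for i p
      using bij_betwE[OF \<beta>[OF that(1)]] that(2) by blast
    \<comment> \<open>One leading form for each vector of \<open>B i\<close>. Each depends only on
      the component at its level and is thus scaled by the one-parameter subgroup, which makes the
      product of their minors a weight vector.\<close>
    define F where "F i p = f i (\<beta> i p)" for i p
    define T where "T = minor_tensor k rs n F"
    have F: "Vector_Spaces.linear sw (*) (F i p)" if "i \<in> {1..k}" "p < rs i" for i p
      unfolding F_def by (rule f(1)[OF that(1) \<beta>_mem[OF that]])
    have T_mem: "T \<in> sigma_space sw k rs n"
      unfolding T_def using F by (intro minor_tensor_mem vector_space_axioms)
    have "minor (rs i) (F i) (b i) \<noteq> 0" if i: "i \<in> {1..k}" for i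
    proof (rule minor_nonzero)
      fix v assume v: "v \<in> span (b i ` {..<rs i})" "\<And>p. p < rs i \<Longrightarrow> F i p v = 0"
      show "v = 0"
      proof (rule leading_forms_injective[OF B[OF i] f(1)[OF i] f(2)[OF i] f(3)[OF i]])
        show "v \<in> V i" using v(1) b[OF i] by blast
        fix x assume "x \<in> B i"
        then obtain p where "p < rs i" "x = \<beta> i p" using \<beta>[OF i] by (auto simp: bij_betw_def)
        then show "f i x v = 0" using v(2) by (simp add: F_def)
      qed
    qed (use F i b[OF i] in blast)+
    then have "T (\<lambda>(i, _, p). b i p) \<noteq> 0"
      unfolding T_def by (rule minor_tensor_nonzero)
    then have sT: "s T \<noteq> 0" using s[OF T_mem] \<open>c \<noteq> 0\<close> by simp
    obtain q e where q: "0 < q" "\<And>i. i \<in> {1..m+1} \<Longrightarrow> of_int (e i) = of_nat q * \<gamma> i"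
      by (rule integral_weights[where \<gamma> = \<gamma>]) blast
    define N where "N = - (\<Sum>j\<in>?P. e (level (\<beta> (fst j) (snd (snd j)))))"
    have N: "of_int N = of_nat q * - ?w"
    proof -
      have "of_int N = - (\<Sum>j\<in>?P. of_nat q * \<gamma> (level (\<beta> (fst j) (snd (snd j)))))"
        unfolding N_def using q(2) level_mem by (simp del: atLeastAtMost_iff)
      also have "\<dots> = of_nat q * - (\<Sum>j\<in>?P. \<gamma> (level (\<beta> (fst j) (snd (snd j)))))"
        by (simp add: sum_distrib_left)
      also have "(\<Sum>j\<in>?P. \<gamma> (level (\<beta> (fst j) (snd (snd j))))) = ?w"
        by (rule sum_B) (simp add: \<beta>)
      finally show ?thesis .
    qed
    have "sigma_act (one_parameter e t) T = sigma_smul (t powi N) T" if t: "t \<noteq> 0" for t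
    proof
      fix u
      have "T (inv_into UNIV (one_parameter e t) \<circ> u) =
          (\<Prod>i=1..k. \<Prod>c<n i. \<Prod>p<rs i. t powi (- e (level (\<beta> i p)))) * T u"
        unfolding T_def
      proof (rule minor_tensor_scale)
        fix i c p q assume "(i, c, q) \<in> ?P" "p < rs i"
        then have i: "i \<in> {1..k}" by (auto simp: positions_def)
        let ?x = "\<beta> i p"
        have x: "?x \<in> B i" by (rule \<beta>_mem[OF i \<open>p < rs i\<close>])
        have "f i ?x (one_parameter e (inverse t) v) = t powi (- e (level ?x)) * f i ?x v" for v
        proof -
          have "f i ?x (one_parameter e (inverse t) v) = f i ?x (sw (inverse t powi e (level ?x)) (proj (level ?x) v))"
            using f(2)[OF i x, of "one_parameter e (inverse t) v"] proj_one_parameter[OF level_mem] by simp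
          also have "\<dots> = inverse t powi e (level ?x) * f i ?x (proj (level ?x) v)"
            using f(1)[OF i x] unfolding Vector_Spaces.linear_iff by blast
          finally show ?thesis using f(2)[OF i x] by (simp add: power_int_inverse power_int_minus)
        qed
        then show "F i p ((inv_into UNIV (one_parameter e t) \<circ> u) (i, c, q)) = t powi (- e (level (\<beta> i p))) * F i p (u (i, c, q))"
          by (simp add: F_def inv_one_parameter[OF t])
      qed
      also have "(\<Prod>i=1..k. \<Prod>c<n i. \<Prod>p<rs i. t powi (- e (level (\<beta> i p)))) = t powi N"
        unfolding prod_power_int[OF t] by (simp add: N_def sum_positions sum_negf)
      finally show "sigma_act (one_parameter e t) T u = sigma_smul (t powi N) T u"
        by (simp only: sigma_act_def sigma_smul_def)
    qed
    then have "T \<in> weight_space sw m D \<gamma> (sigma_space sw k rs n) sigma_smul sigma_act (- ?w)"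
      unfolding mem_weight_space_iff using T_mem q N by blast
    then show ?thesis using sT by blast
  qed
  have "finite ((\<lambda>a. - (\<Sum>j\<in>?P. \<gamma> (a j))) ` (?P \<rightarrow>\<^sub>E {1..m+1}))"
    by (intro finite_imageI finite_PiE finite_positions) simp
  then have "finite ?S" by (rule rev_finite_subset) (use upper in blast)
  then show ?thesis using upper lower by (intro Min_eqI) auto
qed

end

section \<open>Curves and sheaves\<close>

locale curve =
  fixes emb :: "complex \<Rightarrow> 'k::field" and X :: "'k set set"
  assumes curve: "smooth_projective_curve emb X"
begin

lemma emb_1: "emb 1 = 1" and emb_add: "emb (a + b) = emb a + emb b"
  and emb_mult: "emb (a * b) = emb a * emb b"
  using curve by (simp_all add: smooth_projective_curve_def complex_structure_def)

lemma emb_0: "emb 0 = 0"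
  using emb_add[of 0 0] by (metis add.right_neutral add_left_cancel)

lemma emb_eq_0_iff: "emb a = 0 \<longleftrightarrow> a = 0"
proof
  assume "emb a = 0"
  then have "emb (a * inverse a) = 0" by (simp add: emb_mult)
  then show "a = 0" using emb_1 by (cases "a = 0") auto
qed (simp add: emb_0)

lemma inj_emb: "inj emb"
proof (rule injI)
  fix a b assume "emb a = emb b"
  then have "emb (a - b) + emb b = emb b" by (simp add: emb_add[symmetric])
  then show "a = b" using emb_eq_0_iff[of "a - b"] by simp
qed

text \<open>The zero ideal of a chart algebra is prime, and localizing there gives the field of
  fractions, which is the whole function field.\<close>

lemma generic_point_mem: "UNIV \<in> X"
proof -
  obtain n f where "\<exists>i\<le>n. f i \<noteq> 0" and X: "X = (\<Union>i\<in>{i. i \<le> n \<and> f i \<noteq> 0}.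
      {localization_at (chart_algebra emb n f i) P | P. prime_ideal_in (chart_algebra emb n f i) P})"
    and frac: "\<forall>i\<le>n. f i \<noteq> 0 \<longrightarrow> (\<forall>h. \<exists>a\<in>chart_algebra emb n f i. \<exists>b\<in>chart_algebra emb n f i. b \<noteq> 0 \<and> h = a / b)"
    using curve unfolding smooth_projective_curve_def projective_variety_def by blast
  then obtain i where i: "i \<le> n" "f i \<noteq> 0" by blast
  let ?A = "chart_algebra emb n f i"
  have "0 \<in> ?A"
    using generated_algebra.const[of emb 0] by (simp add: chart_algebra_def emb_0)
  then have "prime_ideal_in ?A {0}" by (simp add: prime_ideal_in_def)
  moreover have "localization_at ?A {0} = UNIV"
    using frac i by (fastforce simp: localization_at_def)
  ultimately show ?thesis unfolding X using i by blast
qed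

lemma emb_mem: "x \<in> X \<Longrightarrow> emb c \<in> x"
proof -
  assume "x \<in> X"
  then obtain n f i P where "x = localization_at (chart_algebra emb n f i) P"
      "prime_ideal_in (chart_algebra emb n f i) P"
    using curve unfolding smooth_projective_curve_def projective_variety_def by blast
  moreover have "emb c \<in> chart_algebra emb n f i" for c
    unfolding chart_algebra_def by (rule generated_algebra.const)
  moreover have "emb c = emb c / emb 1" by (simp add: emb_1)
  ultimately show ?thesis
    unfolding localization_at_def prime_ideal_in_def using emb_1 by (metis (mono_tags, lifting) mem_Collect_eq)
qed

lemma point_cases:
  assumes "x \<in> X"
  obtains "x = UNIV" | v where "discrete_valuation_on x v"
  using curve assms unfolding smooth_projective_curve_def closed_points_def by blast

lemma point_add: "x \<in> X \<Longrightarrow> f \<in> x \<Longrightarrow> g \<in> x \<Longrightarrow> f + g \<in> x"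
  and point_mult: "x \<in> X \<Longrightarrow> f \<in> x \<Longrightarrow> g \<in> x \<Longrightarrow> f * g \<in> x"
proof -
  assume x: "x \<in> X" "f \<in> x" "g \<in> x"
  have "f + g \<in> x \<and> f * g \<in> x"
    using x(1)
  proof (cases rule: point_cases)
    case (2 v)
    then have v: "x = {f. f = 0 \<or> 0 \<le> v f}" "\<And>f g. f \<noteq> 0 \<Longrightarrow> g \<noteq> 0 \<Longrightarrow> v (f * g) = v f + v g"
      "\<And>f g. f \<noteq> 0 \<Longrightarrow> g \<noteq> 0 \<Longrightarrow> f + g \<noteq> 0 \<Longrightarrow> min (v f) (v g) \<le> v (f + g)"
      by (simp_all add: discrete_valuation_on_def)
    consider "f = 0" | "g = 0" | "f + g = 0" "f \<noteq> 0" "g \<noteq> 0" | "f \<noteq> 0" "g \<noteq> 0" "f + g \<noteq> 0" by blast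
    then show ?thesis
    proof cases
      case 3
      then show ?thesis using x v(2)[of f g] by (simp add: v(1))
    next
      case 4
      then show ?thesis using x v(2)[of f g] v(3)[of f g] by (auto simp: v(1))
    qed (use x in \<open>auto simp: v(1)\<close>)
  qed simp
  then show "f + g \<in> x" "f * g \<in> x" by simp_all
qed

lemma point_0: "x \<in> X \<Longrightarrow> 0 \<in> x" and point_1: "x \<in> X \<Longrightarrow> 1 \<in> x"
  using emb_mem[of x 0] emb_mem[of x 1] emb_0 emb_1 by simp_all

lemma point_minus: "x \<in> X \<Longrightarrow> f \<in> x \<Longrightarrow> - f \<in> x"
proof -
  assume x: "x \<in> X" "f \<in> x"
  have "emb (- 1) = - 1" using emb_add[of 1 "- 1"] emb_0 emb_1 by (simp add: eq_neg_iff_add_eq_0 add.commute)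
  then show ?thesis using point_mult[OF x(1) emb_mem[OF x(1), of "- 1"] x(2)] by simp
qed

lemma valuation_ring:
  assumes "x \<in> X" "f \<noteq> 0"
  shows "f \<in> x \<or> inverse f \<in> x"
  using assms(1)
proof (cases rule: point_cases)
  case (2 v)
  then have v: "x = {f. f = 0 \<or> 0 \<le> v f}" "\<And>f g. f \<noteq> 0 \<Longrightarrow> g \<noteq> 0 \<Longrightarrow> v (f * g) = v f + v g"
    by (simp_all add: discrete_valuation_on_def)
  have "v 1 = 0" using v(2)[of 1 1] by simp
  then have "v f + v (inverse f) = 0" using v(2)[of f "inverse f"] assms(2) by simp
  then show ?thesis using assms(2) by (auto simp: v(1))
qed simp

text \<open>The element found is one of minimal valuation. Arguing with divisibility in a valuation
  ring instead of a valuation covers the generic point too.\<close>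

lemma common_divisor:
  assumes "x \<in> X" "finite A" "A \<noteq> {}" "0 \<notin> A"
  shows "\<exists>p\<in>A. \<forall>a\<in>A. a / p \<in> x"
  using assms(2,3,4)
proof (induction A rule: finite_ne_induct)
  case (singleton a)
  then show ?case using point_1[OF assms(1)] by simp
next
  case (insert b A)
  then obtain p where p: "p \<in> A" "\<forall>a\<in>A. a / p \<in> x" by auto
  have nz: "p \<noteq> 0" "b \<noteq> 0" using insert.prems p(1) by auto
  show ?case
  proof (cases "b / p \<in> x")
    case True
    then show ?thesis using p by auto
  next
    case False
    then have "p / b \<in> x" using valuation_ring[OF assms(1), of "b / p"] nz by simp
    then have "a / b \<in> x" if "a \<in> A" for a
      using point_mult[OF assms(1), of "a / p" "p / b"] p(2) that nz by simp
    then show ?thesis using point_1[OF assms(1)] nz by auto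
  qed
qed

lemma open_subset: "U \<in> nonempty_opens X \<Longrightarrow> U \<subseteq> X"
  by (simp add: nonempty_opens_def zariski_open_def)

lemma generic_mem_open: "U \<in> nonempty_opens X \<Longrightarrow> UNIV \<in> U"
proof -
  assume "U \<in> nonempty_opens X"
  then obtain x where "zariski_open X U" "x \<in> U" by (auto simp: nonempty_opens_def)
  then obtain S where "{y\<in>X. S \<subseteq> y} \<subseteq> U" unfolding zariski_open_def by metis
  then show ?thesis using generic_point_mem by auto
qed

lemma nonempty_opensI:
  assumes "U \<subseteq> X" "UNIV \<in> U" "\<And>x. x \<in> U \<Longrightarrow> \<exists>S. finite S \<and> S \<subseteq> x \<and> {y\<in>X. S \<subseteq> y} \<subseteq> U"
  shows "U \<in> nonempty_opens X"
  using assms by (auto simp: nonempty_opens_def zariski_open_def)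

lemma X_open: "X \<in> nonempty_opens X"
  by (rule nonempty_opensI[OF _ generic_point_mem]) auto

lemma Int_open:
  assumes "U \<in> nonempty_opens X" "U' \<in> nonempty_opens X"
  shows "U \<inter> U' \<in> nonempty_opens X"
proof (rule nonempty_opensI)
  fix x assume "x \<in> U \<inter> U'"
  then obtain S S' where "finite S" "S \<subseteq> x" "{y\<in>X. S \<subseteq> y} \<subseteq> U" "finite S'" "S' \<subseteq> x" "{y\<in>X. S' \<subseteq> y} \<subseteq> U'"
    using assms unfolding nonempty_opens_def zariski_open_def by blast
  then show "\<exists>S. finite S \<and> S \<subseteq> x \<and> {y\<in>X. S \<subseteq> y} \<subseteq> U \<inter> U'"
    by (intro exI[of _ "S \<union> S'"]) auto
qed (use assms open_subset generic_mem_open in auto)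

lemma Union_open:
  assumes "\<U> \<noteq> {}" "\<U> \<subseteq> nonempty_opens X"
  shows "\<Union>\<U> \<in> nonempty_opens X"
proof (rule nonempty_opensI)
  fix x assume "x \<in> \<Union>\<U>"
  then obtain U where U: "U \<in> \<U>" "x \<in> U" by blast
  then have "zariski_open X U" using assms(2) by (auto simp: nonempty_opens_def)
  then obtain S where "finite S" "S \<subseteq> x" "{y\<in>X. S \<subseteq> y} \<subseteq> U"
    using U(2) by (auto simp: zariski_open_def)
  then show "\<exists>S. finite S \<and> S \<subseteq> x \<and> {y\<in>X. S \<subseteq> y} \<subseteq> \<Union>\<U>"
    using U(1) by (intro exI[of _ S]) auto
next
  show "\<Union>\<U> \<subseteq> X" using assms(2) open_subset by (intro Union_least) blast
  obtain U where "U \<in> \<U>" using assms(1) by blast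
  then show "UNIV \<in> \<Union>\<U>" using assms(2) generic_mem_open[of U] by blast
qed

lemma regular_open:
  assumes "U \<in> nonempty_opens X" "finite S"
  shows "{y\<in>U. S \<subseteq> y} \<in> nonempty_opens X"
proof (rule nonempty_opensI)
  fix x assume x: "x \<in> {y\<in>U. S \<subseteq> y}"
  then obtain S' where "finite S'" "S' \<subseteq> x" "{y\<in>X. S' \<subseteq> y} \<subseteq> U"
    using assms(1) unfolding nonempty_opens_def zariski_open_def by blast
  then show "\<exists>S'. finite S' \<and> S' \<subseteq> x \<and> {y\<in>X. S' \<subseteq> y} \<subseteq> {y\<in>U. S \<subseteq> y}"
    using x assms(2) by (intro exI[of _ "S \<union> S'"]) auto
qed (use assms open_subset generic_mem_open in auto)

lemma structure_sheaf_mono: "U' \<subseteq> U \<Longrightarrow> structure_sheaf U \<subseteq> structure_sheaf U'"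
  by (auto simp: structure_sheaf_def)

lemma structure_sheaf_ring:
  assumes "U \<in> nonempty_opens X"
  shows "0 \<in> structure_sheaf U" "1 \<in> structure_sheaf U" "emb c \<in> structure_sheaf U"
    "f \<in> structure_sheaf U \<Longrightarrow> g \<in> structure_sheaf U \<Longrightarrow> f + g \<in> structure_sheaf U"
    "f \<in> structure_sheaf U \<Longrightarrow> g \<in> structure_sheaf U \<Longrightarrow> f * g \<in> structure_sheaf U"
    "f \<in> structure_sheaf U \<Longrightarrow> - f \<in> structure_sheaf U"
  using open_subset[OF assms] point_0 point_1 emb_mem point_add point_mult point_minus
  by (auto simp: structure_sheaf_def)

lemma sheaf_0: "is_sheaf X sc E \<Longrightarrow> U \<in> nonempty_opens X \<Longrightarrow> 0 \<in> E U"
  and sheaf_add: "is_sheaf X sc E \<Longrightarrow> U \<in> nonempty_opens X \<Longrightarrow> u \<in> E U \<Longrightarrow> v \<in> E U \<Longrightarrow> u + v \<in> E U"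
  and sheaf_scale: "is_sheaf X sc E \<Longrightarrow> U \<in> nonempty_opens X \<Longrightarrow> f \<in> structure_sheaf U \<Longrightarrow> v \<in> E U \<Longrightarrow> sc f v \<in> E U"
  and sheaf_Union: "is_sheaf X sc E \<Longrightarrow> \<U> \<noteq> {} \<Longrightarrow> \<U> \<subseteq> nonempty_opens X \<Longrightarrow> E (\<Union>\<U>) = (\<Inter>U\<in>\<U>. E U)"
  unfolding is_sheaf_def by (metis, metis, metis, metis)

text \<open>Restriction is hidden in the gluing axiom: apply it to the cover of \<open>U\<close> by
  \<open>U\<close> and \<open>U'\<close>.\<close>

lemma sheaf_restrict:
  assumes "is_sheaf X sc E" "U \<in> nonempty_opens X" "U' \<in> nonempty_opens X" "U' \<subseteq> U"
  shows "E U \<subseteq> E U'"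
proof -
  have "E (\<Union>{U, U'}) = (\<Inter>U\<in>{U, U'}. E U)"
    by (rule sheaf_Union[OF assms(1)]) (use assms(2,3) in auto)
  moreover have "\<Union>{U, U'} = U" using assms(4) by auto
  ultimately show ?thesis by auto
qed

lemma sheaf_glue:
  assumes E: "is_sheaf X sc E" and "U \<in> nonempty_opens X"
    and loc: "\<And>x. x \<in> U \<Longrightarrow> \<exists>U'\<in>nonempty_opens X. x \<in> U' \<and> U' \<subseteq> U \<and> v \<in> E U'"
  shows "v \<in> E U"
proof -
  let ?\<U> = "{U' \<in> nonempty_opens X. U' \<subseteq> U \<and> v \<in> E U'}"
  have "U = \<Union>?\<U>" using loc by blast
  moreover from this have "?\<U> \<noteq> {}" using generic_mem_open[OF assms(2)] by blast
  then have "E (\<Union>?\<U>) = (\<Inter>U\<in>?\<U>. E U)" by (intro sheaf_Union[OF E]) auto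
  ultimately show ?thesis by auto
qed

text \<open>Gluing over arbitrary covers follows from restriction and a local test at each point,
  the form in which saturations, twists and duals satisfy it.\<close>

lemma is_sheafI:
  assumes "\<And>U. U \<in> nonempty_opens X \<Longrightarrow> 0 \<in> E U"
    and "\<And>U u v. U \<in> nonempty_opens X \<Longrightarrow> u \<in> E U \<Longrightarrow> v \<in> E U \<Longrightarrow> u + v \<in> E U"
    and "\<And>U f v. U \<in> nonempty_opens X \<Longrightarrow> f \<in> structure_sheaf U \<Longrightarrow> v \<in> E U \<Longrightarrow> sc f v \<in> E U"
    and restr: "\<And>U U' v. U \<in> nonempty_opens X \<Longrightarrow> U' \<in> nonempty_opens X \<Longrightarrow> U' \<subseteq> U \<Longrightarrow> v \<in> E U \<Longrightarrow> v \<in> E U'"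
    and glue: "\<And>U v. U \<in> nonempty_opens X \<Longrightarrow>
      (\<And>x. x \<in> U \<Longrightarrow> \<exists>U'\<in>nonempty_opens X. x \<in> U' \<and> U' \<subseteq> U \<and> v \<in> E U') \<Longrightarrow> v \<in> E U"
  shows "is_sheaf X sc E"
proof -
  have "E (\<Union>\<U>) = (\<Inter>U\<in>\<U>. E U)" if "\<U> \<noteq> {}" "\<U> \<subseteq> nonempty_opens X" for \<U>
  proof
    show "E (\<Union>\<U>) \<subseteq> (\<Inter>U\<in>\<U>. E U)"
      using restr[OF Union_open[OF that]] that(2) by blast
    show "(\<Inter>U\<in>\<U>. E U) \<subseteq> E (\<Union>\<U>)"
    proof
      fix v assume "v \<in> (\<Inter>U\<in>\<U>. E U)"
      then show "v \<in> E (\<Union>\<U>)"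
        by (intro glue[OF Union_open[OF that]]) (use that(2) in blast)
    qed
  qed
  then show ?thesis using assms(1-3) unfolding is_sheaf_def by simp
qed

section \<open>Stalks and the generic fiber\<close>

lemma stalk_mono: "subsheaf_of X F E \<Longrightarrow> stalk X F x \<subseteq> stalk X E x"
  unfolding stalk_def subsheaf_of_def by blast

lemma stalk_add:
  assumes E: "is_sheaf X sc E" and "u \<in> stalk X E x" "v \<in> stalk X E x"
  shows "u + v \<in> stalk X E x"
proof -
  obtain U U' where U: "U \<in> nonempty_opens X" "x \<in> U" "u \<in> E U" "U' \<in> nonempty_opens X" "x \<in> U'" "v \<in> E U'"
    using assms(2,3) unfolding stalk_def by blast
  then have "u \<in> E (U \<inter> U')" "v \<in> E (U \<inter> U')"
    using sheaf_restrict[OF E] Int_open by blast+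
  then have "u + v \<in> E (U \<inter> U')" "U \<inter> U' \<in> nonempty_opens X" "x \<in> U \<inter> U'"
    using sheaf_add[OF E Int_open] Int_open U by blast+
  then show ?thesis unfolding stalk_def by blast
qed

text \<open>The neighbourhood is shrunk to the points where \<open>f\<close> is regular. At the
  generic point every rational function becomes an admissible scalar.\<close>

lemma stalk_scale:
  assumes E: "is_sheaf X sc E" and "f \<in> x" "v \<in> stalk X E x"
  shows "sc f v \<in> stalk X E x"
proof -
  obtain U where U: "U \<in> nonempty_opens X" "x \<in> U" "v \<in> E U"
    using assms(3) unfolding stalk_def by blast
  have U': "{y\<in>U. {f} \<subseteq> y} \<in> nonempty_opens X" by (rule regular_open[OF U(1)]) simp
  moreover have "sc f v \<in> E {y\<in>U. {f} \<subseteq> y}"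
    by (rule sheaf_scale[OF E U']) (use sheaf_restrict[OF E U(1) U'] U in \<open>auto simp: structure_sheaf_def\<close>)
  ultimately show ?thesis using U(2) assms(2) unfolding stalk_def by blast
qed

lemma stalk_0: "is_sheaf X sc E \<Longrightarrow> x \<in> X \<Longrightarrow> 0 \<in> stalk X E x"
  using sheaf_0 X_open unfolding stalk_def by blast

lemma subspace_generic_fiber:
  assumes "vector_space sc" "is_sheaf X sc E"
  shows "module.subspace sc (generic_fiber X E)"
proof -
  interpret vector_space sc by fact
  show ?thesis
    unfolding subspace_def generic_fiber_def
    using stalk_0[OF assms(2) generic_point_mem] stalk_add[OF assms(2)] stalk_scale[OF assms(2)] by blast
qed

lemma open_subset_generic_fiber: "U \<in> nonempty_opens X \<Longrightarrow> E U \<subseteq> generic_fiber X E"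
  using generic_mem_open unfolding generic_fiber_def stalk_def by blast

end

section \<open>Frames and subbundles\<close>

text \<open>Frames are indexed families. Independence in this form lets coefficients be compared
  index by index, without going through the image set.\<close>

lemma (in vector_space) independent_family_iff:
  fixes n :: nat
  shows
  "inj_on e {..<n} \<and> independent (e ` {..<n}) \<longleftrightarrow>
     (\<forall>f. (\<Sum>i<n. scale (f i) (e i)) = 0 \<longrightarrow> (\<forall>i<n. f i = 0))" (is "?L \<longleftrightarrow> ?R")
proof
  assume L: ?L
  show ?R
  proof (intro allI impI)
    fix f i assume f: "(\<Sum>i<n. scale (f i) (e i)) = 0" and i: "i < n"
    have "(\<Sum>v\<in>e ` {..<n}. scale (f (the_inv_into {..<n} e v)) v) = (\<Sum>i<n. scale (f i) (e i))"
      using L by (simp add: sum.reindex the_inv_into_f_f)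
    then have "f (the_inv_into {..<n} e (e i)) = 0"
      using L f i independentD[of "e ` {..<n}" "e ` {..<n}" "\<lambda>v. f (the_inv_into {..<n} e v)" "e i"] by simp
    then show "f i = 0" using L i by (simp add: the_inv_into_f_f)
  qed
next
  assume R: ?R
  have inj: "inj_on e {..<n}"
  proof (rule inj_onI, rule ccontr)
    fix i j assume ij: "i \<in> {..<n}" "j \<in> {..<n}" "e i = e j" "i \<noteq> j"
    let ?f = "\<lambda>k. (if k = i then 1 else 0) - (if k = j then 1 else 0) :: 'a"
    have "(\<Sum>k<n. scale (?f k) (e k)) = e i - e j"
      using ij by (simp add: scale_left_diff_distrib sum_subtractf if_distrib[of "\<lambda>c. scale c _"] cong: if_cong)
    then have "(\<Sum>k<n. scale (?f k) (e k)) = 0" using ij(3) by (simp only: diff_self)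
    then have "\<forall>k<n. ?f k = 0" by (rule mp[OF spec[OF R, of ?f]])
    then have "?f i = 0" using ij(1) by blast
    then show False using ij(4) by simp
  qed
  moreover have "independent (e ` {..<n})"
  proof
    assume "dependent (e ` {..<n})"
    then obtain u where u: "\<exists>v\<in>e ` {..<n}. u v \<noteq> 0" "(\<Sum>v\<in>e ` {..<n}. scale (u v) v) = 0"
      by (auto simp: dependent_finite)
    then have "(\<Sum>i<n. scale (u (e i)) (e i)) = 0" using inj by (simp add: sum.reindex)
    then show False using R[rule_format, of "\<lambda>i. u (e i)"] u(1) by auto
  qed
  ultimately show ?L by blast
qed

lemma (in vector_space) span_family:
  fixes n :: nat
  shows
  "span (e ` {..<n}) = {\<Sum>i<n. scale (f i) (e i) | f. True}"
proof (intro equalityI subsetI)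
  fix v assume "v \<in> span (e ` {..<n})"
  then show "v \<in> {\<Sum>i<n. scale (f i) (e i) | f. True}"
  proof (induction rule: span_induct_alt)
    case base
    show ?case by (intro CollectI exI[of _ "\<lambda>_. 0"]) simp
  next
    case (step c x y)
    then obtain f j where f: "y = (\<Sum>i<n. scale (f i) (e i))" and j: "x = e j" "j < n" by blast
    have "scale c x + y = (\<Sum>i<n. scale (f i + (if i = j then c else 0)) (e i))"
      using j by (simp add: f scale_left_distrib sum.distrib if_distrib[of "\<lambda>c. scale c _"] add.commute cong: if_cong)
    then show ?case by (intro CollectI exI[of _ "\<lambda>i. f i + (if i = j then c else 0)"] conjI TrueI)
  qed
next
  fix v assume "v \<in> {\<Sum>i<n. scale (f i) (e i) | f. True}"
  then obtain f where "v = (\<Sum>i<n. scale (f i) (e i))" by blast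
  then show "v \<in> span (e ` {..<n})" by (simp only:) (intro span_sum span_scale span_base, auto)
qed

lemma (in vector_space) family_coeff_eq_0:
  fixes n s :: nat
  assumes indep: "\<forall>f. (\<Sum>i<n. scale (f i) (e i)) = 0 \<longrightarrow> (\<forall>i<n. f i = 0)"
    and "s \<le> n" "(\<Sum>i<n. scale (f i) (e i)) \<in> span (e ` {..<s})" "s \<le> i" "i < n"
  shows "f i = 0"
proof -
  obtain g where "(\<Sum>i<n. scale (f i) (e i)) = (\<Sum>i<s. scale (g i) (e i))"
    using assms(3) unfolding span_family by blast
  also have "\<dots> = (\<Sum>i<n. scale (if i < s then g i else 0) (e i))"
    using assms(2) by (intro sum.mono_neutral_cong_left) auto
  finally have "(\<Sum>i<n. scale (f i - (if i < s then g i else 0)) (e i)) = 0"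
    by (simp add: scale_left_diff_distrib sum_subtractf)
  then show ?thesis using indep[rule_format, of "\<lambda>i. f i - (if i < s then g i else 0)" i] assms(4,5) by simp
qed

locale curve_space = curve emb X + vector_space sc
  for emb :: "complex \<Rightarrow> 'k::field" and X :: "'k set set"
    and sc :: "'k \<Rightarrow> 'v::ab_group_add \<Rightarrow> 'v"
begin

lemma frame_on_iff:
  "frame_on X sc E U n e \<longleftrightarrow>
     (\<forall>f. (\<Sum>i<n. sc (f i) (e i)) = 0 \<longrightarrow> (\<forall>i<n. f i = 0)) \<and>
     (\<forall>U'\<in>nonempty_opens X. U' \<subseteq> U \<longrightarrow>
        E U' = {\<Sum>i<n. sc (f i) (e i) | f. \<forall>i<n. f i \<in> structure_sheaf U'})"
  unfolding frame_on_def using independent_family_iff[of e n] by (simp only: conj_assoc[symmetric])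

lemma frame_indep: "frame_on X sc E U n e \<Longrightarrow> inj_on e {..<n}" "frame_on X sc E U n e \<Longrightarrow> independent (e ` {..<n})"
  by (simp_all add: frame_on_def)

lemma frame_sections:
  assumes "frame_on X sc E U n e" "U' \<in> nonempty_opens X" "U' \<subseteq> U"
  shows "E U' = {\<Sum>i<n. sc (f i) (e i) | f. \<forall>i<n. f i \<in> structure_sheaf U'}"
proof -
  have "\<forall>U'\<in>nonempty_opens X. U' \<subseteq> U \<longrightarrow>
     E U' = {\<Sum>i<n. sc (f i) (e i) | f. \<forall>i<n. f i \<in> structure_sheaf U'}"
    using assms(1) by (simp add: frame_on_def)
  from this[rule_format, OF assms(2,3)] show ?thesis .
qed

lemma frame_on_restrict:
  assumes "frame_on X sc E U n e" "U' \<subseteq> U"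
  shows "frame_on X sc E U' n e"
  unfolding frame_on_def
  by (intro conjI ballI impI frame_indep[OF assms(1)] frame_sections[OF assms(1)] subset_trans[OF _ assms(2)])

lemma frame_mem:
  assumes "frame_on X sc E U n e" "U \<in> nonempty_opens X" "i < n"
  shows "e i \<in> E U"
proof -
  have "e i = (\<Sum>j<n. sc (if j = i then 1 else 0) (e j))"
    using assms(3) by (simp add: if_distrib[of "\<lambda>c. sc c _"] cong: if_cong)
  moreover have "\<forall>j<n. (if j = i then 1 else 0) \<in> structure_sheaf U"
    using structure_sheaf_ring[OF assms(2)] by simp
  ultimately show ?thesis
    unfolding frame_sections[OF assms(1,2) order_refl]
    by (intro CollectI exI[of _ "\<lambda>j. if j = i then 1 else 0"] conjI)
qed

text \<open>Nonempty open sets meet, so every rational section restricts to a part of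
  \<open>U\<close>, where the frame expresses it; conversely the generic fiber is closed under all
  rational coefficients.\<close>

lemma generic_fiber_frame:
  assumes E: "is_sheaf X sc E" and U: "U \<in> nonempty_opens X" and e: "frame_on X sc E U n e"
  shows "generic_fiber X E = span (e ` {..<n})"
proof
  show "generic_fiber X E \<subseteq> span (e ` {..<n})"
  proof
    fix v assume "v \<in> generic_fiber X E"
    then obtain U' where U': "U' \<in> nonempty_opens X" "v \<in> E U'"
      unfolding generic_fiber_def stalk_def by blast
    then have "v \<in> E (U \<inter> U')" using sheaf_restrict[OF E U'(1) Int_open[OF U U'(1)]] by blast
    then show "v \<in> span (e ` {..<n})"
      unfolding frame_sections[OF e Int_open[OF U U'(1)] Int_lower1] span_family by blast
  qed
  show "span (e ` {..<n}) \<subseteq> generic_fiber X E"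
    using subsetD[OF open_subset_generic_fiber[OF U, of E] frame_mem[OF e U]]
    by (intro span_minimal[OF _ subspace_generic_fiber[OF vector_space_axioms E]] image_subsetI) simp
qed

lemma bundle_rank_frame:
  assumes "is_sheaf X sc E" "U \<in> nonempty_opens X" "frame_on X sc E U n e"
  shows "bundle_rank X sc E = n"
  unfolding bundle_rank_def generic_fiber_frame[OF assms]
  by (simp only: dim_span_eq_card_independent[OF frame_indep(2)[OF assms(3)]]
      card_image[OF frame_indep(1)[OF assms(3)]] card_lessThan)

lemma vector_bundle_frame:
  assumes "vector_bundle X sc r E" "x \<in> X"
  obtains U e where "U \<in> nonempty_opens X" "x \<in> U" "frame_on X sc E U r e"
proof -
  have "\<exists>U\<in>nonempty_opens X. x \<in> U \<and> (\<exists>e. frame_on X sc E U r e)"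
    using assms by (simp add: vector_bundle_def)
  then show thesis using that by blast
qed

lemma bundle_rank_eq:
  assumes "vector_bundle X sc r E"
  shows "bundle_rank X sc E = r"
proof -
  obtain U e where U: "U \<in> nonempty_opens X" "frame_on X sc E U r e"
    by (rule vector_bundle_frame[OF assms generic_point_mem])
  have "is_sheaf X sc E" using assms by (simp add: vector_bundle_def)
  then show ?thesis using U by (rule bundle_rank_frame)
qed

text \<open>The coefficient 1 at \<open>p\<close> makes this an elementary change of frame, whose
  inverse matrix is obtained without division.\<close>

lemma frame_exchange:
  assumes e: "frame_on X sc E U n e" and p: "p < n" "d p = 1"
    and d: "\<And>i. i < n \<Longrightarrow> d i \<in> structure_sheaf U"
  shows "frame_on X sc E U n (e(p := \<Sum>i<n. sc (d i) (e i)))"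
proof -
  let ?e = "e(p := \<Sum>i<n. sc (d i) (e i))"
  \<comment> \<open>\<open>T\<close> converts coordinates in the new family into coordinates in the
    old one, and \<open>T'\<close> inverts it; both preserve regularity of coordinates.\<close>
  define T where "T f i = (if i = p then f p else f i + f p * d i)" for f i
  define T' where "T' g i = (if i = p then g p else g i - g p * d i)" for g i
  have T: "(\<Sum>i<n. sc (f i) (?e i)) = (\<Sum>i<n. sc (T f i) (e i))" for f
  proof -
    have "(\<Sum>i<n. sc (f i) (?e i)) = sc (f p) (\<Sum>i<n. sc (d i) (e i)) + (\<Sum>i\<in>{..<n} - {p}. sc (f i) (e i))"
      using p(1) by (subst sum.remove[of _ p]) (auto intro!: sum.cong)
    also have "sc (f p) (\<Sum>i<n. sc (d i) (e i)) =
        sc (f p) (e p) + (\<Sum>i\<in>{..<n} - {p}. sc (f p * d i) (e i))"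
      using p by (subst sum.remove[of _ p]) (auto simp: scale_right_distrib scale_sum_right)
    finally have "(\<Sum>i<n. sc (f i) (?e i)) =
        sc (f p) (e p) + (\<Sum>i\<in>{..<n} - {p}. sc (f i + f p * d i) (e i))"
      by (simp add: scale_left_distrib sum.distrib add_ac)
    also have "\<dots> = (\<Sum>i<n. sc (T f i) (e i))"
      using p(1) by (subst sum.remove[of _ p]) (auto simp: T_def)
    finally show ?thesis .
  qed
  have TT': "T (T' g) = g" for g by (auto simp: T_def T'_def)
  show ?thesis
    unfolding frame_on_iff
  proof (intro conjI allI impI ballI)
    fix f i assume "(\<Sum>i<n. sc (f i) (?e i)) = 0" "i < n"
    then have 0: "\<forall>i<n. T f i = 0" using e unfolding T frame_on_iff by blast
    then have "f p = 0" using p(1) by (auto simp: T_def)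
    then show "f i = 0" using 0 \<open>i < n\<close> by (auto simp: T_def split: if_splits)
  next
    fix U' assume U': "U' \<in> nonempty_opens X" "U' \<subseteq> U"
    have d': "d i \<in> structure_sheaf U'" if "i < n" for i
      using d[OF that] structure_sheaf_mono[OF U'(2)] by blast
    note ring = structure_sheaf_ring[OF U'(1)]
    show "E U' = {\<Sum>i<n. sc (f i) (?e i) | f. \<forall>i<n. f i \<in> structure_sheaf U'}"
      unfolding frame_sections[OF e U']
    proof (intro equalityI subsetI)
      fix v assume "v \<in> {\<Sum>i<n. sc (f i) (e i) | f. \<forall>i<n. f i \<in> structure_sheaf U'}"
      then obtain g where g: "v = (\<Sum>i<n. sc (g i) (e i))" "\<forall>i<n. g i \<in> structure_sheaf U'" by blast
      have "T' g i \<in> structure_sheaf U'" if "i < n" for i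
        using ring(4)[OF _ ring(6)[OF ring(5)], of "g i" "g p" "d i"] g(2) d' p(1) that by (auto simp: T'_def)
      moreover have "v = (\<Sum>i<n. sc (T' g i) (?e i))" unfolding T TT' by (rule g(1))
      ultimately show "v \<in> {\<Sum>i<n. sc (f i) (?e i) | f. \<forall>i<n. f i \<in> structure_sheaf U'}" by blast
    next
      fix v assume "v \<in> {\<Sum>i<n. sc (f i) (?e i) | f. \<forall>i<n. f i \<in> structure_sheaf U'}"
      then obtain f where f: "v = (\<Sum>i<n. sc (f i) (?e i))" "\<forall>i<n. f i \<in> structure_sheaf U'" by blast
      have "T f i \<in> structure_sheaf U'" if "i < n" for i
        using ring(4)[OF _ ring(5), of "f i" "f p" "d i"] f(2) d' p(1) that by (auto simp: T_def)
      moreover have "v = (\<Sum>i<n. sc (T f i) (e i))" unfolding f(1) T ..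
      ultimately show "v \<in> {\<Sum>i<n. sc (f i) (e i) | f. \<forall>i<n. f i \<in> structure_sheaf U'}" by blast
    qed
  qed
qed

lemma frame_permute:
  assumes e: "frame_on X sc E U n e" and \<pi>: "\<pi> permutes {..<n}"
  shows "frame_on X sc E U n (e \<circ> \<pi>)"
proof -
  have sum: "(\<Sum>i<n. sc (f (\<pi> i)) (e (\<pi> i))) = (\<Sum>i<n. sc (f i) (e i))" for f
    using sum.permute[OF \<pi>, of "\<lambda>i. sc (f i) (e i)"] by (simp add: comp_def)
  have "(\<Sum>i<n. sc (f i) ((e \<circ> \<pi>) i)) = (\<Sum>i<n. sc ((f \<circ> inv_into UNIV \<pi>) i) (e i))" for f
    using sum[of "f \<circ> inv_into UNIV \<pi>"] permutes_inverses(2)[OF \<pi>] by simp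
  then have sums: "{\<Sum>i<n. sc (f i) ((e \<circ> \<pi>) i) | f. \<forall>i<n. f i \<in> A} =
      {\<Sum>i<n. sc (f i) (e i) | f. \<forall>i<n. f i \<in> A}" for A
  proof (intro equalityI subsetI)
    fix v assume *: "\<And>f. (\<Sum>i<n. sc (f i) ((e \<circ> \<pi>) i)) = (\<Sum>i<n. sc ((f \<circ> inv_into UNIV \<pi>) i) (e i))"
      and "v \<in> {\<Sum>i<n. sc (f i) ((e \<circ> \<pi>) i) | f. \<forall>i<n. f i \<in> A}"
    then obtain f where f: "v = (\<Sum>i<n. sc (f i) ((e \<circ> \<pi>) i))" "\<forall>i<n. f i \<in> A" by blast
    have "\<forall>i<n. (f \<circ> inv_into UNIV \<pi>) i \<in> A"
      using f(2) permutes_in_image[OF permutes_inv[OF \<pi>]] by simp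
    then show "v \<in> {\<Sum>i<n. sc (f i) (e i) | f. \<forall>i<n. f i \<in> A}" using f(1) * by blast
  next
    fix v assume "v \<in> {\<Sum>i<n. sc (f i) (e i) | f. \<forall>i<n. f i \<in> A}"
    then obtain f where f: "v = (\<Sum>i<n. sc (f i) (e i))" "\<forall>i<n. f i \<in> A" by blast
    have "v = (\<Sum>i<n. sc ((f \<circ> \<pi>) i) ((e \<circ> \<pi>) i))" using sum[of f] f(1) by simp
    moreover have "\<forall>i<n. (f \<circ> \<pi>) i \<in> A" using f(2) permutes_in_image[OF \<pi>] by simp
    ultimately show "v \<in> {\<Sum>i<n. sc (f i) ((e \<circ> \<pi>) i) | f. \<forall>i<n. f i \<in> A}" by blast
  qed
  have \<pi>': "bij_betw \<pi> {..<n} {..<n}" using \<pi> by (rule permutes_imp_bij)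
  have "(e \<circ> \<pi>) ` {..<n} = e ` {..<n}" using \<pi>' by (metis bij_betw_imp_surj_on image_comp)
  moreover have "inj_on (e \<circ> \<pi>) {..<n}"
    using comp_inj_on[of \<pi> "{..<n}" e] frame_indep(1)[OF e] \<pi>' by (simp add: bij_betw_def)
  ultimately show ?thesis
    using e unfolding frame_on_def sums by simp
qed

text \<open>
  Dividing the coordinates of \<open>w\<close> outside the span of the first \<open>t\<close> vectors by one of minimal valuation
  makes this coordinate \<open>1\<close> and all others regular at \<open>x\<close>, so that \<open>w\<close> can be exchanged into the frame.
\<close>

lemma adapted_frame_extend:
  assumes E: "is_sheaf X sc E" "generic_fiber X E = UNIV"
    and e: "U \<in> nonempty_opens X" "x \<in> U" "frame_on X sc E U n e"
    and W: "subspace W" "t \<le> n" "\<And>i. i < t \<Longrightarrow> e i \<in> W"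
    and w: "w \<in> W" "w \<notin> span (e ` {..<t})"
  shows "t < n \<and> (\<exists>U'\<in>nonempty_opens X. x \<in> U' \<and> (\<exists>e'. frame_on X sc E U' n e' \<and> (\<forall>i<Suc t. e' i \<in> W)))"
proof -
  have "w \<in> span (e ` {..<n})" using generic_fiber_frame[OF E(1) e(1,3)] E(2) by simp
  then obtain c where c: "w = (\<Sum>i<n. sc (c i) (e i))" unfolding span_family by blast
  \<comment> \<open>The first \<open>t\<close> frame vectors lie in \<open>W\<close>, so their
    contribution can be removed from \<open>w\<close> without leaving \<open>W\<close>. The
    remainder is nonzero because \<open>w\<close> is outside their span.\<close>
  define c' where "c' i = (if i < t then 0 else c i)" for i
  define w' where "w' = (\<Sum>i<n. sc (c' i) (e i))"
  have c_split: "c i = (if i < t then c i else 0) + c' i" for i by (simp add: c'_def)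
  have "w = (\<Sum>i<n. sc ((if i < t then c i else 0) + c' i) (e i))"
    unfolding c by (rule sum.cong[OF refl], subst c_split) simp
  also have "\<dots> = (\<Sum>i<n. sc (if i < t then c i else 0) (e i)) + w'"
    by (simp only: scale_left_distrib sum.distrib w'_def)
  also have "(\<Sum>i<n. sc (if i < t then c i else 0) (e i)) = (\<Sum>i<t. sc (c i) (e i))"
    using W(2) by (intro sum.mono_neutral_cong_right) auto
  finally have w_eq: "w = (\<Sum>i<t. sc (c i) (e i)) + w'" .
  have "(\<Sum>i<t. sc (c i) (e i)) \<in> W"
    using W(1,3) by (intro subspace_sum subspace_scale) auto
  then have w'_mem: "w' \<in> W" using subspace_diff[OF W(1) w(1)] w_eq by fastforce
  define A where "A = c' ` {..<n} - {0}"
  have "A \<noteq> {}"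
  proof
    assume "A = {}"
    then have "c' i = 0" if "i < n" for i using that by (auto simp: A_def)
    then have "w' = 0" by (simp add: w'_def)
    then have "w \<in> span (e ` {..<t})" unfolding w_eq span_family by auto
    then show False using w(2) by contradiction
  qed
  moreover have x: "x \<in> X" using open_subset[OF e(1)] e(2) by blast
  ultimately obtain a where a: "a \<in> A" "\<forall>b\<in>A. b / a \<in> x"
    using common_divisor[OF x, of A] by (auto simp: A_def)
  then obtain p where p: "p < n" "c' p = a" "a \<noteq> 0" by (auto simp: A_def)
  then have "t \<le> p" by (auto simp: c'_def split: if_splits)
  define d where "d i = c' i / a" for i
  have d_x: "d i \<in> x" if "i < n" for i
    using a(2) point_0[OF x] that by (cases "c' i = 0") (auto simp: d_def A_def)
  define U' where "U' = {y\<in>U. d ` {..<n} \<subseteq> y}"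
  have U': "U' \<in> nonempty_opens X" "U' \<subseteq> U" "x \<in> U'"
    using regular_open[OF e(1), of "d ` {..<n}"] e(2) d_x by (auto simp: U'_def)
  have "frame_on X sc E U' n (e(p := \<Sum>i<n. sc (d i) (e i)))"
  proof (rule frame_exchange[OF frame_on_restrict[OF e(3) U'(2)] p(1)])
    show "d p = 1" using p by (simp add: d_def)
    show "d i \<in> structure_sheaf U'" if "i < n" for i
      using that by (auto simp: structure_sheaf_def U'_def)
  qed
  \<comment> \<open>The new vector moves from position \<open>p\<close> to position
    \<open>t\<close>, directly after the vectors already known to lie in \<open>W\<close>.\<close>
  then have frame: "frame_on X sc E U' n (e(p := \<Sum>i<n. sc (d i) (e i)) \<circ> transpose t p)"
    using p(1) \<open>t \<le> p\<close> by (intro frame_permute permutes_swap_id) auto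
  have "(\<Sum>i<n. sc (d i) (e i)) = sc (1 / a) w'"
    by (simp add: w'_def d_def scale_sum_right)
  then have "(\<Sum>i<n. sc (d i) (e i)) \<in> W" using subspace_scale[OF W(1) w'_mem] by simp
  then have "\<forall>i<Suc t. (e(p := \<Sum>i<n. sc (d i) (e i)) \<circ> transpose t p) i \<in> W"
    using W(3) \<open>t \<le> p\<close> by (auto simp: less_Suc_eq transpose_def)
  moreover have "t < n" using p(1) \<open>t \<le> p\<close> by simp
  ultimately show ?thesis using frame U'(1,3) by blast
qed

text \<open>Take a frame near \<open>x\<close> with as many initial vectors in \<open>W\<close> as
  possible, a number bounded by \<open>r\<close>. If they did not span \<open>W\<close>,
  \<open>adapted_frame_extend\<close> would produce one more on a smaller neighbourhood.\<close>

lemma adapted_frame_exists: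
  assumes E: "vector_bundle X sc r E" "generic_fiber X E = UNIV"
    and W: "subspace W" and x: "x \<in> X"
  obtains U e where "U \<in> nonempty_opens X" "x \<in> U" "frame_on X sc E U r e"
    "dim W \<le> r" "span (e ` {..<dim W}) = W"
proof -
  define P where "P t \<longleftrightarrow> t \<le> r \<and> (\<exists>U\<in>nonempty_opens X. x \<in> U \<and> (\<exists>e. frame_on X sc E U r e \<and> (\<forall>i<t. e i \<in> W)))" for t
  have sheaf: "is_sheaf X sc E" using E(1) by (simp add: vector_bundle_def)
  have "P 0" using E(1) x unfolding P_def vector_bundle_def by auto
  moreover have "\<And>t. P t \<Longrightarrow> t \<le> r" by (simp add: P_def)
  ultimately obtain t where t: "P t" "\<And>t'. P t' \<Longrightarrow> t' \<le> t"
    using GreatestI_nat[of P 0 r] Greatest_le_nat[of P _ r] by metis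
  then obtain U e where U: "U \<in> nonempty_opens X" "x \<in> U" "frame_on X sc E U r e" "\<forall>i<t. e i \<in> W" "t \<le> r"
    unfolding P_def by blast
  have "W \<subseteq> span (e ` {..<t})"
  proof (rule ccontr)
    assume "\<not> ?thesis"
    then obtain w where "w \<in> W" "w \<notin> span (e ` {..<t})" by blast
    then have "P (Suc t)"
      using adapted_frame_extend[OF sheaf E(2) U(1-3) W U(5), of w] U(4) unfolding P_def by auto
    then show False using t(2) by fastforce
  qed
  moreover have "e ` {..<t} \<subseteq> W" using U(4) by auto
  ultimately have span: "span (e ` {..<t}) = W" using span_subspace W by blast
  have "{..<t} \<subseteq> {..<r}" using U(5) by simp
  then have "independent (e ` {..<t})" "inj_on e {..<t}"
    using independent_mono[OF frame_indep(2)[OF U(3)] image_mono] inj_on_subset[OF frame_indep(1)[OF U(3)]]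
    by blast+
  then have t_eq: "dim W = t"
    using dim_span_eq_card_independent[of "e ` {..<t}"] unfolding span by (simp add: card_image)
  show thesis by (rule that[OF U(1-3)]) (use U(5) span t_eq in simp_all)
qed

section \<open>Subbundles and subspaces of the generic fiber\<close>

lemma frame_on_saturation:
  assumes E: "frame_on X sc E U n e" and "s \<le> n"
  shows "frame_on X sc (\<lambda>U'. E U' \<inter> span (e ` {..<s})) U s e"
proof -
  have ind: "\<forall>f. (\<Sum>i<n. sc (f i) (e i)) = 0 \<longrightarrow> (\<forall>i<n. f i = 0)"
    using E unfolding frame_on_iff by blast
  have extend: "(\<Sum>i<s. sc (f i) (e i)) = (\<Sum>i<n. sc (if i < s then f i else 0) (e i))" for f
    using assms(2) by (intro sum.mono_neutral_cong_left) auto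
  show ?thesis
    unfolding frame_on_iff
  proof (intro conjI allI impI ballI)
    fix f i assume "(\<Sum>i<s. sc (f i) (e i)) = 0" "i < s"
    then show "f i = 0"
      using ind[rule_format, of "\<lambda>i. if i < s then f i else 0" i] assms(2) unfolding extend by simp
  next
    fix U' assume U': "U' \<in> nonempty_opens X" "U' \<subseteq> U"
    show "E U' \<inter> span (e ` {..<s}) = {\<Sum>i<s. sc (f i) (e i) | f. \<forall>i<s. f i \<in> structure_sheaf U'}"
    proof (intro equalityI subsetI)
      fix v assume v: "v \<in> E U' \<inter> span (e ` {..<s})"
      then obtain f where f: "v = (\<Sum>i<n. sc (f i) (e i))" "\<forall>i<n. f i \<in> structure_sheaf U'"
        unfolding frame_sections[OF E U'] by blast
      have "f i = 0" if "s \<le> i" "i < n" for i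
        using family_coeff_eq_0[OF ind assms(2) _ that, of f] v f(1) by blast
      then have "v = (\<Sum>i<s. sc (f i) (e i))"
        unfolding f(1) using assms(2) by (intro sum.mono_neutral_right) auto
      then show "v \<in> {\<Sum>i<s. sc (f i) (e i) | f. \<forall>i<s. f i \<in> structure_sheaf U'}"
        using f(2) assms(2) by auto
    next
      fix v assume "v \<in> {\<Sum>i<s. sc (f i) (e i) | f. \<forall>i<s. f i \<in> structure_sheaf U'}"
      then obtain f where f: "v = (\<Sum>i<s. sc (f i) (e i))" "\<forall>i<s. f i \<in> structure_sheaf U'" by blast
      have "v \<in> E U'"
        unfolding frame_sections[OF E U'] f(1) extend
        using f(2) structure_sheaf_ring(1)[OF U'(1)] by (intro CollectI exI[of _ "\<lambda>i. if i < s then f i else 0"]) auto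
      then show "v \<in> E U' \<inter> span (e ` {..<s})" using f(1) unfolding span_family by blast
    qed
  qed
qed

text \<open>The largest subsheaf of \<open>E\<close> with sections in \<open>W\<close>. On a smooth
  curve it is a subbundle, which gives the way back from subspaces of the generic fiber to
  subbundles.\<close>

definition saturation :: "('k, 'v) subsheaf \<Rightarrow> 'v set \<Rightarrow> ('k, 'v) subsheaf" where
  "saturation E W U = E U \<inter> W"

lemma is_sheaf_saturation:
  assumes E: "is_sheaf X sc E" and W: "subspace W"
  shows "is_sheaf X sc (saturation E W)"
proof (rule is_sheafI)
  fix U v assume U: "U \<in> nonempty_opens X"
    and loc: "\<And>x. x \<in> U \<Longrightarrow> \<exists>U'\<in>nonempty_opens X. x \<in> U' \<and> U' \<subseteq> U \<and> v \<in> saturation E W U'"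
  have "v \<in> E U" by (rule sheaf_glue[OF E U]) (use loc in \<open>auto simp: saturation_def\<close>)
  moreover have "v \<in> W" using loc generic_mem_open[OF U] by (auto simp: saturation_def)
  ultimately show "v \<in> saturation E W U" by (simp add: saturation_def)
next
  show "v \<in> saturation E W U'"
    if "U \<in> nonempty_opens X" "U' \<in> nonempty_opens X" "U' \<subseteq> U" "v \<in> saturation E W U" for U U' v
    using sheaf_restrict[OF E that(1-3)] that(4) by (auto simp: saturation_def)
qed (use W sheaf_0[OF E] sheaf_add[OF E] sheaf_scale[OF E] in
    \<open>auto simp: saturation_def subspace_0 subspace_add subspace_scale\<close>)

lemma subbundle_saturation:
  assumes E: "vector_bundle X sc r E" "generic_fiber X E = UNIV" and W: "subspace W"
  shows "subbundle X sc (saturation E W) E"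
proof -
  have "\<exists>U\<in>nonempty_opens X. x \<in> U \<and>
      (\<exists>e. frame_on X sc E U r e \<and> frame_on X sc (saturation E W) U (dim W) e)" if "x \<in> X" for x
  proof -
    obtain U e where U: "U \<in> nonempty_opens X" "x \<in> U" "frame_on X sc E U r e"
        "dim W \<le> r" "span (e ` {..<dim W}) = W"
      by (rule adapted_frame_exists[OF E W \<open>x \<in> X\<close>])
    then show ?thesis
      using frame_on_saturation[OF U(3,4)] by (auto simp: saturation_def[abs_def])
  qed
  moreover have "dim W \<le> r"
    by (rule adapted_frame_exists[OF E W generic_point_mem])
  moreover have "is_sheaf X sc E" using E(1) by (simp add: vector_bundle_def)
  ultimately show ?thesis
    unfolding subbundle_def using is_sheaf_saturation[OF _ W]
    by (intro conjI exI[of _ "dim W"] exI[of _ r]) (auto simp: subsheaf_of_def saturation_def)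
qed

lemma stalk_saturation: "stalk X (saturation E W) x = stalk X E x \<inter> W"
  by (auto simp: stalk_def saturation_def)

text \<open>Locally \<open>F\<close> is generated by part of a frame of \<open>E\<close>, and a
  section of \<open>E\<close> that lies generically in \<open>F\<close> has no coordinates along the
  rest. So a subbundle can be recovered from its generic fiber.\<close>

lemma subbundle_saturated:
  assumes F: "subbundle X sc F E" and E: "is_sheaf X sc E" and U: "U \<in> nonempty_opens X"
    and v: "v \<in> E U" "v \<in> generic_fiber X F"
  shows "v \<in> F U"
proof -
  obtain s n where "s \<le> n" and frames: "\<And>x. x \<in> X \<Longrightarrow> \<exists>U\<in>nonempty_opens X. x \<in> U \<and>
      (\<exists>e. frame_on X sc E U n e \<and> frame_on X sc F U s e)" and sheaf: "is_sheaf X sc F"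
    using F unfolding subbundle_def by blast
  show ?thesis
  proof (rule sheaf_glue[OF sheaf U])
    fix x assume "x \<in> U"
    then obtain U0 e where U0: "U0 \<in> nonempty_opens X" "x \<in> U0" "frame_on X sc E U0 n e" "frame_on X sc F U0 s e"
      using frames open_subset[OF U] by blast
    have U1: "U0 \<inter> U \<in> nonempty_opens X" by (rule Int_open[OF U0(1) U])
    have "v \<in> E (U0 \<inter> U) \<inter> span (e ` {..<s})"
      using v sheaf_restrict[OF E U U1] generic_fiber_frame[OF sheaf U0(1,4)] by blast
    moreover have "F (U0 \<inter> U) = E (U0 \<inter> U) \<inter> span (e ` {..<s})"
      using frame_sections[OF U0(4) U1] frame_sections[OF frame_on_saturation[OF U0(3) \<open>s \<le> n\<close>] U1] by simp
    ultimately have "v \<in> F (U0 \<inter> U)" by blast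
    then show "\<exists>U'\<in>nonempty_opens X. x \<in> U' \<and> U' \<subseteq> U \<and> v \<in> F U'"
      using U1 U0(2) \<open>x \<in> U\<close> by (intro bexI[of _ "U0 \<inter> U"]) simp_all
  qed
qed

end

section \<open>Line bundles and twists\<close>

text \<open>A frame of a line bundle inside the function field is a single nonzero rational
  function; this form avoids families indexed by one element.\<close>

definition local_generator :: "'k::field set set \<Rightarrow> ('k, 'k) subsheaf \<Rightarrow> 'k set set \<Rightarrow> 'k \<Rightarrow> bool" where
  "local_generator X L U g \<longleftrightarrow> g \<noteq> 0 \<and>
     (\<forall>U'\<in>nonempty_opens X. U' \<subseteq> U \<longrightarrow> L U' = (\<lambda>f. f * g) ` structure_sheaf U')"

lemma local_generator_sections:
  "local_generator X L U g \<Longrightarrow> U' \<in> nonempty_opens X \<Longrightarrow> U' \<subseteq> U \<Longrightarrow> L U' = (\<lambda>f. f * g) ` structure_sheaf U'"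
  by (simp add: local_generator_def)

lemma local_generator_restrict: "local_generator X L U g \<Longrightarrow> U' \<subseteq> U \<Longrightarrow> local_generator X L U' g"
  unfolding local_generator_def by (meson subset_trans)

lemma additive_span_subset:
  assumes "S \<subseteq> M" "0 \<in> M" "\<And>u v. u \<in> M \<Longrightarrow> v \<in> M \<Longrightarrow> u + v \<in> M"
  shows "additive_span S \<subseteq> M"
proof
  fix v assume "v \<in> additive_span S"
  then show "v \<in> M" by induction (use assms in auto)
qed

lemma additive_span_mono: "S \<subseteq> S' \<Longrightarrow> additive_span S \<subseteq> additive_span S'"
  by (intro additive_span_subset additive_span.zero additive_span.add) (auto intro: additive_span.base)

context curve
begin

lemma curve_space_self: "curve_space emb X ((*) :: 'k \<Rightarrow> 'k \<Rightarrow> 'k)"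
  by (simp add: curve_space_def curve_axioms vector_space_self)

lemma frame_on_line_iff: "frame_on X (*) L U 1 e \<longleftrightarrow> local_generator X L U (e 0)"
proof -
  have "(\<forall>f. (\<Sum>i<1::nat. f i * e i) = 0 \<longrightarrow> (\<forall>i<1. f i = 0)) \<longleftrightarrow> e 0 \<noteq> 0"
    by (auto dest: spec[of _ "\<lambda>_. 1"])
  moreover have "{\<Sum>i<1::nat. f i * e i | f. \<forall>i<1. f i \<in> A} = (\<lambda>f. f * e 0) ` A" for A
  proof (intro equalityI subsetI)
    fix v assume "v \<in> (\<lambda>f. f * e 0) ` A"
    then obtain a where "a \<in> A" "v = a * e 0" by blast
    then show "v \<in> {\<Sum>i<1::nat. f i * e i | f. \<forall>i<1. f i \<in> A}"
      by (intro CollectI exI[of _ "\<lambda>_. a"]) simp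
  qed auto
  ultimately show ?thesis
    unfolding curve_space.frame_on_iff[OF curve_space_self] local_generator_def by simp
qed

lemma line_bundle_iff:
  "line_bundle X L \<longleftrightarrow> is_sheaf X (*) L \<and>
     (\<forall>x\<in>X. \<exists>U\<in>nonempty_opens X. x \<in> U \<and> (\<exists>g. local_generator X L U g))"
proof -
  have "(\<exists>e. frame_on X (*) L U 1 e) \<longleftrightarrow> (\<exists>g. local_generator X L U g)" for U
  proof
    assume "\<exists>g. local_generator X L U g"
    then obtain g where "local_generator X L U g" ..
    then show "\<exists>e. frame_on X (*) L U 1 e"
      unfolding frame_on_line_iff by (intro exI[of _ "\<lambda>_. g"])
  next
    assume "\<exists>e. frame_on X (*) L U 1 e"
    then show "\<exists>g. local_generator X L U g"
      unfolding frame_on_line_iff by (elim exE) (rule exI)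
  qed
  then show ?thesis by (simp add: line_bundle_def vector_bundle_def)
qed

lemma line_bundle_sheaf: "line_bundle X L \<Longrightarrow> is_sheaf X (*) L"
  by (simp add: line_bundle_iff)

lemma line_bundle_generator:
  assumes "line_bundle X L" "U \<in> nonempty_opens X" "x \<in> U"
  obtains U' g where "U' \<in> nonempty_opens X" "x \<in> U'" "U' \<subseteq> U" "local_generator X L U' g"
proof -
  have "x \<in> X" using open_subset[OF assms(2)] assms(3) by blast
  then have "\<exists>V\<in>nonempty_opens X. x \<in> V \<and> (\<exists>g. local_generator X L V g)"
    using assms(1) by (simp add: line_bundle_iff)
  then obtain V g where V: "V \<in> nonempty_opens X" "x \<in> V" "local_generator X L V g" by (elim bexE conjE exE)
  show thesis
    by (rule that[OF Int_open[OF V(1) assms(2)] _ _ local_generator_restrict[OF V(3)]])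
      (use V(2) assms(3) in auto)
qed

lemma generator_mem:
  "local_generator X L U g \<Longrightarrow> U \<in> nonempty_opens X \<Longrightarrow> g \<in> L U"
  unfolding local_generator_sections[OF _ _ order_refl]
  using structure_sheaf_ring(2)[of U] by force

lemma structure_sheaf_is_sheaf: "is_sheaf X (*) structure_sheaf"
proof (rule is_sheafI)
  fix U v assume "U \<in> nonempty_opens X"
    and loc: "\<And>x. x \<in> U \<Longrightarrow> \<exists>U'\<in>nonempty_opens X. x \<in> U' \<and> U' \<subseteq> U \<and> v \<in> structure_sheaf U'"
  show "v \<in> structure_sheaf U"
    unfolding structure_sheaf_def
  proof
    fix x assume "x \<in> U"
    from loc[OF this] show "v \<in> x" by (auto simp: structure_sheaf_def)
  qed
next
  show "v \<in> structure_sheaf U'" if "U' \<subseteq> U" "v \<in> structure_sheaf U" for U U' and v :: 'k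
    using structure_sheaf_mono[OF that(1)] that(2) by blast
qed (simp_all add: structure_sheaf_ring)

lemma line_bundle_structure_sheaf: "line_bundle X structure_sheaf"
proof -
  have "local_generator X structure_sheaf X 1" by (simp add: local_generator_def)
  then show ?thesis
    unfolding line_bundle_iff using structure_sheaf_is_sheaf X_open by blast
qed

end

context curve_space
begin

text \<open>Where \<open>g\<close> generates \<open>L\<close>, the products already form
  \<open>g\<close> times \<open>E\<close>. Dividing local sections by \<open>g\<close> and gluing in
  \<open>E\<close> shows that sheafification adds nothing there.\<close>

lemma twist_eq:
  assumes E: "is_sheaf X sc E" and g: "local_generator X L U g"
    and U': "U' \<in> nonempty_opens X" "U' \<subseteq> U"
  shows "twist X sc L E U' = sc g ` E U'"
proof
  have nz: "g \<noteq> 0" using g by (simp add: local_generator_def)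
  have gen: "{sc f u | f u. f \<in> L V \<and> u \<in> E V} \<subseteq> sc g ` E V"
    if V: "V \<in> nonempty_opens X" "V \<subseteq> U" for V
  proof clarify
    fix f u assume "f \<in> L V" "u \<in> E V"
    then obtain h where h: "h \<in> structure_sheaf V" "f = h * g"
      unfolding local_generator_sections[OF g V] by blast
    then have "sc f u = sc g (sc h u)" by (simp add: mult.commute)
    then show "sc f u \<in> sc g ` E V" using sheaf_scale[OF E V(1) h(1) \<open>u \<in> E V\<close>] by blast
  qed
  have span: "additive_span {sc f u | f u. f \<in> L V \<and> u \<in> E V} \<subseteq> sc g ` E V"
    if V: "V \<in> nonempty_opens X" "V \<subseteq> U" for V
  proof (rule additive_span_subset[OF gen[OF V]])
    show "0 \<in> sc g ` E V" using sheaf_0[OF E V(1)] by (metis image_eqI scale_zero_right)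
    show "u + v \<in> sc g ` E V" if "u \<in> sc g ` E V" "v \<in> sc g ` E V" for u v
      using that sheaf_add[OF E V(1)] by (auto simp: scale_right_distrib[symmetric])
  qed
  show "twist X sc L E U' \<subseteq> sc g ` E U'"
  proof
    fix v assume v: "v \<in> twist X sc L E U'"
    have "sc (inverse g) v \<in> E U'"
    proof (rule sheaf_glue[OF E U'(1)])
      fix x assume "x \<in> U'"
      then obtain V where V: "V \<in> nonempty_opens X" "x \<in> V" "V \<subseteq> U'"
          "v \<in> additive_span {sc f u | f u. f \<in> L V \<and> u \<in> E V}"
        using v unfolding twist_def by blast
      then have "v \<in> sc g ` E V" using span[OF V(1)] U'(2) by blast
      then have "sc (inverse g) v \<in> E V" using nz by auto
      then show "\<exists>V\<in>nonempty_opens X. x \<in> V \<and> V \<subseteq> U' \<and> sc (inverse g) v \<in> E V"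
        using V(1-3) by (intro bexI[of _ V]) simp_all
    qed
    moreover have "v = sc g (sc (inverse g) v)" using nz by simp
    ultimately show "v \<in> sc g ` E U'" by blast
  qed
  show "sc g ` E U' \<subseteq> twist X sc L E U'"
  proof clarify
    fix u assume u: "u \<in> E U'"
    have "g \<in> L U'" by (rule generator_mem[OF local_generator_restrict[OF g U'(2)] U'(1)])
    then have "sc g u \<in> additive_span {sc f u | f u. f \<in> L U' \<and> u \<in> E U'}"
      using u by (intro additive_span.base) blast
    then show "sc g u \<in> twist X sc L E U'"
      unfolding twist_def using U'(1) by blast
  qed
qed

lemma twist_is_sheaf:
  assumes L: "is_sheaf X (*) L" and E: "is_sheaf X sc E"
  shows "is_sheaf X sc (twist X sc L E)"
proof -
  let ?S = "\<lambda>V. {sc f u | f u. f \<in> L V \<and> u \<in> E V}"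
  have S_mono: "additive_span (?S V) \<subseteq> additive_span (?S V')"
    if "V \<in> nonempty_opens X" "V' \<in> nonempty_opens X" "V' \<subseteq> V" for V V'
    using sheaf_restrict[OF L that] sheaf_restrict[OF E that] by (intro additive_span_mono) blast
  have twistI: "v \<in> twist X sc L E U"
    if "\<And>x. x \<in> U \<Longrightarrow> \<exists>V\<in>nonempty_opens X. x \<in> V \<and> V \<subseteq> U \<and> v \<in> additive_span (?S V)" for U v
    using that unfolding twist_def by blast
  have twistD: "\<exists>V\<in>nonempty_opens X. x \<in> V \<and> V \<subseteq> U \<and> v \<in> additive_span (?S V)"
    if "v \<in> twist X sc L E U" "x \<in> U" for U v x
    using that unfolding twist_def by blast
  show ?thesis
  proof (rule is_sheafI)
    fix U assume U: "U \<in> nonempty_opens X"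
    show "0 \<in> twist X sc L E U"
      by (rule twistI) (use U additive_span.zero in blast)
  next
    fix U u v assume U: "U \<in> nonempty_opens X" and uv: "u \<in> twist X sc L E U" "v \<in> twist X sc L E U"
    show "u + v \<in> twist X sc L E U"
    proof (rule twistI)
      fix x assume "x \<in> U"
      obtain V where V: "V \<in> nonempty_opens X" "x \<in> V" "V \<subseteq> U" "u \<in> additive_span (?S V)"
        using twistD[OF uv(1) \<open>x \<in> U\<close>] by (elim bexE conjE)
      obtain V' where V': "V' \<in> nonempty_opens X" "x \<in> V'" "V' \<subseteq> U" "v \<in> additive_span (?S V')"
        using twistD[OF uv(2) \<open>x \<in> U\<close>] by (elim bexE conjE)
      have W: "V \<inter> V' \<in> nonempty_opens X" by (rule Int_open[OF V(1) V'(1)])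
      have "u + v \<in> additive_span (?S (V \<inter> V'))"
        by (intro additive_span.add subsetD[OF S_mono[OF V(1) W Int_lower1] V(4)]
            subsetD[OF S_mono[OF V'(1) W Int_lower2] V'(4)])
      then show "\<exists>V\<in>nonempty_opens X. x \<in> V \<and> V \<subseteq> U \<and> u + v \<in> additive_span (?S V)"
        using W V(2,3) V'(2) by (intro bexI[of _ "V \<inter> V'"]) auto
    qed
  next
    fix U f v assume U: "U \<in> nonempty_opens X" and f: "f \<in> structure_sheaf U" and v: "v \<in> twist X sc L E U"
    show "sc f v \<in> twist X sc L E U"
    proof (rule twistI)
      fix x assume "x \<in> U"
      obtain V where V: "V \<in> nonempty_opens X" "x \<in> V" "V \<subseteq> U" "v \<in> additive_span (?S V)"
        using twistD[OF v \<open>x \<in> U\<close>] by (elim bexE conjE)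
      have f': "f \<in> structure_sheaf V" using f structure_sheaf_mono[OF V(3)] by blast
      from V(4) have "sc f v \<in> additive_span (?S V)"
      proof induction
        case (base v)
        then obtain h u where "v = sc h u" "h \<in> L V" "u \<in> E V" by blast
        then have "sc f v = sc h (sc f u)" "h \<in> L V" "sc f u \<in> E V"
          using sheaf_scale[OF E V(1) f'] by (simp_all add: mult.commute)
        then show ?case by (intro additive_span.base) blast
      qed (simp_all add: additive_span.zero additive_span.add scale_right_distrib)
      then show "\<exists>V\<in>nonempty_opens X. x \<in> V \<and> V \<subseteq> U \<and> sc f v \<in> additive_span (?S V)"
        using V(1-3) by (intro bexI[of _ V]) simp_all
    qed
  next
    fix U U' v assume U: "U \<in> nonempty_opens X" "U' \<in> nonempty_opens X" "U' \<subseteq> U" and v: "v \<in> twist X sc L E U"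
    show "v \<in> twist X sc L E U'"
    proof (rule twistI)
      fix x assume "x \<in> U'"
      then have "x \<in> U" using U(3) by blast
      obtain V where V: "V \<in> nonempty_opens X" "x \<in> V" "V \<subseteq> U" "v \<in> additive_span (?S V)"
        using twistD[OF v \<open>x \<in> U\<close>] by (elim bexE conjE)
      have W: "V \<inter> U' \<in> nonempty_opens X" by (rule Int_open[OF V(1) U(2)])
      have "v \<in> additive_span (?S (V \<inter> U'))"
        by (rule subsetD[OF S_mono[OF V(1) W Int_lower1] V(4)])
      then show "\<exists>V\<in>nonempty_opens X. x \<in> V \<and> V \<subseteq> U' \<and> v \<in> additive_span (?S V)"
        using W V(2) \<open>x \<in> U'\<close> by (intro bexI[of _ "V \<inter> U'"]) auto
    qed
  next
    fix U v assume U: "U \<in> nonempty_opens X"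
      and loc: "\<And>x. x \<in> U \<Longrightarrow> \<exists>U'\<in>nonempty_opens X. x \<in> U' \<and> U' \<subseteq> U \<and> v \<in> twist X sc L E U'"
    show "v \<in> twist X sc L E U"
    proof (rule twistI)
      fix x assume "x \<in> U"
      obtain U' where U': "U' \<in> nonempty_opens X" "x \<in> U'" "U' \<subseteq> U" "v \<in> twist X sc L E U'"
        using loc[OF \<open>x \<in> U\<close>] by (elim bexE conjE)
      obtain V where V: "V \<in> nonempty_opens X" "x \<in> V" "V \<subseteq> U'" "v \<in> additive_span (?S V)"
        using twistD[OF U'(4,2)] by (elim bexE conjE)
      then show "\<exists>V\<in>nonempty_opens X. x \<in> V \<and> V \<subseteq> U \<and> v \<in> additive_span (?S V)"
        using U'(3) by (intro bexI[of _ V]) auto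
    qed
  qed
qed

end

context curve
begin

lemma line_bundle_twist:
  assumes L: "line_bundle X L" and M: "line_bundle X M"
  shows "line_bundle X (twist X (*) L M)"
  unfolding line_bundle_iff
proof (intro conjI ballI)
  interpret self: curve_space emb X "(*)" by (rule curve_space_self)
  show "is_sheaf X (*) (twist X (*) L M)"
    by (rule self.twist_is_sheaf) (use L M line_bundle_sheaf in auto)
  fix x assume x: "x \<in> X"
  obtain U g where U: "U \<in> nonempty_opens X" "x \<in> U" "local_generator X L U g"
    by (rule line_bundle_generator[OF L X_open x])
  obtain U' h where U': "U' \<in> nonempty_opens X" "x \<in> U'" "U' \<subseteq> U" "local_generator X M U' h"
    by (rule line_bundle_generator[OF M U(1,2)])
  have "local_generator X (twist X (*) L M) U' (g * h)"
    unfolding local_generator_def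
  proof (intro conjI ballI impI)
    show "g * h \<noteq> 0" using U(3) U'(4) by (simp add: local_generator_def)
    fix V assume V: "V \<in> nonempty_opens X" "V \<subseteq> U'"
    have "twist X (*) L M V = (*) g ` M V"
      by (rule self.twist_eq[OF line_bundle_sheaf[OF M] U(3) V(1)]) (use V(2) U'(3) in blast)
    also have "M V = (\<lambda>f. f * h) ` structure_sheaf V"
      by (rule local_generator_sections[OF U'(4) V])
    also have "(*) g ` (\<lambda>f. f * h) ` structure_sheaf V = (\<lambda>f. f * (g * h)) ` structure_sheaf V"
      unfolding image_image by (intro image_cong refl mult.left_commute)
    finally show "twist X (*) L M V = (\<lambda>f. f * (g * h)) ` structure_sheaf V" .
  qed
  then show "\<exists>U\<in>nonempty_opens X. x \<in> U \<and> (\<exists>g. local_generator X (twist X (*) L M) U g)"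
    using U'(1,2) by (intro bexI[of _ U'] conjI exI[of _ "g * h"])
qed

text \<open>Near each point the inverse of a generator of \<open>L\<close> generates the
  dual.\<close>

lemma line_bundle_dual:
  assumes L: "line_bundle X L"
  shows "line_bundle X (dual_line_bundle X L)"
  unfolding line_bundle_iff
proof (intro conjI ballI)
  let ?D = "dual_line_bundle X L"
  have DI: "f \<in> ?D U" if "\<And>V l. V \<in> nonempty_opens X \<Longrightarrow> V \<subseteq> U \<Longrightarrow> l \<in> L V \<Longrightarrow> f * l \<in> structure_sheaf V" for f U
    using that by (simp add: dual_line_bundle_def)
  have DD: "f * l \<in> structure_sheaf V" if "f \<in> ?D U" "V \<in> nonempty_opens X" "V \<subseteq> U" "l \<in> L V" for f U V l
    using that by (simp add: dual_line_bundle_def)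
  show "is_sheaf X (*) ?D"
  proof (rule is_sheafI)
    show "0 \<in> ?D U" for U by (rule DI) (simp add: structure_sheaf_ring)
    show "u + v \<in> ?D U" if "u \<in> ?D U" "v \<in> ?D U" for U u v
      by (rule DI) (simp add: distrib_right structure_sheaf_ring DD[OF that(1)] DD[OF that(2)])
    show "f * v \<in> ?D U" if "f \<in> structure_sheaf U" "v \<in> ?D U" for U f v
    proof (rule DI)
      fix V l assume V: "V \<in> nonempty_opens X" "V \<subseteq> U" "l \<in> L V"
      have "f * (v * l) \<in> structure_sheaf V"
        by (rule structure_sheaf_ring(5)[OF V(1) subsetD[OF structure_sheaf_mono[OF V(2)] that(1)] DD[OF that(2) V]])
      then show "f * v * l \<in> structure_sheaf V" by (simp add: mult.assoc)
    qed
    show "v \<in> ?D U'" if "U' \<subseteq> U" "v \<in> ?D U" for U U' v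
      by (rule DI, rule DD[OF that(2)]) (use that(1) in auto)
    fix U v assume U: "U \<in> nonempty_opens X"
      and loc: "\<And>x. x \<in> U \<Longrightarrow> \<exists>U'\<in>nonempty_opens X. x \<in> U' \<and> U' \<subseteq> U \<and> v \<in> ?D U'"
    show "v \<in> ?D U"
    proof (rule DI)
      fix V l assume V: "V \<in> nonempty_opens X" "V \<subseteq> U" "l \<in> L V"
      show "v * l \<in> structure_sheaf V"
      proof (rule sheaf_glue[OF structure_sheaf_is_sheaf V(1)])
        fix x assume "x \<in> V"
        then have "x \<in> U" using V(2) by blast
        obtain U' where U': "U' \<in> nonempty_opens X" "x \<in> U'" "U' \<subseteq> U" "v \<in> ?D U'"
          using loc[OF \<open>x \<in> U\<close>] by (elim bexE conjE)
        have W: "U' \<inter> V \<in> nonempty_opens X" by (rule Int_open[OF U'(1) V(1)])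
        have "l \<in> L (U' \<inter> V)"
          by (rule subsetD[OF sheaf_restrict[OF line_bundle_sheaf[OF L] V(1) W Int_lower2] V(3)])
        then have "v * l \<in> structure_sheaf (U' \<inter> V)" by (rule DD[OF U'(4) W Int_lower1])
        then show "\<exists>V'\<in>nonempty_opens X. x \<in> V' \<and> V' \<subseteq> V \<and> v * l \<in> structure_sheaf V'"
          using W U'(2) \<open>x \<in> V\<close> by (intro bexI[of _ "U' \<inter> V"]) auto
      qed
    qed
  qed
  fix x assume x: "x \<in> X"
  obtain U g where U: "U \<in> nonempty_opens X" "x \<in> U" "local_generator X L U g"
    by (rule line_bundle_generator[OF L X_open x])
  then have nz: "g \<noteq> 0" by (simp add: local_generator_def)
  have "local_generator X ?D U (inverse g)"
    unfolding local_generator_def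
  proof (intro conjI ballI impI equalityI subsetI)
    show "inverse g \<noteq> 0" using nz by simp
    fix V f assume V: "V \<in> nonempty_opens X" "V \<subseteq> U"
    have g: "g \<in> L V" by (rule generator_mem[OF local_generator_restrict[OF U(3) V(2)] V(1)])
    {
      assume "f \<in> ?D V"
      then have "f * g \<in> structure_sheaf V" using V(1) order_refl g by (rule DD)
      moreover have "f = f * g * inverse g" using nz by simp
      ultimately show "f \<in> (\<lambda>f. f * inverse g) ` structure_sheaf V" by (rule rev_image_eqI)
    next
      assume "f \<in> (\<lambda>f. f * inverse g) ` structure_sheaf V"
      then obtain h where h: "h \<in> structure_sheaf V" "f = h * inverse g" by blast
      show "f \<in> ?D V"
      proof (rule DI)
        fix V' l assume V': "V' \<in> nonempty_opens X" "V' \<subseteq> V" "l \<in> L V'"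
        then have "V' \<subseteq> U" using V(2) by blast
        then obtain k where k: "k \<in> structure_sheaf V'" "l = k * g"
          using V'(3) unfolding local_generator_sections[OF U(3) V'(1) \<open>V' \<subseteq> U\<close>] by blast
        have "h * k \<in> structure_sheaf V'"
          by (rule structure_sheaf_ring(5)[OF V'(1) subsetD[OF structure_sheaf_mono[OF V'(2)] h(1)] k(1)])
        moreover have "f * l = h * k" using h(2) k(2) nz by (simp add: field_simps)
        ultimately show "f * l \<in> structure_sheaf V'" by simp
      qed
    }
  qed
  then show "\<exists>U\<in>nonempty_opens X. x \<in> U \<and> (\<exists>g. local_generator X ?D U g)"
    using U(1,2) by blast
qed

lemma line_bundle_line_bundle_power:
  assumes "line_bundle X L"
  shows "line_bundle X (line_bundle_power X L l)"
proof -
  have "line_bundle X ((twist X (*) L ^^ n) structure_sheaf)" for n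
    by (induction n) (simp_all add: line_bundle_structure_sheaf line_bundle_twist[OF assms])
  then show ?thesis by (simp add: line_bundle_power_def line_bundle_dual)
qed

end

section \<open>Block triangular maps and the sign of the minimal weight\<close>

context split_space
begin

lemma invariant_iff_blocks:
  assumes lin: "Vector_Spaces.linear scale scale \<phi>"
  shows "(\<forall>j\<in>{1..m+1}. \<phi> ` W j \<subseteq> W j) \<longleftrightarrow>
    (\<forall>i\<in>{1..m+1}. \<forall>j\<in>{1..m+1}. i < j \<longrightarrow> (\<forall>v\<in>D i. proj j (\<phi> v) = 0))"
proof
  assume inv: "\<forall>j\<in>{1..m+1}. \<phi> ` W j \<subseteq> W j"
  show "\<forall>i\<in>{1..m+1}. \<forall>j\<in>{1..m+1}. i < j \<longrightarrow> (\<forall>v\<in>D i. proj j (\<phi> v) = 0)"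
  proof (intro ballI impI)
    fix i j v assume ij: "i \<in> {1..m+1}" "j \<in> {1..m+1}" "i < j" and v: "v \<in> D i"
    have "v \<in> W i"
      unfolding mem_W_iff[OF ij(1)] using proj_D[OF ij(1) _ v] by simp
    then have "\<phi> v \<in> W i" using inv ij(1) by blast
    then show "proj j (\<phi> v) = 0" using mem_W_iff[OF ij(1)] ij(2,3) by blast
  qed
next
  assume *: "\<forall>i\<in>{1..m+1}. \<forall>j\<in>{1..m+1}. i < j \<longrightarrow> (\<forall>v\<in>D i. proj j (\<phi> v) = 0)"
  interpret \<phi>: Vector_Spaces.linear scale scale \<phi> by fact
  show "\<forall>j\<in>{1..m+1}. \<phi> ` W j \<subseteq> W j"
  proof (intro ballI image_subsetI)
    fix j v assume j: "j \<in> {1..m+1}" and v: "v \<in> W j"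
    show "\<phi> v \<in> W j"
      unfolding mem_W_iff[OF j]
    proof (intro ballI impI)
      fix i assume i: "i \<in> {1..m+1}" "j < i"
      have "\<phi> v = \<phi> (\<Sum>a=1..m+1. proj a v)" by (simp only: sum_proj)
      then have "proj i (\<phi> v) = (\<Sum>a=1..m+1. proj i (\<phi> (proj a v)))"
        by (simp only: \<phi>.sum proj_sum[OF i(1)])
      also have "\<dots> = 0"
      proof (intro sum.neutral ballI)
        fix a assume a: "a \<in> {1..m+1}"
        show "proj i (\<phi> (proj a v)) = 0"
        proof (cases "a \<le> j")
          case True
          then have "a < i" using i(2) by simp
          then show ?thesis using *[rule_format, OF a i(1) _ proj_mem[OF a]] by blast
        next
          case False
          then have "proj a v = 0" using v a unfolding mem_W_iff[OF j] by auto
          then show ?thesis using proj_0[OF i(1)] by simp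
        qed
      qed
      finally show "proj i (\<phi> v) = 0" .
    qed
  qed
qed

lemma nilpotent_of_blocks:
  assumes lin: "Vector_Spaces.linear scale scale \<phi>"
    and blocks: "\<And>i j v. i \<in> {1..m+1} \<Longrightarrow> j \<in> {1..m+1} \<Longrightarrow> i \<le> j \<Longrightarrow> v \<in> D i \<Longrightarrow> proj j (\<phi> v) = 0"
  shows "nilpotent_hom \<phi>"
proof -
  interpret \<phi>: Vector_Spaces.linear scale scale \<phi> by fact
  \<comment> \<open>Each application of \<phi> removes at least one more component from the top, so
    \<open>m + 1\<close> applications remove all.\<close>
  have *: "proj i ((\<phi> ^^ n) v) = 0" if "i \<in> {1..m+1}" "m + 1 < i + n" for i n v
    using that
  proof (induction n arbitrary: i)
    case 0
    then show ?case by auto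
  next
    case (Suc n)
    let ?w = "(\<phi> ^^ n) v"
    have "\<phi> ?w = \<phi> (\<Sum>a=1..m+1. proj a ?w)" by (simp only: sum_proj)
    then have "proj i (\<phi> ?w) = (\<Sum>a=1..m+1. proj i (\<phi> (proj a ?w)))"
      by (simp only: \<phi>.sum proj_sum[OF Suc.prems(1)])
    also have "\<dots> = 0"
    proof (intro sum.neutral ballI)
      fix a assume a: "a \<in> {1..m+1}"
      show "proj i (\<phi> (proj a ?w)) = 0"
      proof (cases "a \<le> i")
        case True
        then show ?thesis using blocks[OF a Suc.prems(1) _ proj_mem[OF a]] by blast
      next
        case False
        then have "proj a ?w = 0" using Suc.IH[OF a] Suc.prems by simp
        then show ?thesis using proj_0[OF Suc.prems(1)] by simp
      qed
    qed
    finally show ?case by simp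
  qed
  have "(\<phi> ^^ (m + 1)) v = 0" for v
  proof (rule proj_ext)
    fix i assume i: "i \<in> {1..m+1}"
    then have "m + 1 < i + (m + 1)" by simp
    then show "proj i ((\<phi> ^^ (m + 1)) v) = proj i 0" by (simp only: *[OF i] proj_0[OF i])
  qed
  then show ?thesis unfolding nilpotent_hom_def by (intro exI[of _ "m + 1"]) auto
qed

text \<open>A nonzero block from \<open>i\<close> to \<open>j\<close> gives the weight \<gamma> i -
  \<gamma> j, and its sign is decided by the order of \<open>i\<close> and \<open>j\<close>. Blocks
  that raise the index are those which violate invariance; if there are neither such blocks nor
  diagonal ones, the map is nilpotent. \<open>c2\<close> is the coefficient of the scalar
  summand.\<close>

lemma weight_signs:
  fixes \<gamma> :: "nat \<Rightarrow> rat"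
  assumes lin: "Vector_Spaces.linear scale scale \<phi>"
    and \<gamma>: "\<And>i j. i \<in> {1..m+1} \<Longrightarrow> j \<in> {1..m+1} \<Longrightarrow> i < j \<Longrightarrow> \<gamma> i < \<gamma> j"
    and ne: "\<phi> \<noteq> (\<lambda>_. 0) \<or> c2 \<noteq> 0"
  defines "S \<equiv> {\<gamma> i - \<gamma> j | i j. i \<in> {1..m+1} \<and> j \<in> {1..m+1} \<and> (\<exists>v\<in>D i. proj j (\<phi> v) \<noteq> 0)}
      \<union> (if c2 = 0 then {} else {0})"
  shows "\<not> (\<forall>j\<in>{1..m+1}. \<phi> ` W j \<subseteq> W j) \<Longrightarrow> Min S < 0"
    and "\<forall>j\<in>{1..m+1}. \<phi> ` W j \<subseteq> W j \<Longrightarrow> 0 \<le> Min S"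
    and "0 < Min S \<Longrightarrow> c2 = 0 \<and> ((\<forall>j\<in>{1..m+1}. \<phi> ` W j \<subseteq> W j) \<longrightarrow> nilpotent_hom \<phi>)"
    and "c2 = 0 \<Longrightarrow> (\<And>i j v. i \<in> {1..m+1} \<Longrightarrow> j \<in> {1..m+1} \<Longrightarrow> i \<le> j \<Longrightarrow> v \<in> D i \<Longrightarrow> proj j (\<phi> v) = 0) \<Longrightarrow> 0 < Min S"
proof -
  have "S \<subseteq> (\<lambda>(i, j). \<gamma> i - \<gamma> j) ` ({1..m+1} \<times> {1..m+1}) \<union> {0}"
    unfolding S_def by (auto split: if_splits)
  then have fin: "finite S" by (rule finite_subset) simp
  \<comment> \<open>\<open>Min\<close> must not be taken over the empty set: if the scalar summand
    contributes nothing, \<phi> is nonzero and so has a nonzero block.\<close>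
  have S: "S \<noteq> {}"
  proof (cases "c2 = 0")
    case True
    then have "\<phi> \<noteq> (\<lambda>_. 0)" using ne by blast
    have "\<exists>i\<in>{1..m+1}. \<exists>j\<in>{1..m+1}. \<exists>v\<in>D i. proj j (\<phi> v) \<noteq> 0"
    proof (rule ccontr)
      assume *: "\<not> ?thesis"
      have "\<phi> v = 0" for v
      proof -
        have "\<phi> v = (\<Sum>(i, j)\<in>{1..m+1} \<times> {1..m+1}. proj j (\<phi> (proj i v)))"
          using fun_cong[OF block_decomposition[OF lin]] .
        also have "\<dots> = 0"
        proof (intro sum.neutral ballI)
          fix p assume "p \<in> {1..m+1} \<times> {1..m+1}"
          then obtain i j where ij: "p = (i, j)" "i \<in> {1..m+1}" "j \<in> {1..m+1}" by blast
          then have "proj j (\<phi> (proj i v)) = 0" using * proj_mem[OF ij(2)] by blast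
          then show "(case p of (i, j) \<Rightarrow> proj j (\<phi> (proj i v))) = 0" by (simp add: ij(1))
        qed
        finally show ?thesis .
      qed
      then show False using \<open>\<phi> \<noteq> (\<lambda>_. 0)\<close> by auto
    qed
    then show ?thesis unfolding S_def by blast
  qed (simp add: S_def)
  show "Min S < 0" if not_inv: "\<not> (\<forall>j\<in>{1..m+1}. \<phi> ` W j \<subseteq> W j)"
  proof -
    obtain i j v where ij: "i \<in> {1..m+1}" "j \<in> {1..m+1}" "i < j" "v \<in> D i" "proj j (\<phi> v) \<noteq> 0"
      using not_inv unfolding invariant_iff_blocks[OF lin] by blast
    then have "\<gamma> i - \<gamma> j \<in> S" unfolding S_def by blast
    then have "Min S \<le> \<gamma> i - \<gamma> j" by (rule Min_le[OF fin])
    then show ?thesis using \<gamma>[OF ij(1-3)] by simp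
  qed
  show "0 \<le> Min S" if inv: "\<forall>j\<in>{1..m+1}. \<phi> ` W j \<subseteq> W j"
  proof (rule Min.boundedI[OF fin S])
    fix y assume "y \<in> S"
    then consider "y = 0" | i j v where "y = \<gamma> i - \<gamma> j" "i \<in> {1..m+1}" "j \<in> {1..m+1}" "v \<in> D i" "proj j (\<phi> v) \<noteq> 0"
      unfolding S_def by (auto split: if_splits)
    then show "0 \<le> y"
    proof cases
      case 2
      then have "j \<le> i" using inv unfolding invariant_iff_blocks[OF lin] by (meson not_le)
      then show ?thesis using 2 \<gamma>[of j i] by (cases "i = j") auto
    qed simp
  qed
  show "c2 = 0 \<and> ((\<forall>j\<in>{1..m+1}. \<phi> ` W j \<subseteq> W j) \<longrightarrow> nilpotent_hom \<phi>)" if pos: "0 < Min S"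
  proof -
    have "0 \<notin> S" using Min_le[OF fin, of 0] pos by auto
    then have c2: "c2 = 0" by (auto simp: S_def split: if_splits)
    have diag: "proj i (\<phi> v) = 0" if "i \<in> {1..m+1}" "v \<in> D i" for i v
    proof (rule ccontr)
      assume "proj i (\<phi> v) \<noteq> 0"
      then have "\<gamma> i - \<gamma> i \<in> S" unfolding S_def using that by blast
      then show False using \<open>0 \<notin> S\<close> by simp
    qed
    have "nilpotent_hom \<phi>" if inv: "\<forall>j\<in>{1..m+1}. \<phi> ` W j \<subseteq> W j"
    proof (rule nilpotent_of_blocks[OF lin])
      fix i j v assume ij: "i \<in> {1..m+1}" "j \<in> {1..m+1}" "i \<le> j" "v \<in> D i"
      show "proj j (\<phi> v) = 0"
      proof (cases "i = j")
        case True
        then show ?thesis using diag ij by blast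
      next
        case False
        then show ?thesis using inv ij unfolding invariant_iff_blocks[OF lin] by (meson le_neq_implies_less)
      qed
    qed
    then show ?thesis using c2 by blast
  qed
  show "0 < Min S" if c2: "c2 = 0"
    and blocks: "\<And>i j v. i \<in> {1..m+1} \<Longrightarrow> j \<in> {1..m+1} \<Longrightarrow> i \<le> j \<Longrightarrow> v \<in> D i \<Longrightarrow> proj j (\<phi> v) = 0"
  proof -
    have "0 < y" if y: "y \<in> S" for y
    proof -
      obtain i j v where 2: "y = \<gamma> i - \<gamma> j" "i \<in> {1..m+1}" "j \<in> {1..m+1}" "v \<in> D i" "proj j (\<phi> v) \<noteq> 0"
        using y c2 unfolding S_def by auto
      then have "j < i" using blocks by (meson not_le)
      then show ?thesis using 2 \<gamma>[of j i] by simp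
    qed
    then show ?thesis using Min_in[OF fin S] by blast
  qed
qed

end

section \<open>The flag generator as a nonzero linear functional\<close>

lemma sigma_space_add:
  assumes "S \<in> sigma_space sw k rs n" "T \<in> sigma_space sw k rs n"
  shows "(\<lambda>u. S u + T u) \<in> sigma_space sw k rs n"
proof -
  have "Vector_Spaces.linear sw (*) (\<lambda>w. S (u(j := w)) + T (u(j := w)))" if "j \<in> positions k rs n" for u j
    using sigma_space_linear[OF assms(1) that, of u] sigma_space_linear[OF assms(2) that, of u]
    by (simp add: Vector_Spaces.linear_iff distrib_left)
  moreover have "S u + T u = S u' + T u'" if "\<forall>j\<in>positions k rs n. u j = u' j" for u u'
    using sigma_space_cong[OF assms(1), of u u'] sigma_space_cong[OF assms(2), of u u'] that by simp
  moreover have "S u + T u = 0"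
    if "(i, c, p) \<in> positions k rs n" "(i, c, q) \<in> positions k rs n" "p \<noteq> q" "u (i, c, p) = u (i, c, q)" for u i c p q
    using sigma_space_alternating[OF assms(1) that] sigma_space_alternating[OF assms(2) that] by simp
  ultimately show ?thesis unfolding sigma_space_def by blast
qed

lemma sigma_space_smul:
  assumes "T \<in> sigma_space sw k rs n"
  shows "sigma_smul c T \<in> sigma_space sw k rs n"
proof -
  have "Vector_Spaces.linear sw (*) (\<lambda>w. c * T (u(j := w)))" if "j \<in> positions k rs n" for u j
    using sigma_space_linear[OF assms that, of u]
    by (simp add: Vector_Spaces.linear_iff distrib_left)
  moreover have "c * T u = c * T u'" if "\<forall>j\<in>positions k rs n. u j = u' j" for u u'
    using sigma_space_cong[OF assms, of u u'] that by simp
  moreover have "c * T u = 0"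
    if "(i, a, p) \<in> positions k rs n" "(i, a, q) \<in> positions k rs n" "p \<noteq> q" "u (i, a, p) = u (i, a, q)" for u i a p q
    using sigma_space_alternating[OF assms that] by simp
  ultimately show ?thesis unfolding sigma_space_def sigma_smul_def by blast
qed

text \<open>The value of \<open>s\<close> is prescribed on the form space only, so linearity rests
  on its closure under sums and multiples. Nonvanishing is tested on minors of forms dual to the
  bases \<open>b i\<close>.\<close>

lemma flag_generator_functional:
  assumes "vector_space sw" "flag_generator sw k rs n V s"
  shows "sigma_functional sw k rs n s" "\<exists>T\<in>sigma_space sw k rs n. s T \<noteq> 0"
proof -
  interpret vector_space sw by fact
  obtain b c where "c \<noteq> 0"
    and b: "\<And>i. i \<in> {1..k} \<Longrightarrow> inj_on (b i) {..<rs i} \<and> independent (b i ` {..<rs i}) \<and> span (b i ` {..<rs i}) = V i"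
    and s: "\<And>T. T \<in> sigma_space sw k rs n \<Longrightarrow> s T = c * T (\<lambda>(i, _, p). b i p)"
    using assms(2) unfolding flag_generator_def by blast
  show "sigma_functional sw k rs n s"
    unfolding sigma_functional_def
  proof (intro conjI ballI allI)
    show "s (\<lambda>u. S u + T u) = s S + s T" if "S \<in> sigma_space sw k rs n" "T \<in> sigma_space sw k rs n" for S T
      using s[OF sigma_space_add[OF that]] s[OF that(1)] s[OF that(2)] by (simp add: distrib_left)
    show "s (sigma_smul a T) = a * s T" if "T \<in> sigma_space sw k rs n" for a T
      using s[OF sigma_space_smul[OF that, of a]] s[OF that] by (simp add: sigma_smul_def)
  qed
  have "\<exists>g. Vector_Spaces.linear sw (*) g \<and> (\<forall>q<rs i. g (b i q) = (if q = p then 1 else 0))"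
    if i: "i \<in> {1..k}" "p < rs i" for i p
  proof -
    obtain g where g: "Vector_Spaces.linear sw (*) g" "\<And>x. x \<in> b i ` {..<rs i} \<Longrightarrow> g x = (if x = b i p then 1 else 0)"
      using linear_form_extend[of "b i ` {..<rs i}" "\<lambda>x. if x = b i p then 1 else 0"] b[OF i(1)] by metis
    have "g (b i q) = (if q = p then 1 else 0)" if "q < rs i" for q
      using g(2)[of "b i q"] that i(2) b[OF i(1)] by (auto simp: inj_on_eq_iff)
    then show ?thesis using g(1) by blast
  qed
  then obtain f where f: "\<And>i p. i \<in> {1..k} \<Longrightarrow> p < rs i \<Longrightarrow> Vector_Spaces.linear sw (*) (f i p)"
    "\<And>i p q. i \<in> {1..k} \<Longrightarrow> p < rs i \<Longrightarrow> q < rs i \<Longrightarrow> f i p (b i q) = (if q = p then 1 else 0)"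
    by metis
  have "minor (rs i) (f i) (b i) \<noteq> 0" if i: "i \<in> {1..k}" for i
  proof (rule minor_nonzero)
    fix v assume v: "v \<in> span (b i ` {..<rs i})" "\<And>p. p < rs i \<Longrightarrow> f i p v = 0"
    obtain a where a: "v = (\<Sum>q<rs i. sw (a q) (b i q))" using v(1) unfolding span_family by blast
    have "a p = 0" if p: "p < rs i" for p
    proof -
      interpret g: Vector_Spaces.linear sw "(*)" "f i p" by (rule f(1)[OF i p])
      have "f i p v = (\<Sum>q<rs i. a q * f i p (b i q))" unfolding a by (simp only: g.sum g.scale)
      also have "\<dots> = (\<Sum>q<rs i. if q = p then a p else 0)"
        by (intro sum.cong refl) (simp add: f(2)[OF i p])
      also have "\<dots> = a p" using p by simp
      finally show ?thesis using v(2)[OF p] by simp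
    qed
    then show "v = 0" unfolding a by simp
  qed (use f(1)[OF i] b[OF i] in blast)+
  then have "minor_tensor k rs n f (\<lambda>(i, _, p). b i p) \<noteq> 0" by (rule minor_tensor_nonzero)
  moreover have "minor_tensor k rs n f \<in> sigma_space sw k rs n"
    using f(1) by (intro minor_tensor_mem vector_space_axioms)
  ultimately show "\<exists>T\<in>sigma_space sw k rs n. s T \<noteq> 0" using s \<open>c \<noteq> 0\<close> by (metis mult_eq_0_iff)
qed

lemma common_denominator_props:
  "0 < common_denominator k \<beta>" "i \<in> {1..k} \<Longrightarrow> of_nat (common_denominator k \<beta>) * \<beta> i \<in> \<int>"
proof -
  obtain q :: nat where "0 < q \<and> (\<forall>i\<in>{1..k}. of_nat q * \<beta> i \<in> \<int>)"
    using common_denominator_exists[of "\<beta> ` {1..k}"] by auto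
  from LeastI[of "\<lambda>q. 0 < q \<and> (\<forall>i\<in>{1..k}. of_nat q * \<beta> i \<in> \<int>)", OF this]
  show "0 < common_denominator k \<beta>" "i \<in> {1..k} \<Longrightarrow> of_nat (common_denominator k \<beta>) * \<beta> i \<in> \<int>"
    unfolding common_denominator_def by blast+
qed

text \<open>The common denominator makes the floor exact, and positivity makes the passage to
  natural numbers faithful.\<close>

lemma of_nat_exponent:
  assumes "i \<in> {1..k}" "0 < \<beta> i"
  shows "of_nat (exponent k \<beta> i) = of_nat (common_denominator k \<beta>) * \<beta> i"
proof -
  obtain N :: int where N: "of_nat (common_denominator k \<beta>) * \<beta> i = of_int N"
    using common_denominator_props(2)[OF assms(1)] by (rule Ints_cases)
  have "0 \<le> (of_int N :: rat)" using assms(2) by (simp flip: N)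
  then have "0 \<le> N" by simp
  then show ?thesis by (simp add: exponent_def N)
qed

section \<open>Hitchin pairs and weighted flags\<close>

text \<open>\<open>A\<close> is the target line bundle of the swamp, kept abstract until the theorem
  puts a power of the degree one bundle in its place.\<close>

locale hitchin_pair = curve_space emb X sc
  for emb :: "complex \<Rightarrow> 'k::field" and X :: "'k set set"
    and sc :: "'k \<Rightarrow> 'v::ab_group_add \<Rightarrow> 'v" +
  fixes x0 :: "'k set" and A L :: "('k, 'k) subsheaf" and r k :: nat and d :: int
    and rs :: "nat \<Rightarrow> nat" and \<beta> :: "nat \<Rightarrow> rat" and \<iota>1 \<iota>2 :: "'k \<Rightarrow> 'k"
    and sw :: "complex \<Rightarrow> 'w::ab_group_add \<Rightarrow> 'w"
    and E :: "('k, 'v) subsheaf" and \<phi> :: "'v \<Rightarrow> 'v" and \<epsilon> :: complex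
    and ev :: "'v \<Rightarrow> 'w" and V :: "nat \<Rightarrow> 'w set" and s :: "'w form \<Rightarrow> complex"
  assumes x0: "x0 \<in> X"
    and A: "line_bundle X A" and L: "line_bundle X L"
    and weights: "\<forall>i\<in>{1..k}. 0 < \<beta> i"
    and \<iota>1: "bundle_hom X (*) L (*) A \<iota>1" "inj \<iota>1"
    and \<iota>2: "bundle_hom X (*) structure_sheaf (*) A \<iota>2" "inj \<iota>2"
    and sw: "vector_space sw"
    and fiber: "fiber_map emb X sc E x0 sw ev"
    and pair: "parabolic_Hitchin_pair X L sc r d x0 sw ev k rs E \<phi> \<epsilon> V"
    and generator: "flag_generator sw k rs (exponent k \<beta>) V s"
begin

abbreviation "\<Phi> \<equiv> associated_hom emb \<iota>1 \<iota>2 \<phi> \<epsilon>"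
abbreviation "n \<equiv> exponent k \<beta>"
abbreviation "z \<equiv> common_denominator k \<beta>"

lemma vector_bundle_E: "vector_bundle X sc r E" and generic_E: "generic_fiber X E = UNIV"
  and \<phi>_hom: "bundle_hom X sc E sc (twist X sc L E) \<phi>" and \<phi>_\<epsilon>: "\<phi> \<noteq> (\<lambda>_. 0) \<or> \<epsilon> \<noteq> 0"
  and V: "\<And>i. i \<in> {1..k} \<Longrightarrow> vector_space.dim sw (V i) = rs i"
  using pair by (simp_all add: parabolic_Hitchin_pair_def)

lemma sheaf_E: "is_sheaf X sc E"
  using vector_bundle_E by (simp add: vector_bundle_def)

lemma rank_E: "bundle_rank X sc E = r"
  by (rule bundle_rank_eq[OF vector_bundle_E])

lemma linear_\<phi>: "Vector_Spaces.linear sc sc \<phi>"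
  using \<phi>_hom by (simp add: bundle_hom_def)

lemma linear_\<iota>: "Vector_Spaces.linear (*) (*) \<iota>1" "Vector_Spaces.linear (*) (*) \<iota>2"
  using \<iota>1 \<iota>2 by (simp_all add: bundle_hom_def)

lemma \<Phi>_eq: "\<Phi> x = \<iota>1 1 * fst x \<phi> + emb \<epsilon> * \<iota>2 1 * snd x"
  by (rule associated_hom_eq[OF linear_\<iota>])

lemma \<Phi>_coeffs: "\<iota>1 1 \<noteq> 0" "emb \<epsilon> * \<iota>2 1 = 0 \<longleftrightarrow> \<epsilon> = 0"
  using linear_mult_nonzero[OF linear_\<iota>(1) \<iota>1(2)] linear_mult_nonzero[OF linear_\<iota>(2) \<iota>2(2)]
  by (simp_all add: emb_eq_0_iff)

lemma \<phi>_local: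
  assumes "local_generator X L U g" "U' \<in> nonempty_opens X" "U' \<subseteq> U" "v \<in> E U'"
  shows "\<exists>u\<in>E U'. \<phi> v = sc g u"
proof -
  have "\<phi> ` E U' \<subseteq> twist X sc L E U'" using \<phi>_hom assms(2) by (simp add: bundle_hom_def)
  then show ?thesis
    using assms(4) unfolding twist_eq[OF sheaf_E assms(1-3)] by blast
qed

text \<open>Where \<open>g\<close> generates \<open>L\<close>, dividing \<phi> by \<open>g\<close>
  gives an endomorphism of \<open>E\<close>, on which \<xi> takes a regular value; multiplying back
  by \<open>g\<close> lands in \<open>L\<close>. This makes the trace pairing with \<phi> a
  homomorphism of sheaves.\<close>

lemma pairing_\<phi>_mem:
  assumes U: "U \<in> nonempty_opens X" and \<xi>: "\<xi> \<in> end_dual sc"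
    and reg: "\<And>U' f. U' \<in> nonempty_opens X \<Longrightarrow> U' \<subseteq> U \<Longrightarrow> f \<in> end_sheaf X sc E U' \<Longrightarrow> \<xi> f \<in> structure_sheaf U'"
  shows "\<xi> \<phi> \<in> L U"
proof (rule sheaf_glue[OF line_bundle_sheaf[OF L] U])
  fix x assume "x \<in> U"
  then obtain U' g where U': "U' \<in> nonempty_opens X" "x \<in> U'" "U' \<subseteq> U" "local_generator X L U' g"
    by (rule line_bundle_generator[OF L U])
  then have nz: "g \<noteq> 0" by (simp add: local_generator_def)
  let ?f = "\<lambda>v. sc (inverse g) (\<phi> v)"
  have "?f v \<in> E V" if V: "V \<in> nonempty_opens X" "V \<subseteq> U'" "v \<in> E V" for V v
    using \<phi>_local[OF U'(4) V] nz by auto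
  then have "?f \<in> end_sheaf X sc E U'"
    using linear_scale_fun[OF linear_\<phi>] by (auto simp: end_sheaf_def)
  then have "\<xi> ?f \<in> structure_sheaf U'" by (rule reg[OF U'(1,3)])
  moreover have "\<xi> ?f = inverse g * \<xi> \<phi>"
    using \<xi> linear_\<phi> unfolding end_dual_def by blast
  moreover have "\<xi> \<phi> = inverse g * \<xi> \<phi> * g" using nz by simp
  ultimately have "\<xi> \<phi> \<in> L U'"
    unfolding local_generator_sections[OF U'(4,1) order_refl] by (metis rev_image_eqI)
  then show "\<exists>U'\<in>nonempty_opens X. x \<in> U' \<and> U' \<subseteq> U \<and> \<xi> \<phi> \<in> L U'"
    using U'(1-3) by (intro bexI[of _ U']) simp_all
qed

lemma rho_hom_\<Phi>: "rho_hom X sc E A \<Phi>"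
  unfolding rho_hom_def
proof (intro conjI ballI allI)
  show "\<Phi> (rho_add x y) = \<Phi> x + \<Phi> y" for x y
    unfolding \<Phi>_eq by (simp add: rho_add_def distrib_left)
  show "\<Phi> (rho_smul c x) = c * \<Phi> x" for c x
    unfolding \<Phi>_eq by (simp add: rho_smul_def distrib_left mult.left_commute)
  fix U assume U: "U \<in> nonempty_opens X"
  show "\<Phi> ` rho_bundle X sc E U \<subseteq> A U"
  proof (rule image_subsetI)
    fix x assume "x \<in> rho_bundle X sc E U"
    then obtain \<xi> c where x: "x = (\<xi>, c)" "\<xi> \<in> end_dual sc" "c \<in> structure_sheaf U"
      "\<And>U' f. U' \<in> nonempty_opens X \<Longrightarrow> U' \<subseteq> U \<Longrightarrow> f \<in> end_sheaf X sc E U' \<Longrightarrow> \<xi> f \<in> structure_sheaf U'"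
      by (auto simp: rho_bundle_def)
    have "\<iota>1 (\<xi> \<phi>) \<in> A U"
      using pairing_\<phi>_mem[OF U x(2,4)] \<iota>1(1) U unfolding bundle_hom_def by blast
    moreover have "\<iota>2 c \<in> A U" using x(3) \<iota>2(1) U unfolding bundle_hom_def by blast
    then have "emb \<epsilon> * \<iota>2 c \<in> A U"
      by (rule sheaf_scale[OF line_bundle_sheaf[OF A] U structure_sheaf_ring(3)[OF U]])
    ultimately have "\<iota>1 (\<xi> \<phi>) + emb \<epsilon> * \<iota>2 c \<in> A U"
      by (rule sheaf_add[OF line_bundle_sheaf[OF A] U])
    then show "\<Phi> x \<in> A U" by (simp add: x(1) associated_hom_def)
  qed
qed

lemma \<Phi>_nonzero: "\<exists>x\<in>end_dual sc \<times> UNIV. \<Phi> x \<noteq> 0"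
proof (cases "\<epsilon> = 0")
  case True
  then obtain v where v: "\<phi> v \<noteq> 0" using \<phi>_\<epsilon> by auto
  then have "independent {\<phi> v}" by simp
  then obtain lam where lam: "Vector_Spaces.linear sc (*) lam" "lam (\<phi> v) = 1"
    using linear_form_extend[of "{\<phi> v}" "\<lambda>_. 1"] by (metis singletonI)
  have "\<Phi> (elementary_tensor sc lam v, 0) \<noteq> 0"
    unfolding \<Phi>_eq using \<Phi>_coeffs(1) lam(2) linear_\<phi> by (simp add: elementary_tensor_def)
  then show ?thesis using elementary_tensor_mem_end_dual[OF lam(1)] by blast
next
  case False
  have "(\<lambda>_. 0) \<in> end_dual sc" by (simp add: end_dual_def)
  moreover have "\<Phi> (\<lambda>_. 0, 1) \<noteq> 0" unfolding \<Phi>_eq using \<Phi>_coeffs(2) False by simp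
  ultimately show ?thesis by blast
qed

lemma decorated_swamp: "decorated_swamp X sc r sw k rs n E A \<Phi> s"
  unfolding decorated_swamp_def
  using vector_bundle_E generic_E A rho_hom_\<Phi> \<Phi>_nonzero flag_generator_functional[OF sw generator] by blast

lemma subbundle_sheaf: "subbundle X sc F E \<Longrightarrow> is_sheaf X sc F"
  and subbundle_subsheaf: "subbundle X sc F E \<Longrightarrow> subsheaf_of X F E"
  by (simp_all add: subbundle_def)

text \<open>In rank zero the generic fiber vanishes, and all sections lie in it.\<close>

lemma rank_pos:
  assumes F: "subbundle X sc F E" "strict_subsheaf_of X zero_sheaf F"
  shows "0 < bundle_rank X sc F" "0 < r"
proof -
  obtain t q where "t \<le> q" and frames: "\<forall>x\<in>X. \<exists>U\<in>nonempty_opens X. x \<in> U \<and>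
      (\<exists>e. frame_on X sc E U q e \<and> frame_on X sc F U t e)"
    using F(1) unfolding subbundle_def by blast
  then obtain U e where U: "U \<in> nonempty_opens X" "frame_on X sc E U q e" "frame_on X sc F U t e"
    using generic_point_mem by blast
  have rank: "bundle_rank X sc F = t"
    by (rule bundle_rank_frame[OF subbundle_sheaf[OF F(1)] U(1,3)])
  have "r = q" using bundle_rank_frame[OF sheaf_E U(1,2)] rank_E by simp
  have "t \<noteq> 0"
  proof
    assume "t = 0"
    then have "generic_fiber X F = {0}"
      using generic_fiber_frame[OF subbundle_sheaf[OF F(1)] U(1,3)] by simp
    then have sub: "F U' \<subseteq> {0}" if "U' \<in> nonempty_opens X" for U'
      using open_subset_generic_fiber[OF that, of F] by simp
    moreover have "\<exists>U'\<in>nonempty_opens X. {0} \<noteq> F U' \<and> {0} \<subseteq> F U'"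
      using F(2) unfolding strict_subsheaf_of_def subsheaf_of_def zero_sheaf_def by blast
    ultimately show False by blast
  qed
  then show "0 < bundle_rank X sc F" "0 < r" using rank \<open>t \<le> q\<close> \<open>r = q\<close> by simp_all
qed

text \<open>Twisting is invisible at the generic point: sections of \<open>L\<close> act as rational
  scalars, which preserve the generic fiber of \<open>F\<close>.\<close>

lemma generic_fiber_invariant:
  assumes F: "invariant_subbundle X L sc E \<phi> F"
  shows "\<phi> ` generic_fiber X F \<subseteq> generic_fiber X F"
proof (rule image_subsetI)
  have sub: "subspace (generic_fiber X F)"
    using F subbundle_sheaf by (intro subspace_generic_fiber vector_space_axioms) (simp add: invariant_subbundle_def)
  fix v assume "v \<in> generic_fiber X F"
  then obtain U where U: "U \<in> nonempty_opens X" "v \<in> F U"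
    by (auto simp: generic_fiber_def stalk_def)
  then have "\<phi> v \<in> twist X sc L F U" using F by (auto simp: invariant_subbundle_def)
  then obtain U' where U': "U' \<in> nonempty_opens X"
      "\<phi> v \<in> additive_span {sc f u | f u. f \<in> L U' \<and> u \<in> F U'}"
    using generic_mem_open[OF U(1)] unfolding twist_def by blast
  have "additive_span {sc f u | f u. f \<in> L U' \<and> u \<in> F U'} \<subseteq> generic_fiber X F"
  proof (rule additive_span_subset)
    show "{sc f u | f u. f \<in> L U' \<and> u \<in> F U'} \<subseteq> generic_fiber X F"
      using open_subset_generic_fiber[OF U'(1), of F] subspace_scale[OF sub] by auto
  qed (use subspace_0[OF sub] subspace_add[OF sub] in auto)
  then show "\<phi> v \<in> generic_fiber X F" using U'(2) by blast
qed

text \<open>Locally \<open>\<phi> v\<close> is a generator of \<open>L\<close> times a section of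
  \<open>E\<close>. That section lies in the generic fiber of \<open>F\<close>, hence in
  \<open>F\<close> because subbundles are saturated. Invariance can thus be tested at the generic
  point.\<close>

lemma invariant_subbundleI:
  assumes F: "subbundle X sc F E" and inv: "\<phi> ` generic_fiber X F \<subseteq> generic_fiber X F"
  shows "invariant_subbundle X L sc E \<phi> F"
  unfolding invariant_subbundle_def
proof (intro conjI F ballI image_subsetI)
  have sub: "subspace (generic_fiber X F)"
    by (rule subspace_generic_fiber[OF vector_space_axioms subbundle_sheaf[OF F]])
  fix U v assume U: "U \<in> nonempty_opens X" and v: "v \<in> F U"
  show "\<phi> v \<in> twist X sc L F U"
  proof (rule sheaf_glue[OF twist_is_sheaf[OF line_bundle_sheaf[OF L] subbundle_sheaf[OF F]] U])
    fix x assume "x \<in> U"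
    then obtain U' g where U': "U' \<in> nonempty_opens X" "x \<in> U'" "U' \<subseteq> U" "local_generator X L U' g"
      by (rule line_bundle_generator[OF L U])
    then have nz: "g \<noteq> 0" by (simp add: local_generator_def)
    have v': "v \<in> F U'" using sheaf_restrict[OF subbundle_sheaf[OF F] U U'(1,3)] v by blast
    then have "v \<in> E U'" using subbundle_subsheaf[OF F] U'(1) by (auto simp: subsheaf_of_def)
    then obtain u where u: "u \<in> E U'" "\<phi> v = sc g u"
      using \<phi>_local[OF U'(4,1) order_refl] by blast
    have "v \<in> generic_fiber X F" using open_subset_generic_fiber[OF U'(1), of F] v' by blast
    then have "sc (inverse g) (\<phi> v) \<in> generic_fiber X F" using inv subspace_scale[OF sub] by blast
    then have "u \<in> generic_fiber X F" using u(2) nz by simp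
    then have "u \<in> F U'" by (rule subbundle_saturated[OF F sheaf_E U'(1) u(1)])
    then have "\<phi> v \<in> twist X sc L F U'"
      unfolding twist_eq[OF subbundle_sheaf[OF F] U'(4,1) order_refl] u(2) by blast
    then show "\<exists>U'\<in>nonempty_opens X. x \<in> U' \<and> U' \<subseteq> U \<and> \<phi> v \<in> twist X sc L F U'"
      using U'(1-3) by (intro bexI[of _ U']) simp_all
  qed
qed

lemma subspace_sub_fiber:
  assumes F: "subbundle X sc F E"
  shows "module.subspace sw (sub_fiber X x0 ev F)"
proof -
  interpret w: vector_space sw by (rule sw)
  have stalk: "u \<in> stalk X E x0" if "u \<in> stalk X F x0" for u
    using stalk_mono[OF subbundle_subsheaf[OF F]] that by blast
  have add: "ev (u + v) = ev u + ev v" if "u \<in> stalk X F x0" "v \<in> stalk X F x0" for u v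
    using fiber stalk[OF that(1)] stalk[OF that(2)] by (simp add: fiber_map_def)
  have scale: "ev (sc (emb c) u) = sw c (ev u)" if "u \<in> stalk X F x0" for c u
    using fiber stalk[OF that] by (simp add: fiber_map_def)
  have 0: "0 \<in> stalk X F x0" by (rule stalk_0[OF subbundle_sheaf[OF F] x0])
  have "ev 0 = 0" using scale[OF 0, of 0] by (simp add: emb_0)
  then have "0 \<in> ev ` stalk X F x0" using 0 by (metis image_eqI)
  moreover have "u + v \<in> ev ` stalk X F x0" if "u \<in> ev ` stalk X F x0" "v \<in> ev ` stalk X F x0" for u v
    using that add stalk_add[OF subbundle_sheaf[OF F]] by (auto simp: image_iff) metis
  moreover have "sw c u \<in> ev ` stalk X F x0" if "u \<in> ev ` stalk X F x0" for c u
    using that scale stalk_scale[OF subbundle_sheaf[OF F] emb_mem[OF x0, of c]] by (auto simp: image_iff) metis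
  ultimately show ?thesis by (simp add: w.subspace_def sub_fiber_def)
qed

lemma sub_fiber_mono: "subsheaf_of X F G \<Longrightarrow> sub_fiber X x0 ev F \<subseteq> sub_fiber X x0 ev G"
  unfolding sub_fiber_def by (intro image_mono stalk_mono)

lemma sub_fiber_E: "sub_fiber X x0 ev E = UNIV"
  using fiber by (simp add: sub_fiber_def fiber_map_def)

abbreviation "pd \<equiv> pardeg X sc x0 sw ev k \<beta> V"
abbreviation "rk \<equiv> bundle_rank X sc"

lemma pardeg_E: "pd E = of_int (bundle_degree X sc E) + (\<Sum>i=1..k. \<beta> i * of_nat (rs i))"
  unfolding pardeg_def sub_fiber_E by (simp add: V)

section \<open>The weights of a weighted flag\<close>

context
  fixes m :: nat and Es :: "nat \<Rightarrow> ('k, 'v) subsheaf" and \<alpha> :: "nat \<Rightarrow> rat"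
  assumes flag: "weighted_flag X sc E m Es \<alpha>"
begin

lemma m_pos: "1 \<le> m" and \<alpha>_pos: "j \<in> {1..m} \<Longrightarrow> 0 < \<alpha> j"
  and Es_subbundle: "j \<in> {0..m+1} \<Longrightarrow> subbundle X sc (Es j) E"
  and Es_strict: "j \<le> m \<Longrightarrow> strict_subsheaf_of X (Es j) (Es (j + 1))"
  and Es_0: "U \<in> nonempty_opens X \<Longrightarrow> Es 0 U = {0}"
  and Es_top: "U \<in> nonempty_opens X \<Longrightarrow> Es (m + 1) U = E U"
  using flag by (simp_all add: weighted_flag_def zero_sheaf_def)

lemma Es_sub: "j \<le> m \<Longrightarrow> subsheaf_of X (Es j) (Es (j + 1))"
  using Es_strict by (simp add: strict_subsheaf_of_def)

text \<open>The last step of the flag agrees with \<open>E\<close> on nonempty open sets only, so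
  the two are compared through their stalks.\<close>

lemma stalk_Es_top: "stalk X (Es (m + 1)) x = stalk X E x"
  unfolding stalk_def using Es_top by (intro arg_cong[where f = Union]) blast

lemma Es_mono: "i \<le> j \<Longrightarrow> j \<le> m + 1 \<Longrightarrow> subsheaf_of X (Es i) (Es j)"
proof (induction j)
  case (Suc j)
  show ?case
  proof (cases "i = Suc j")
    case False
    then have "subsheaf_of X (Es i) (Es j)" using Suc by simp
    moreover have "subsheaf_of X (Es j) (Es (Suc j))" using Es_sub[of j] Suc.prems by simp
    ultimately show ?thesis by (auto simp: subsheaf_of_def)
  qed (simp add: subsheaf_of_def)
qed (simp add: subsheaf_of_def)

lemma Es_proper:
  assumes j: "j \<in> {1..m}"
  shows "strict_subsheaf_of X zero_sheaf (Es j)" "strict_subsheaf_of X (Es j) E"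
proof -
  obtain U where U: "U \<in> nonempty_opens X" "Es 0 U \<noteq> Es 1 U"
    using Es_strict[of 0] by (auto simp: strict_subsheaf_of_def)
  have zero: "subsheaf_of X (Es 0) (Es j)" "subsheaf_of X (Es 0) (Es 1)" "subsheaf_of X (Es 1) (Es j)"
    using Es_mono[of 0 j] Es_mono[of 0 1] Es_mono[of 1 j] j by auto
  then have "Es 0 U \<noteq> Es j U" using U unfolding subsheaf_of_def by blast
  then show "strict_subsheaf_of X zero_sheaf (Es j)"
    using zero(1) U(1) Es_0 by (auto simp: strict_subsheaf_of_def subsheaf_of_def zero_sheaf_def)
  obtain U where U: "U \<in> nonempty_opens X" "Es j U \<noteq> Es (j + 1) U"
    using Es_strict[of j] j by (auto simp: strict_subsheaf_of_def)
  have "subsheaf_of X (Es j) (Es (j + 1))" "subsheaf_of X (Es (j + 1)) (Es (m + 1))" "subsheaf_of X (Es j) (Es (m + 1))"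
    using Es_mono[of j "j + 1"] Es_mono[of "j + 1" "m + 1"] Es_mono[of j "m + 1"] j by auto
  then have sub: "subsheaf_of X (Es j) E" and "Es j U \<noteq> E U"
    using U Es_top unfolding subsheaf_of_def by blast+
  then show "strict_subsheaf_of X (Es j) E"
    using U(1) by (auto simp: strict_subsheaf_of_def)
qed

lemma r_pos: "0 < r"
  using rank_pos(2)[OF Es_subbundle Es_proper(1), of 1] m_pos by simp

abbreviation "\<gamma> \<equiv> flag_gamma X sc r m Es \<alpha>"

lemma \<gamma>_step: "j \<in> {1..m} \<Longrightarrow> \<gamma> (j + 1) - \<gamma> j = of_nat r * \<alpha> j"
  by (simp add: flag_gamma_def sum.atLeast_Suc_atMost[of j m] right_diff_distrib[symmetric])

lemma \<gamma>_top: "\<gamma> (m + 1) = (\<Sum>j=1..m. \<alpha> j * of_nat (rk (Es j)))"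
  by (simp add: flag_gamma_def)

lemma \<gamma>_strict_mono:
  assumes "i \<in> {1..m+1}" "j \<in> {1..m+1}" "i < j"
  shows "\<gamma> i < \<gamma> j"
proof -
  have "0 < (\<Sum>a=i..<j. \<gamma> (Suc a) - \<gamma> a)"
  proof (rule sum_pos)
    fix a assume "a \<in> {i..<j}"
    then have "a \<in> {1..m}" using assms by auto
    then show "0 < \<gamma> (Suc a) - \<gamma> a" using \<gamma>_step[of a] \<alpha>_pos[of a] r_pos by simp
  qed (use assms(3) in auto)
  then show ?thesis using assms(3) by (simp add: sum_Suc_diff')
qed

abbreviation "gf j \<equiv> generic_fiber X (Es j)"
abbreviation "sf j \<equiv> sub_fiber X x0 ev (Es j)"

lemma gf_top: "gf (m + 1) = UNIV"
  using stalk_Es_top[of UNIV] generic_E by (simp add: generic_fiber_def)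

lemma split_space_generic: "split_space sc m gf (SOME D. splitting sc m gf D)"
proof -
  have "\<exists>D. splitting sc m gf D"
  proof (rule splitting_exists)
    show "subspace (gf j)" if "j \<in> {1..m+1}" for j
      using that by (intro subspace_generic_fiber vector_space_axioms subbundle_sheaf Es_subbundle) simp
    show "gf j \<subseteq> gf (j + 1)" if "j \<in> {1..m}" for j
      unfolding generic_fiber_def using that by (intro stalk_mono Es_sub) simp
  qed
  from someI_ex[OF this] show ?thesis
    by (intro split_space.intro split_space_axioms.intro vector_space_axioms gf_top)
qed

lemma split_space_special: "split_space sw m sf (SOME D. splitting sw m sf D)"
proof -
  have "\<exists>D. splitting sw m sf D"
  proof (rule vector_space.splitting_exists[OF sw])
    show "module.subspace sw (sf j)" if "j \<in> {1..m+1}" for j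
      using that by (intro subspace_sub_fiber Es_subbundle) simp
    show "sf j \<subseteq> sf (j + 1)" if "j \<in> {1..m}" for j
      using that by (intro sub_fiber_mono Es_sub) simp
  qed
  moreover have "sf (m + 1) = UNIV"
    using sub_fiber_E stalk_Es_top[of x0] by (simp add: sub_fiber_def)
  ultimately show ?thesis
    by (intro split_space.intro split_space_axioms.intro sw someI_ex[of "splitting sw m sf"])
qed

text \<open>The block conditions for the chosen splitting are translated into conditions on the
  filtration, independent of the splitting. The third case is the one met by the kernels of the
  powers of a nilpotent \<phi>.\<close>

lemma mu1_signs:
  shows "\<not> (\<forall>j\<in>{1..m+1}. \<phi> ` gf j \<subseteq> gf j) \<Longrightarrow> 0 < mu1 X sc r m Es \<alpha> \<Phi>"
    and "\<forall>j\<in>{1..m+1}. \<phi> ` gf j \<subseteq> gf j \<Longrightarrow> \<not> (\<epsilon> = 0 \<and> nilpotent_hom \<phi>) \<Longrightarrow> mu1 X sc r m Es \<alpha> \<Phi> = 0"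
    and "\<epsilon> = 0 \<Longrightarrow> (\<And>v. v \<in> gf 1 \<Longrightarrow> \<phi> v = 0) \<Longrightarrow> (\<And>j. j \<in> {1..m} \<Longrightarrow> \<phi> ` gf (j + 1) \<subseteq> gf j) \<Longrightarrow>
      mu1 X sc r m Es \<alpha> \<Phi> < 0"
proof -
  \<comment> \<open>The same choice as the one inside \<open>minus_min_weight\<close>, so that
    unfolding \<open>mu1\<close> produces literally this \<open>D\<close>.\<close>
  define D where "D = (SOME D. splitting sc m gf D)"
  interpret sp: split_space sc m gf D
    unfolding D_def by (rule split_space_generic)
  \<comment> \<open>The embedding of the complex numbers is injective and multiplicative, so the
    image of 2 is no more a root of unity than 2 itself.\<close>
  have powi: "n = 0" if "emb 2 powi n = 1" for n
  proof -
    have "emb ((2::complex) ^ j) = emb 2 ^ j" for j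
      by (induction j) (simp_all add: emb_1 emb_mult)
    then have emb_power: "(emb 2 ^ j = 1) = ((2::complex) ^ j = 1)" for j
      using inj_emb emb_1 by (metis injD)
    have "emb 2 ^ nat \<bar>n\<bar> = 1"
      using that by (cases "n \<ge> 0") (simp_all add: power_int_def power_inverse)
    then have "(2::complex) ^ nat \<bar>n\<bar> = 1" by (simp only: emb_power)
    then have "(2::complex) powi int (nat \<bar>n\<bar>) = 2 powi 0" by (simp only: power_int_of_nat power_int_0_right)
    then have "int (nat \<bar>n\<bar>) = 0" by (rule two_powi_inject)
    then show ?thesis by simp
  qed
  have "mu1 X sc r m Es \<alpha> \<Phi> = - Min {\<chi>. \<exists>x\<in>weight_space sc m D \<gamma> (end_dual sc \<times> UNIV) rho_smul rho_act \<chi>. \<Phi> x \<noteq> 0}"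
    by (simp only: mu1_def minus_min_weight_def D_def Let_def)
  also have "{\<chi>. \<exists>x\<in>weight_space sc m D \<gamma> (end_dual sc \<times> UNIV) rho_smul rho_act \<chi>. \<Phi> x \<noteq> 0} =
    {\<gamma> i - \<gamma> j | i j. i \<in> {1..m+1} \<and> j \<in> {1..m+1} \<and> (\<exists>v\<in>D i. sp.proj j (\<phi> v) \<noteq> 0)}
      \<union> (if emb \<epsilon> * \<iota>2 1 = 0 then {} else {0})"
    by (rule sp.weights_nonvanishing[OF linear_\<phi> _ powi \<Phi>_coeffs(1) \<Phi>_eq]) (simp_all add: emb_eq_0_iff)
  finally have mu1: "mu1 X sc r m Es \<alpha> \<Phi> = - Min ({\<gamma> i - \<gamma> j | i j. i \<in> {1..m+1} \<and> j \<in> {1..m+1} \<and>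
      (\<exists>v\<in>D i. sp.proj j (\<phi> v) \<noteq> 0)} \<union> (if emb \<epsilon> * \<iota>2 1 = 0 then {} else {0}))" .
  have ne: "\<phi> \<noteq> (\<lambda>_. 0) \<or> emb \<epsilon> * \<iota>2 1 \<noteq> 0" using \<phi>_\<epsilon> \<Phi>_coeffs(2) by blast
  let ?inv = "\<forall>j\<in>{1..m+1}. \<phi> ` gf j \<subseteq> gf j"
  have sign_neg: "\<not> ?inv \<Longrightarrow> 0 < mu1 X sc r m Es \<alpha> \<Phi>"
    using sp.weight_signs(1)[where \<gamma> = \<gamma>, OF linear_\<phi> _ ne] \<gamma>_strict_mono unfolding mu1 neg_0_less_iff_less by blast
  have sign_inv: "?inv \<Longrightarrow> mu1 X sc r m Es \<alpha> \<Phi> \<le> 0"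
    using sp.weight_signs(2)[where \<gamma> = \<gamma>, OF linear_\<phi> _ ne] \<gamma>_strict_mono unfolding mu1 neg_le_0_iff_le by blast
  have sign_nilp: "mu1 X sc r m Es \<alpha> \<Phi> < 0 \<Longrightarrow> emb \<epsilon> * \<iota>2 1 = 0 \<and> (?inv \<longrightarrow> nilpotent_hom \<phi>)"
    using sp.weight_signs(3)[where \<gamma> = \<gamma>, OF linear_\<phi> _ ne] \<gamma>_strict_mono unfolding mu1 neg_less_0_iff_less by blast
  have sign_pos: "mu1 X sc r m Es \<alpha> \<Phi> < 0" if "emb \<epsilon> * \<iota>2 1 = 0"
    "\<And>i j v. i \<in> {1..m+1} \<Longrightarrow> j \<in> {1..m+1} \<Longrightarrow> i \<le> j \<Longrightarrow> v \<in> D i \<Longrightarrow> sp.proj j (\<phi> v) = 0"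
    unfolding mu1 neg_less_0_iff_less
    by (rule sp.weight_signs(4)[where \<gamma> = \<gamma>, OF linear_\<phi> _ ne])
      (fact \<gamma>_strict_mono, fact that(1), fact that(2))
  show "0 < mu1 X sc r m Es \<alpha> \<Phi>" if "\<not> (\<forall>j\<in>{1..m+1}. \<phi> ` gf j \<subseteq> gf j)"
    using that by (rule sign_neg)
  show "mu1 X sc r m Es \<alpha> \<Phi> = 0"
    if "\<forall>j\<in>{1..m+1}. \<phi> ` gf j \<subseteq> gf j" "\<not> (\<epsilon> = 0 \<and> nilpotent_hom \<phi>)"
    using sign_inv[OF that(1)] sign_nilp that \<Phi>_coeffs(2) by (meson antisym_conv2)
  show "mu1 X sc r m Es \<alpha> \<Phi> < 0"
    if "\<epsilon> = 0" and gf1: "\<And>v. v \<in> gf 1 \<Longrightarrow> \<phi> v = 0"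
      and lower: "\<And>j. j \<in> {1..m} \<Longrightarrow> \<phi> ` gf (j + 1) \<subseteq> gf j"
  proof -
    have "sp.proj j (\<phi> v) = 0" if ij: "i \<in> {1..m+1}" "j \<in> {1..m+1}" "i \<le> j" "v \<in> D i" for i j v
    proof -
      have v: "v \<in> gf i" unfolding sp.mem_W_iff[OF ij(1)] using sp.proj_D[OF ij(1) _ ij(4)] by simp
      show ?thesis
      proof (cases "i = 1")
        case True
        then show ?thesis using gf1 v sp.proj_0[OF ij(2)] by simp
      next
        case False
        then have i: "i - 1 \<in> {1..m}" "i - 1 \<in> {1..m+1}" "i - 1 + 1 = i" using ij(1) by auto
        then have "\<phi> v \<in> gf (i - 1)" using lower[OF i(1)] v by auto
        moreover have "i - 1 < j" using ij(3) i(3) by linarith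
        ultimately show ?thesis using sp.mem_W_iff[OF i(2)] ij(2) by blast
      qed
    qed
    then show ?thesis using sign_pos \<open>\<epsilon> = 0\<close> \<Phi>_coeffs(2) by blast
  qed
qed

text \<open>The increments of \<gamma> are \<open>r\<close> times the weights \<alpha>, so after
  exchanging the two summations \<open>mu2\<close> is a combination of the same \<alpha> as
  \<open>flag_M\<close>. The factor \<open>1 / z\<close> turns the exponents back into the
  \<beta>.\<close>

lemma flag_M_mu2:
  "flag_M X sc E m Es \<alpha> + 1 / of_nat z * mu2 X sc r x0 sw ev k rs n m Es \<alpha> s =
     (\<Sum>j=1..m. \<alpha> j * (pd E * of_nat (rk (Es j)) - pd (Es j) * of_nat r))"
proof -
  define D where "D = (SOME D. splitting sw m sf D)"
  interpret sp: complex_split_space sw m sf D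
    unfolding complex_split_space_def D_def by (rule split_space_special)
  obtain b c where "c \<noteq> 0"
    and b: "\<And>i. i \<in> {1..k} \<Longrightarrow> inj_on (b i) {..<rs i} \<and> sp.independent (b i ` {..<rs i}) \<and> sp.span (b i ` {..<rs i}) = V i"
    and s: "\<And>T. T \<in> sigma_space sw k rs n \<Longrightarrow> s T = c * T (\<lambda>(i, _, p). b i p)"
    using generator unfolding flag_generator_def by blast
  have mono: "\<gamma> i \<le> \<gamma> j" if "i \<in> {1..m+1}" "j \<in> {1..m+1}" "i \<le> j" for i j
    using \<gamma>_strict_mono[OF that(1,2)] that(3) by (cases "i = j") auto
  define dd where "dd i j = (of_nat (sp.dim (V i \<inter> sf j)) :: rat)" for i j
  have "mu2 X sc r x0 sw ev k rs n m Es \<alpha> s =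
      - Min {\<chi>. \<exists>T\<in>weight_space sw m D \<gamma> (sigma_space sw k rs n) sigma_smul sigma_act \<chi>. s T \<noteq> 0}"
    by (simp only: mu2_def minus_min_weight_def D_def Let_def)
  also have "Min {\<chi>. \<exists>T\<in>weight_space sw m D \<gamma> (sigma_space sw k rs n) sigma_smul sigma_act \<chi>. s T \<noteq> 0}
      = - (\<Sum>i=1..k. of_nat (n i) * sp.flag_weight \<gamma> (V i))"
    by (rule sp.sigma_weights[where \<gamma> = \<gamma> and b = b and V = V and c = c]) (fact mono, fact b, fact s, fact)
  also have "- \<dots> = of_nat z * (\<Sum>i=1..k. \<beta> i * sp.flag_weight \<gamma> (V i))"
    unfolding minus_minus sum_distrib_left
    by (intro sum.cong refl) (use of_nat_exponent weights in \<open>simp add: mult.assoc\<close>)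
  finally have "1 / of_nat z * mu2 X sc r x0 sw ev k rs n m Es \<alpha> s = (\<Sum>i=1..k. \<beta> i * sp.flag_weight \<gamma> (V i))"
    using common_denominator_props(1)[of k \<beta>] by simp
  also have "\<dots> = (\<Sum>i=1..k. \<Sum>j=1..m. \<alpha> j * (\<beta> i * (of_nat (rs i) * of_nat (rk (Es j)) - of_nat r * dd i j)))"
  proof (intro sum.cong refl)
    fix i assume i: "i \<in> {1..k}"
    have "sp.flag_weight \<gamma> (V i) = of_nat (rs i) * (\<Sum>j=1..m. \<alpha> j * of_nat (rk (Es j)))
        - (\<Sum>j=1..m. (of_nat r * \<alpha> j) * dd i j)"
      unfolding sp.flag_weight_def V[OF i] \<gamma>_top dd_def
      by (intro arg_cong2[where f = "(-)"] refl sum.cong) (simp only: \<gamma>_step)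
    also have "\<dots> = (\<Sum>j=1..m. \<alpha> j * (of_nat (rs i) * of_nat (rk (Es j)) - of_nat r * dd i j))"
      unfolding sum_distrib_left sum_subtractf[symmetric]
      by (intro sum.cong refl) (simp add: algebra_simps)
    finally show "\<beta> i * sp.flag_weight \<gamma> (V i) =
        (\<Sum>j=1..m. \<alpha> j * (\<beta> i * (of_nat (rs i) * of_nat (rk (Es j)) - of_nat r * dd i j)))"
      by (simp add: sum_distrib_left mult.left_commute)
  qed
  also have "\<dots> = (\<Sum>j=1..m. \<alpha> j * (\<Sum>i=1..k. \<beta> i * (of_nat (rs i) * of_nat (rk (Es j)) - of_nat r * dd i j)))"
    by (subst sum.swap) (simp only: sum_distrib_left)
  finally have mu2: "1 / of_nat z * mu2 X sc r x0 sw ev k rs n m Es \<alpha> s =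
      (\<Sum>j=1..m. \<alpha> j * (\<Sum>i=1..k. \<beta> i * (of_nat (rs i) * of_nat (rk (Es j)) - of_nat r * dd i j)))" .
  have "pd E * of_nat (rk (Es j)) - pd (Es j) * of_nat r =
      (of_int (bundle_degree X sc E) * of_nat (rk (Es j)) - of_int (bundle_degree X sc (Es j)) * of_nat r) +
      (\<Sum>i=1..k. \<beta> i * (of_nat (rs i) * of_nat (rk (Es j)) - of_nat r * dd i j))" for j
  proof -
    have "(\<Sum>i=1..k. \<beta> i * (of_nat (rs i) * of_nat (rk (Es j)) - of_nat r * dd i j)) =
        (\<Sum>i=1..k. \<beta> i * of_nat (rs i)) * of_nat (rk (Es j)) - (\<Sum>i=1..k. \<beta> i * dd i j) * of_nat r"
      unfolding sum_distrib_right sum_subtractf[symmetric]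
      by (intro sum.cong refl) (simp add: algebra_simps)
    moreover have "pd (Es j) = of_int (bundle_degree X sc (Es j)) + (\<Sum>i=1..k. \<beta> i * dd i j)"
      by (simp add: pardeg_def dd_def Int_commute)
    ultimately show ?thesis unfolding pardeg_E by (simp add: algebra_simps)
  qed
  then show ?thesis
    unfolding mu2 flag_M_def rank_E by (simp add: sum.distrib[symmetric] distrib_left[symmetric])
qed

end

end

section \<open>Asymptotic stability\<close>

lemma exists_large_multiplier:
  fixes a b :: rat
  assumes "0 < b"
  shows "\<exists>c>0. \<forall>t\<ge>c. 0 < a + t * b"
proof (intro exI[of _ "(\<bar>a\<bar> + 1) / b"] conjI allI impI)
  fix t assume "(\<bar>a\<bar> + 1) / b \<le> t"
  then have "\<bar>a\<bar> + 1 \<le> t * b" using assms by (simp add: pos_divide_le_eq)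
  then show "0 < a + t * b" by linarith
qed (use assms in simp)

context hitchin_pair
begin

text \<open>\<phi> sends each kernel into the preceding one, so only blocks that lower the index
  survive. All weights that occur are then positive, and \<open>mu1\<close> is minus the least of
  them. Saturation makes the kernels into subbundles.\<close>

lemma kernel_flag:
  assumes nilp: "nilpotent_hom \<phi>" and nz: "\<phi> \<noteq> (\<lambda>_. 0)" and "\<epsilon> = 0"
  obtains m Es \<alpha> where "weighted_flag X sc E m Es \<alpha>" "mu1 X sc r m Es \<alpha> \<Phi> < 0"
proof -
  interpret \<phi>: Vector_Spaces.linear sc sc \<phi> by (rule linear_\<phi>)
  define K where "K j = {v. (\<phi> ^^ j) v = 0}" for j :: nat
  have pow_add: "(\<phi> ^^ j) (u + v) = (\<phi> ^^ j) u + (\<phi> ^^ j) v" for j u v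
    by (induction j) (simp_all add: \<phi>.add)
  have pow_scale: "(\<phi> ^^ j) (sc c v) = sc c ((\<phi> ^^ j) v)" for j c v
    by (induction j) (simp_all add: \<phi>.scale)
  have pow_0: "(\<phi> ^^ j) 0 = 0" for j
    by (induction j) simp_all
  have K: "subspace (K j)" for j
    unfolding subspace_def K_def by (simp add: pow_add pow_scale pow_0)
  have K_Suc: "K j \<subseteq> K (Suc j)" for j by (auto simp: K_def)
  have K_shift: "v \<in> K (Suc j) \<Longrightarrow> \<phi> v \<in> K j" for v j
    by (simp add: K_def funpow_swap1)
  have K_0: "K 0 = {0}" by (simp add: K_def)
  define N where "N = (LEAST j. K j = UNIV)"
  have "\<exists>j. K j = UNIV"
  proof -
    obtain j where "\<phi> ^^ j = (\<lambda>_. 0)" using nilp by (auto simp: nilpotent_hom_def)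
    then show ?thesis by (intro exI[of _ j]) (simp add: K_def)
  qed
  then have N: "K N = UNIV" "\<And>j. K j = UNIV \<Longrightarrow> N \<le> j"
    unfolding N_def by (rule LeastI_ex, intro Least_le)
  have "K 1 \<noteq> UNIV" using nz by (auto simp: K_def)
  moreover have "K 0 \<noteq> UNIV" using nz \<phi>.zero by (auto simp: K_0 fun_eq_iff)
  ultimately have "N \<noteq> 0" "N \<noteq> 1" using N(1) by metis+
  \<comment> \<open>\<open>N\<close> is the nilpotency index. It exceeds 1 because \<phi> is
    nonzero, so a flag with \<open>N - 1\<close> proper steps is not empty.\<close>
  then have "2 \<le> N" by simp
  \<comment> \<open>Kernels of consecutive powers that agree once agree from there on. Hence the
    chain grows strictly until it reaches the whole space, as a flag requires.\<close>
  have stable: "K j = K (j + i)" if "K j = K (Suc j)" for i j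
  proof (induction i)
    case (Suc i)
    have "K (Suc (j + i)) \<subseteq> K (j + i)"
    proof
      fix v assume "v \<in> K (Suc (j + i))"
      then have "(\<phi> ^^ i) v \<in> K (Suc j)" by (simp add: K_def funpow_add[symmetric, THEN fun_cong, simplified])
      then have "(\<phi> ^^ i) v \<in> K j" using that by blast
      then show "v \<in> K (j + i)" by (simp add: K_def funpow_add)
    qed
    then show ?case using Suc K_Suc[of "j + i"] by auto
  qed simp
  have K_strict: "K j \<noteq> K (Suc j)" if "j < N" for j
  proof
    assume "K j = K (Suc j)"
    then have "K j = K N" using stable[of j "N - j"] that by simp
    then show False using N(1) N(2)[of j] that by simp
  qed
  define Es where "Es j = saturation E (K j)" for j
  have gf: "generic_fiber X (Es j) = K j" for j
    using generic_E by (simp add: Es_def generic_fiber_def stalk_saturation)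
  have flag: "weighted_flag X sc E (N - 1) Es (\<lambda>_. 1)"
    unfolding weighted_flag_def
  proof (intro conjI ballI allI impI)
    show "1 \<le> N - 1" using \<open>2 \<le> N\<close> by simp
    show "Es 0 U = zero_sheaf U" if "U \<in> nonempty_opens X" for U
      using sheaf_0[OF sheaf_E that] by (auto simp: Es_def saturation_def K_0 zero_sheaf_def)
    show "Es (N - 1 + 1) U = E U" for U
      using \<open>2 \<le> N\<close> N(1) by (simp add: Es_def saturation_def)
    show "subbundle X sc (Es j) E" for j
      unfolding Es_def by (rule subbundle_saturation[OF vector_bundle_E generic_E K])
    show "strict_subsheaf_of X (Es j) (Es (j + 1))" if "j \<le> N - 1" for j
    proof -
      have "\<exists>U\<in>nonempty_opens X. Es j U \<noteq> Es (j + 1) U"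
      proof (rule ccontr)
        assume "\<not> ?thesis"
        then have "generic_fiber X (Es j) = generic_fiber X (Es (j + 1))"
          unfolding generic_fiber_def stalk_def by (intro arg_cong[where f = Union]) auto
        then show False using gf K_strict[of j] that \<open>2 \<le> N\<close> by simp
      qed
      moreover have "subsheaf_of X (Es j) (Es (j + 1))"
        using K_Suc[of j] by (auto simp: subsheaf_of_def Es_def saturation_def)
      ultimately show ?thesis by (simp add: strict_subsheaf_of_def)
    qed
  qed simp
  have "mu1 X sc r (N - 1) Es (\<lambda>_. 1) \<Phi> < 0"
  proof (rule mu1_signs(3)[OF flag \<open>\<epsilon> = 0\<close>])
    show "\<phi> v = 0" if "v \<in> generic_fiber X (Es 1)" for v
      using that gf by (simp add: K_def)
    show "\<phi> ` generic_fiber X (Es (j + 1)) \<subseteq> generic_fiber X (Es j)" for j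
      unfolding gf using K_shift by auto
  qed
  then show thesis using that flag by blast
qed

lemma single_flag:
  assumes F: "subbundle X sc F E" "strict_subsheaf_of X zero_sheaf F" "strict_subsheaf_of X F E"
  obtains Es where "weighted_flag X sc E 1 Es (\<lambda>_. 1)" "Es 1 = F"
proof -
  \<comment> \<open>Both end terms are written as saturations so that
    \<open>subbundle_saturation\<close> applies to them.\<close>
  define Es where "Es = (\<lambda>j::nat. if j = 0 then saturation E {0} else if j = 1 then F else saturation E UNIV)"
  have zero: "saturation E {0} U = {0}" if "U \<in> nonempty_opens X" for U
    using sheaf_0[OF sheaf_E that] by (auto simp: saturation_def)
  have sat: "saturation E UNIV = E" by (simp add: saturation_def fun_eq_iff)
  have "weighted_flag X sc E 1 Es (\<lambda>_. 1)"
    unfolding weighted_flag_def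
  proof (intro conjI ballI allI impI)
    show "Es 0 U = zero_sheaf U" if "U \<in> nonempty_opens X" for U
      using zero[OF that] by (simp add: Es_def zero_sheaf_def)
    show "Es (1 + 1) U = E U" for U by (simp add: Es_def sat)
    show "subbundle X sc (Es j) E" for j
      using F(1) subbundle_saturation[OF vector_bundle_E generic_E subspace_single_0]
        subbundle_saturation[OF vector_bundle_E generic_E subspace_UNIV] by (simp add: Es_def)
    show "strict_subsheaf_of X (Es j) (Es (j + 1))" if "j \<le> 1" for j
    proof (cases "j = 0")
      case True
      have "strict_subsheaf_of X (saturation E {0}) F"
        using F(2) zero by (simp add: strict_subsheaf_of_def subsheaf_of_def zero_sheaf_def)
      then show ?thesis using True by (simp add: Es_def)
    next
      case False
      then have "j = 1" using that by simp
      then show ?thesis using F(3) by (simp add: Es_def sat)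
    qed
  qed simp_all
  moreover have "Es 1 = F" by (simp add: Es_def)
  ultimately show thesis by (rule that)
qed

lemma slope_iff:
  assumes cmp: "cmp = (\<le>) \<or> cmp = (<)" and F: "subbundle X sc F E" "strict_subsheaf_of X zero_sheaf F"
  shows "cmp (parabolic_slope X sc x0 sw ev k \<beta> V F) (parabolic_slope X sc x0 sw ev k \<beta> V E) \<longleftrightarrow>
    cmp 0 (pd E * of_nat (rk F) - pd F * of_nat r)"
proof -
  have pos: "(0::rat) < of_nat (rk F)" "(0::rat) < of_nat r" using rank_pos[OF F] by simp_all
  have "pd F / of_nat (rk F) \<le> pd E / of_nat r \<longleftrightarrow> 0 \<le> pd E * of_nat (rk F) - pd F * of_nat r"
    "pd F / of_nat (rk F) < pd E / of_nat r \<longleftrightarrow> 0 < pd E * of_nat (rk F) - pd F * of_nat r"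
    using pos by (simp_all add: pos_divide_le_eq pos_divide_less_eq pos_le_divide_eq pos_less_divide_eq)
  then show ?thesis using cmp by (auto simp: parabolic_slope_def rank_E)
qed

text \<open>\<open>cmp\<close> carries both versions at once. It follows from \<open><\<close> and
  implies \<open>\<le>\<close>, which suffices wherever a nonzero \<open>mu1\<close> decides; if
  \<open>mu1\<close> vanishes, the inequality no longer involves \<delta>1.\<close>

lemma asymptotic_condition_iff:
  assumes cmp: "cmp = (\<le>) \<or> cmp = (<)"
  shows "asymptotic_condition cmp X sc r x0 sw ev k rs n (1 / of_nat z) E A \<Phi> s \<longleftrightarrow>
    (\<epsilon> = 0 \<longrightarrow> \<not> nilpotent_hom \<phi>) \<and>
    (\<forall>F. invariant_subbundle X L sc E \<phi> F \<longrightarrow>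
       strict_subsheaf_of X zero_sheaf F \<longrightarrow> strict_subsheaf_of X F E \<longrightarrow>
       cmp (parabolic_slope X sc x0 sw ev k \<beta> V F) (parabolic_slope X sc x0 sw ev k \<beta> V E))"
    (is "?L \<longleftrightarrow> ?N \<and> ?F")
proof -
  let ?\<mu> = "\<lambda>m Es \<alpha>. mu1 X sc r m Es \<alpha> \<Phi>"
  let ?T = "\<lambda>m Es \<alpha>. \<Sum>j=1..m. \<alpha> j * (pd E * of_nat (rk (Es j)) - pd (Es j) * of_nat r)"
  have L_iff: "?L \<longleftrightarrow> (\<forall>m Es \<alpha>. weighted_flag X sc E m Es \<alpha> \<longrightarrow>
      (\<exists>c1>0. \<forall>\<delta>1\<ge>c1. cmp 0 (?T m Es \<alpha> + \<delta>1 * ?\<mu> m Es \<alpha>)))"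
  proof -
    have "flag_M X sc E m Es \<alpha> + \<delta>1 * ?\<mu> m Es \<alpha> + 1 / of_nat z * mu2 X sc r x0 sw ev k rs n m Es \<alpha> s =
        ?T m Es \<alpha> + \<delta>1 * ?\<mu> m Es \<alpha>" if "weighted_flag X sc E m Es \<alpha>" for m Es \<alpha> \<delta>1
      using flag_M_mu2[OF that] by linarith
    then show ?thesis
      unfolding asymptotic_condition_def by (simp only: decorated_swamp simp_thms cong: imp_cong)
  qed
  have le: "a \<le> b" if "cmp a b" for a b :: rat using cmp that by auto
  have less: "cmp a b" if "a < b" for a b :: rat using cmp that by auto
  show ?thesis
  proof
    assume "?L"
    then have L: "\<exists>c1>0. \<forall>\<delta>1\<ge>c1. cmp 0 (?T m Es \<alpha> + \<delta>1 * ?\<mu> m Es \<alpha>)"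
      if "weighted_flag X sc E m Es \<alpha>" for m Es \<alpha>
      using that unfolding L_iff by blast
    have N: ?N
    proof (intro impI notI)
      assume "\<epsilon> = 0" "nilpotent_hom \<phi>"
      then have "\<phi> \<noteq> (\<lambda>_. 0)" using \<phi>_\<epsilon> by blast
      then obtain m Es \<alpha> where flag: "weighted_flag X sc E m Es \<alpha>" and neg: "?\<mu> m Es \<alpha> < 0"
        by (rule kernel_flag[OF \<open>nilpotent_hom \<phi>\<close> _ \<open>\<epsilon> = 0\<close>])
      obtain c1 where c1: "\<forall>\<delta>1\<ge>c1. cmp 0 (?T m Es \<alpha> + \<delta>1 * ?\<mu> m Es \<alpha>)" using L[OF flag] by blast
      \<comment> \<open>A negative \<open>mu1\<close> eventually outweighs the remaining terms;
        \<open>max c1 c2\<close> lies in the range of both inequalities, which contradict each other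
        there.\<close>
      obtain c2 where c2: "\<forall>t\<ge>c2. 0 < - ?T m Es \<alpha> + t * - ?\<mu> m Es \<alpha>"
        using exists_large_multiplier[of "- ?\<mu> m Es \<alpha>" "- ?T m Es \<alpha>"] neg by auto
      have "cmp 0 (?T m Es \<alpha> + max c1 c2 * ?\<mu> m Es \<alpha>)" using c1 max.cobounded1 by blast
      then have "0 \<le> ?T m Es \<alpha> + max c1 c2 * ?\<mu> m Es \<alpha>" by (rule le)
      moreover have "0 < - ?T m Es \<alpha> + max c1 c2 * - ?\<mu> m Es \<alpha>" using c2 max.cobounded2 by blast
      ultimately show False by (simp only: mult_minus_right)
    qed
    moreover have ?F
    proof (intro allI impI)
      fix F assume inv: "invariant_subbundle X L sc E \<phi> F"
        and strict: "strict_subsheaf_of X zero_sheaf F" "strict_subsheaf_of X F E"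
      then have F: "subbundle X sc F E" by (simp add: invariant_subbundle_def)
      obtain Es where flag: "weighted_flag X sc E 1 Es (\<lambda>_. 1)" and Es: "Es 1 = F"
        by (rule single_flag[OF F strict])
      have "\<forall>j\<in>{1..1+1}. \<phi> ` generic_fiber X (Es j) \<subseteq> generic_fiber X (Es j)"
      proof
        fix j :: nat assume "j \<in> {1..1+1}"
        then consider "j = 1" | "j = 1 + 1" by fastforce
        then show "\<phi> ` generic_fiber X (Es j) \<subseteq> generic_fiber X (Es j)"
        proof cases
          case 1
          then show ?thesis using generic_fiber_invariant[OF inv] Es by simp
        next
          case 2
          then show ?thesis using gf_top[OF flag] by simp
        qed
      qed
      then have \<mu>: "?\<mu> 1 Es (\<lambda>_. 1) = 0" by (rule mu1_signs(2)[OF flag]) (use N in blast)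
      \<comment> \<open>As \<open>mu1\<close> is zero, every admissible \<delta>1 yields the same
        inequality, and \<open>c1\<close> itself is one.\<close>
      obtain c1 where "\<forall>\<delta>1\<ge>c1. cmp 0 (?T 1 Es (\<lambda>_. 1) + \<delta>1 * ?\<mu> 1 Es (\<lambda>_. 1))" using L[OF flag] by blast
      then have "cmp 0 (?T 1 Es (\<lambda>_. 1) + c1 * ?\<mu> 1 Es (\<lambda>_. 1))" by blast
      then have "cmp 0 (pd E * of_nat (rk F) - pd F * of_nat r)"
        using \<mu> Es by simp
      then show "cmp (parabolic_slope X sc x0 sw ev k \<beta> V F) (parabolic_slope X sc x0 sw ev k \<beta> V E)"
        by (simp only: slope_iff[OF cmp F strict(1)])
    qed
    ultimately show "?N \<and> ?F" ..
  next
    assume NF: "?N \<and> ?F"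
    show ?L
      unfolding L_iff
    proof (intro allI impI)
      fix m Es \<alpha> assume flag: "weighted_flag X sc E m Es \<alpha>"
      show "\<exists>c1>0. \<forall>\<delta>1\<ge>c1. cmp 0 (?T m Es \<alpha> + \<delta>1 * ?\<mu> m Es \<alpha>)"
      proof (cases "\<forall>j\<in>{1..m+1}. \<phi> ` generic_fiber X (Es j) \<subseteq> generic_fiber X (Es j)")
        case False
        then have "0 < ?\<mu> m Es \<alpha>" by (rule mu1_signs(1)[OF flag])
        then obtain c where "c > 0" "\<forall>t\<ge>c. 0 < ?T m Es \<alpha> + t * ?\<mu> m Es \<alpha>"
          using exists_large_multiplier by blast
        then show ?thesis using less by blast
      next
        case True
        then have \<mu>: "?\<mu> m Es \<alpha> = 0" by (rule mu1_signs(2)[OF flag]) (use NF in blast)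
        have terms: "cmp 0 (\<alpha> j * (pd E * of_nat (rk (Es j)) - pd (Es j) * of_nat r))" if j: "j \<in> {1..m}" for j
        proof -
          have sub: "subbundle X sc (Es j) E" using Es_subbundle[OF flag] j by simp
          have "\<phi> ` generic_fiber X (Es j) \<subseteq> generic_fiber X (Es j)" using True j by simp
          then have "invariant_subbundle X L sc E \<phi> (Es j)" by (rule invariant_subbundleI[OF sub])
          then have "cmp (parabolic_slope X sc x0 sw ev k \<beta> V (Es j)) (parabolic_slope X sc x0 sw ev k \<beta> V E)"
            using NF Es_proper[OF flag j] by blast
          then have "cmp 0 (pd E * of_nat (rk (Es j)) - pd (Es j) * of_nat r)"
            by (simp only: slope_iff[OF cmp sub Es_proper(1)[OF flag j]])
          then show ?thesis using cmp \<alpha>_pos[OF flag j] by (elim disjE) simp_all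
        qed
        have "cmp 0 (?T m Es \<alpha>)"
          using cmp
        proof
          assume eq: "cmp = (\<le>)"
          show ?thesis unfolding eq by (rule sum_nonneg) (rule terms[unfolded eq])
        next
          assume eq: "cmp = (<)"
          \<comment> \<open>A strict sum needs at least one summand, which \<open>1 \<le> m\<close>
            provides.\<close>
          show ?thesis
            unfolding eq by (rule sum_pos[OF _ _ terms[unfolded eq]]) (use m_pos[OF flag] in simp_all)
        qed
        \<comment> \<open>With \<open>mu1\<close> equal to zero any positive constant serves as
          \<open>c1\<close>.\<close>
        then show ?thesis using \<mu> by (intro exI[of _ 1]) simp
      qed
    qed
  qed
qed

end

theorem proposition5p4:
  fixes emb :: "complex \<Rightarrow> 'k::field" and X :: "'k set set" and x0 :: "'k set"
    and O1 L :: "('k, 'k) subsheaf" and l d :: int and r k :: nat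
    and rs :: "nat \<Rightarrow> nat" and \<beta> :: "nat \<Rightarrow> rat" and \<iota>1 \<iota>2 :: "'k \<Rightarrow> 'k"
    and sc :: "'k \<Rightarrow> 'v::ab_group_add \<Rightarrow> 'v" and sw :: "complex \<Rightarrow> 'w::ab_group_add \<Rightarrow> 'w"
    and E :: "('k, 'v) subsheaf" and \<phi> :: "'v \<Rightarrow> 'v" and \<epsilon> :: complex
    and ev :: "'v \<Rightarrow> 'w" and V :: "nat \<Rightarrow> 'w set" and s :: "'w form \<Rightarrow> complex"
  assumes curve: "smooth_projective_curve emb X" "x0 \<in> closed_points X"
    and O1: "line_bundle X O1" "bundle_degree X (*) O1 = 1"
    and L: "line_bundle X L"
    and flag_type: "\<forall>i\<in>{1..k}. 0 < rs i \<and> rs i < r" "\<forall>i\<in>{1..<k}. rs i < rs (i + 1)"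
    and weights: "\<forall>i\<in>{1..k}. 0 < \<beta> i" "(\<Sum>i=1..k. \<beta> i) < 1"
    and \<iota>1: "bundle_hom X (*) L (*) (line_bundle_power X O1 l) \<iota>1" "inj \<iota>1"
    and \<iota>2: "bundle_hom X (*) structure_sheaf (*) (line_bundle_power X O1 l) \<iota>2" "inj \<iota>2"
    and spaces: "vector_space sc" "vector_space sw"
    and fiber: "fiber_map emb X sc E x0 sw ev"
    and pair: "parabolic_Hitchin_pair X L sc r d x0 sw ev k rs E \<phi> \<epsilon> V"
    and generator: "flag_generator sw k rs (exponent k \<beta>) V s"
  shows
    "(asymptotically_semistable X sc r x0 sw ev k rs (exponent k \<beta>)
        (1 / of_nat (common_denominator k \<beta>))
        E (line_bundle_power X O1 l) (associated_hom emb \<iota>1 \<iota>2 \<phi> \<epsilon>) s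
      \<longleftrightarrow>
      (\<epsilon> = 0 \<longrightarrow> \<not> nilpotent_hom \<phi>) \<and>
      (\<forall>F. invariant_subbundle X L sc E \<phi> F \<longrightarrow>
           strict_subsheaf_of X zero_sheaf F \<longrightarrow> strict_subsheaf_of X F E \<longrightarrow>
           parabolic_slope X sc x0 sw ev k \<beta> V F \<le> parabolic_slope X sc x0 sw ev k \<beta> V E))
     \<and>
     (asymptotically_stable X sc r x0 sw ev k rs (exponent k \<beta>)
        (1 / of_nat (common_denominator k \<beta>))
        E (line_bundle_power X O1 l) (associated_hom emb \<iota>1 \<iota>2 \<phi> \<epsilon>) s
      \<longleftrightarrow>
      (\<epsilon> = 0 \<longrightarrow> \<not> nilpotent_hom \<phi>) \<and>
      (\<forall>F. invariant_subbundle X L sc E \<phi> F \<longrightarrow>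
           strict_subsheaf_of X zero_sheaf F \<longrightarrow> strict_subsheaf_of X F E \<longrightarrow>
           parabolic_slope X sc x0 sw ev k \<beta> V F < parabolic_slope X sc x0 sw ev k \<beta> V E))"
proof -
  have x0: "x0 \<in> X" using curve(2) by (simp add: closed_points_def)
  interpret curve emb X by (rule curve.intro[OF curve(1)])
  have A: "line_bundle X (line_bundle_power X O1 l)" by (rule line_bundle_line_bundle_power[OF O1(1)])
  interpret hitchin_pair emb X sc x0 "line_bundle_power X O1 l" L r k d rs \<beta> \<iota>1 \<iota>2 sw E \<phi> \<epsilon> ev V s
    by (intro hitchin_pair.intro curve_space.intro hitchin_pair_axioms.intro curve_axioms spaces
        x0 A L weights(1) \<iota>1 \<iota>2 fiber pair generator)
  \<comment> \<open>Semistability takes \<open>\<le>\<close> for \<open>cmp\<close>, stability takes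
    \<open><\<close>.\<close>
  show ?thesis by (intro conjI asymptotic_condition_iff disjI1 disjI2 refl)
qed

end
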